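(* Let $n\ge 2$, $L\ge 5$, $d\ge 1$ be integers, let $k>0$, and let $\mathcal G$ be the discrete torus $[\mathbb Z/L\mathbb Z]^n$ (nearest-neighbour graph). For every finite collection $\tilde{\mathcal L}$ of geodesic loops on $\mathcal G$ and every $U(d)$-connection modulus $A$ on $\mathcal G$, $$-\mathfrak A^{(\mathcal C,k)}\tau_A(\tilde{\mathcal L})=\Big[(d-1)S+V^+-V^-+B^{SM+}-B^{SM-}+\frac kd\,(B^{D+}-B^{D-})\Big]\tau_A(\tilde{\mathcal L}),$$ where $\mathfrak A^{(\mathcal C,k)}$ acts on $A\mapsto\tau_A(\tilde{\mathcal L})$ with $\tilde{\mathcal L}$ fixed, and the operators on the right-hand side act on $\tilde{\mathcal L}\mapsto\tau_A(\tilde{\mathcal L})$ with $A$ fixed.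
   Context: Loops. $E$ and $E^o$ are the sets of edges and oriented edges of $\mathcal G$. A based loop is a finite closed path $\xi=(\xi_0,\xi_1,\dots,\xi_p=\xi_0)$ with consecutive vertices adjacent; a loop is an equivalence class of based loops under cyclic shift. A geodesic loop is a loop without backtracking, including cyclically. Every loop $l$ has a reduced geodesic loop $l^R$, obtained by iteratively removing pairs of opposite consecutive edges (cyclically); it may be the trivial loop. A collection is a multiset. In collections of geodesic loops a trivial loop produced by reduction is kept as an element; it has no edge crossings. The set $\mathcal P$ of plaquettes is the set of geodesic loops of length 4 (for $L\ge5$: the elementary squares, each with both orientations). Each oriented edge is contained in $2(n-1)$ plaquettes. Occupation numbers. $N_{x,y}(l)$ is the number of crossings of the oriented edge $(x,y)$ by $l$; for a collection, $N_{x,y}(\mathcal L)=\sum_{l\in\mathcal L}N_{x,y}(l)$. Set $S=\sum_{(x,y)\in E^o}N_{x,y}$, $V^+=\sum_{\{x,y\}\in E}(N_{x,y}^2+N_{y,x}^2)$, $V^-=2\sum_{\{x,y\}\in E}N_{x,y}N_{y,x}$. These act by multiplication on functions of collections. Split-and-merge operators. A transition kernel $K$ acts on functions of collections by $KF(\mathcal L)=\sum_{\mathcal L'}K(\mathcal L,\mathcal L')F(\mathcal L')$. Terms with zero rate below are zero. $K^+_{(x,y)}$: choose uniformly and independently two of the $N_{x,y}$ crossings of $(x,y)$ by loops of the collection. If they belong to different loops, these are concatenated, each started at $x$ with its chosen crossing. If they are distinct and on the same loop, it is cut into two closed paths from $x$ to $x$, each starting with one of the chosen crossings, giving two loops. If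 they coincide, nothing changes. $B^{SM+}=\sum_{(x,y)\in E^o}N_{x,y}^2[K^+_{(x,y)}-I]$. $K^{-,R}_{x,y}$: if $N_{x,y}N_{y,x}>0$, choose uniformly a crossing of $(x,y)$ and, independently, uniformly a crossing of $(y,x)$. If they lie on the same loop, decompose it as: the crossing $(x,y)$, a bridge from $y$ to $y$, the crossing $(y,x)$, a bridge from $x$ to $x$; replace the loop by the two loops given by the two bridges. If they lie on different loops, decompose these as the crossing $(x,y)$ followed by a path $\alpha$ from $y$ to $x$, and the crossing $(y,x)$ followed by a path $\beta$ from $x$ to $y$; replace both loops by the single loop formed by $\alpha$ followed by $\beta$ (negative merge). Finally, replace every output loop by its reduced geodesic loop. $B^{SM-}=\sum_{(x,y)\in E^o}N_{x,y}N_{y,x}[K^{-,R}_{x,y}-I]$ (sum over ordered pairs). Deformation operators. $D^+_{(x,y)}$: choose uniformly one of the $N_{x,y}$ crossings of $(x,y)$ by loops of the collection, choose uniformly one of the $2(n-1)$ plaquettes containing $(x,y)$, and replace the loop carrying the chosen crossing by its concatenation with the plaquette, both started at $x$ with the crossing of $(x,y)$. $D^-_{(x,y)}$: choose uniformly one of the $N_{x,y}$ crossings of $(x,y)$, choose uniformly one of the $2(n-1)$ plaquettes containing $(y,x)$, and replace the loop carrying the chosen crossing by its negative merge with the plaquette (the chosen crossing of $(x,y)$ and the crossing of $(y,x)$ by the plaquette are cancelled), followed by reduction. $B^{D\pm}=\sum_{(x,y)\in E^o}2(n-1)N_{x,y}[D^\pm_{(x,y)}-I]$. Connections. A $U(d)$-connection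 is a map $m:E^o\to U(d)$ with $m(x,y)=m(y,x)^{-1}$; $\mathcal C$ is the set of connections. Connections $m,m'$ are equivalent if there is a map $h$ from the vertices to $U(d)$ with $m'(x,y)=h(y)^{-1}m(x,y)h(x)$; connection moduli are the equivalence classes. For a modulus $A$ with representative $m$ and a loop $l$ with based representative $(\xi_0,\dots,\xi_p=\xi_0)$, the holonomy $h_A(l)$ is the conjugacy class of $m(\xi_{p-1},\xi_p)\cdots m(\xi_0,\xi_1)$ (the identity for the trivial loop). Set $\tau_A(\tilde{\mathcal L})=\prod_{l\in\tilde{\mathcal L}}\mathrm{Tr}(h_A(l))$ (a trivial loop contributes the factor $d$), and $P(A)=\sum_{\eta\in\mathcal P}\mathrm{Tr}(h_A(\eta))$. Casimir operators. For an antihermitian matrix $W$ and smooth $f$ on $U(d)$, $\mathfrak L_Wf(g)=\lim_{\epsilon\to0}\epsilon^{-1}(f(e^{\epsilon W}g)-f(g))$, and $\mathfrak A=\sum_l\mathfrak L_{W_l}^2$ for any basis $(W_l)$ of the real vector space of antihermitian matrices orthonormal for $\mathrm{Tr}(WW^* )$. $\mathfrak A^{(\mathcal C)}=\sum_{\{x,y\}\in E}\mathfrak A^{(\{x,y\})}$, where, after choosing an orientation of each edge to identify $\mathcal C$ with $U(d)^E$, $\mathfrak A^{(\{x,y\})}$ is $\mathfrak A$ acting on the coordinate of the edge $\{x,y\}$; it does not depend on the orientations and acts on functions of moduli. $\Gamma^{(\mathcal C)}(f_1,f_2)=\frac12[\mathfrak A^{(\mathcal C)}(f_1f_2)-f_1\mathfrak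 A^{(\mathcal C)}f_2-f_2\mathfrak A^{(\mathcal C)}f_1]$. The modified Casimir operator is $$\mathfrak A^{(\mathcal C,k)}f=\mathfrak A^{(\mathcal C)}f+\frac kd\,\Gamma^{(\mathcal C)}(P,f).$$ It is self-adjoint with respect to the Yang-Mills measure, whose density with respect to Haar measure is proportional to $e^{\frac kdP}$. *)

theory Defs
  imports "HOL-Analysis.Analysis" "HOL-Probability.Probability_Mass_Function"
begin

text \<open>A graph is given by its set of oriented edges.  The discrete torus has vertices
  with coordinates in \<open>{0..<L}\<close>, the standard representatives of \<open>\<int>/L\<int>\<close>, and its dimension
  is the cardinality of the index type.\<close>

definition torus_verts :: "nat \<Rightarrow> (int ^ 'n) set" where
  "torus_verts L = {x. \<forall>i. 0 \<le> x $ i \<and> x $ i < int L}"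

definition torus :: "nat \<Rightarrow> ((int ^ 'n) \<times> (int ^ 'n)) set" where
  "torus L = {(x, y). x \<in> torus_verts L \<and> y \<in> torus_verts L \<and>
     (\<exists>i. (\<forall>j. j \<noteq> i \<longrightarrow> y $ j = x $ j) \<and>
          (y $ i = (x $ i + 1) mod int L \<or> x $ i = (y $ i + 1) mod int L))}"

definition edges :: "('v \<times> 'v) set \<Rightarrow> 'v set set" where
  "edges E = {{x, y} | x y. (x, y) \<in> E}"

definition orients :: "('v \<times> 'v) set \<Rightarrow> 'v set \<Rightarrow> ('v \<times> 'v) set" where
  "orients E e = {(x, y). (x, y) \<in> E \<and> {x, y} = e}"

text \<open>A based loop \<open>(\<xi>\<^sub>0, \<dots>, \<xi>\<^sub>p = \<xi>\<^sub>0)\<close> is encoded by the list \<open>[\<xi>\<^sub>0, \<dots>, \<xi>\<^sub>p\<^sub>-\<^sub>1]\<close>, so that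
  \<open>edge_at \<xi> i\<close> is its \<open>i\<close>-th step \<open>(\<xi>\<^sub>i, \<xi>\<^sub>i\<^sub>+\<^sub>1)\<close>.  The empty list is the trivial loop;
  it carries no base point, because the vertex to which a loop contracts depends on the order of
  the reductions.\<close>

definition edge_at :: "'v list \<Rightarrow> nat \<Rightarrow> 'v \<times> 'v" where
  "edge_at \<xi> i = (\<xi> ! i, \<xi> ! (Suc i mod length \<xi>))"

definition based_loops :: "('v \<times> 'v) set \<Rightarrow> 'v list set" where
  "based_loops E = {\<xi>. \<forall>i < length \<xi>. edge_at \<xi> i \<in> E}"

definition cyclic_shift :: "('v list \<times> 'v list) set" where
  "cyclic_shift = {(\<xi>, \<zeta>). \<exists>k. \<zeta> = rotate k \<xi>}"

type_synonym 'v loop = "'v list set"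

definition loop_of :: "'v list \<Rightarrow> 'v loop" where
  "loop_of \<xi> = cyclic_shift `` {\<xi>}"

definition loops :: "('v \<times> 'v) set \<Rightarrow> 'v loop set" where
  "loops E = based_loops E // cyclic_shift"

definition geodesic :: "'v loop \<Rightarrow> bool" where
  "geodesic l \<longleftrightarrow> (\<forall>\<xi>\<in>l. \<forall>i < length \<xi>.
     edge_at \<xi> (Suc i mod length \<xi>) \<noteq> prod.swap (edge_at \<xi> i))"

definition geodesic_loops :: "('v \<times> 'v) set \<Rightarrow> 'v loop set" where
  "geodesic_loops E = {l \<in> loops E. geodesic l}"

text \<open>Since \<open>l\<close> is closed under cyclic shifts, the two opposite consecutive edges may be taken to
  be the first two steps of a based representative.\<close>

definition reduction_step :: "'v loop \<Rightarrow> 'v loop \<Rightarrow> bool" where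
  "reduction_step l l' \<longleftrightarrow> (\<exists>\<xi>\<in>l. 2 \<le> length \<xi> \<and>
     edge_at \<xi> 1 = prod.swap (edge_at \<xi> 0) \<and> l' = loop_of (drop 2 \<xi>))"

text \<open>Iterated removal of backtracks is terminating and confluent, so there is exactly one loop
  to choose from.\<close>

definition reduced :: "'v loop \<Rightarrow> 'v loop" where
  "reduced l = (SOME l'. reduction_step\<^sup>*\<^sup>* l l' \<and> geodesic l')"

definition plaquettes :: "('v \<times> 'v) set \<Rightarrow> 'v loop set" where
  "plaquettes E = {l \<in> geodesic_loops E. \<forall>\<xi>\<in>l. length \<xi> = 4}"

text \<open>The number of crossings is the same for all based representatives.\<close>

definition crossings_loop :: "'v \<times> 'v \<Rightarrow> 'v loop \<Rightarrow> nat" where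
  "crossings_loop e l = (let \<xi> = (SOME \<xi>. \<xi> \<in> l) in card {i. i < length \<xi> \<and> edge_at \<xi> i = e})"

definition occ :: "'v \<times> 'v \<Rightarrow> 'v loop multiset \<Rightarrow> nat" where
  "occ e C = (\<Sum>l\<in>#C. crossings_loop e l)"

definition S_op :: "('v \<times> 'v) set \<Rightarrow> 'v loop multiset \<Rightarrow> nat" where
  "S_op E C = (\<Sum>e\<in>E. occ e C)"

definition V_plus :: "('v \<times> 'v) set \<Rightarrow> 'v loop multiset \<Rightarrow> nat" where
  "V_plus E C = (\<Sum>e\<in>edges E. \<Sum>a\<in>orients E e. (occ a C)\<^sup>2)"

definition V_minus :: "('v \<times> 'v) set \<Rightarrow> 'v loop multiset \<Rightarrow> nat" where
  "V_minus E C = 2 * (\<Sum>e\<in>edges E. \<Prod>a\<in>orients E e. occ a C)"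

text \<open>A kernel assigns to a collection the distribution of the new collection.\<close>

definition kernel_op :: "('c \<Rightarrow> 'c pmf) \<Rightarrow> ('c \<Rightarrow> complex) \<Rightarrow> 'c \<Rightarrow> complex" where
  "kernel_op K F C = measure_pmf.expectation (K C) F"

text \<open>To speak of individual crossings, a collection is listed by based representatives of its
  elements (repeated according to multiplicity); a crossing is then a pair \<open>(i, j)\<close>, namely step
  \<open>j\<close> of the \<open>i\<close>-th listed loop.  Only the resulting multiset of loops matters, so the law of the
  outcome does not depend on the listing.  When there is no crossing, \<open>pmf_of_set {}\<close> is
  unspecified, but it is then multiplied by a zero rate.\<close>

definition listing :: "'v loop multiset \<Rightarrow> 'v list list" where
  "listing C = (SOME bs. image_mset loop_of (mset bs) = C)"

definition crossings :: "'v \<times> 'v \<Rightarrow> 'v list list \<Rightarrow> (nat \<times> nat) set" where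
  "crossings e bs = {(i, j). i < length bs \<and> j < length (bs ! i) \<and> edge_at (bs ! i) j = e}"

definition offset :: "'v list \<Rightarrow> nat \<Rightarrow> nat \<Rightarrow> nat" where
  "offset \<xi> j j' = (j' + length \<xi> - j) mod length \<xi>"

definition K_plus :: "'v \<times> 'v \<Rightarrow> 'v loop multiset \<Rightarrow> 'v loop multiset pmf" where
  "K_plus e C = (let bs = listing C in
     do {
       (i, j) \<leftarrow> pmf_of_set (crossings e bs);
       (i', j') \<leftarrow> pmf_of_set (crossings e bs);
       return_pmf
         (if i \<noteq> i' then
            C - {#loop_of (bs ! i), loop_of (bs ! i')#}
              + {#loop_of (rotate j (bs ! i) @ rotate j' (bs ! i'))#}
          else if j \<noteq> j' then
            let \<xi> = rotate j (bs ! i); t = offset \<xi> j j' in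
            C - {#loop_of (bs ! i)#} + {#loop_of (take t \<xi>), loop_of (drop t \<xi>)#}
          else C)
     })"

text \<open>Removing the first element of a list representing a closed path started with a given
  crossing leaves the list of starting points of the remaining steps; this is how crossings are
  cancelled below.\<close>

definition K_minus :: "'v \<times> 'v \<Rightarrow> 'v loop multiset \<Rightarrow> 'v loop multiset pmf" where
  "K_minus e C = (let bs = listing C in
     do {
       (i, j) \<leftarrow> pmf_of_set (crossings e bs);
       (i', j') \<leftarrow> pmf_of_set (crossings (prod.swap e) bs);
       return_pmf
         (if i = i' then
            let \<xi> = rotate j (bs ! i); t = offset \<xi> j j' in
            C - {#loop_of (bs ! i)#}
              + {#reduced (loop_of (tl (take t \<xi>))), reduced (loop_of (drop (Suc t) \<xi>))#}
          else
            C - {#loop_of (bs ! i), loop_of (bs ! i')#}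
              + {#reduced (loop_of (tl (rotate j (bs ! i)) @ tl (rotate j' (bs ! i'))))#})
     })"

definition B_SM_plus ::
  "('v \<times> 'v) set \<Rightarrow> ('v loop multiset \<Rightarrow> complex) \<Rightarrow> 'v loop multiset \<Rightarrow> complex" where
  "B_SM_plus E F C = (\<Sum>e\<in>E. (of_nat (occ e C))\<^sup>2 * (kernel_op (K_plus e) F C - F C))"

definition B_SM_minus ::
  "('v \<times> 'v) set \<Rightarrow> ('v loop multiset \<Rightarrow> complex) \<Rightarrow> 'v loop multiset \<Rightarrow> complex" where
  "B_SM_minus E F C = (\<Sum>e\<in>E. of_nat (occ e C) * of_nat (occ (prod.swap e) C) *
     (kernel_op (K_minus e) F C - F C))"

definition plaquettes_at :: "('v \<times> 'v) set \<Rightarrow> 'v \<times> 'v \<Rightarrow> 'v loop set" where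
  "plaquettes_at E e = {\<eta> \<in> plaquettes E. 0 < crossings_loop e \<eta>}"

text \<open>The based representative of a loop starting with the crossing \<open>e\<close>; a plaquette crosses an
  oriented edge at most once, so for plaquettes it is unique.\<close>

definition start_at :: "'v \<times> 'v \<Rightarrow> 'v loop \<Rightarrow> 'v list" where
  "start_at e \<eta> = (SOME \<zeta>. \<zeta> \<in> \<eta> \<and> \<zeta> \<noteq> [] \<and> edge_at \<zeta> 0 = e)"

definition D_plus ::
  "('v \<times> 'v) set \<Rightarrow> 'v \<times> 'v \<Rightarrow> 'v loop multiset \<Rightarrow> 'v loop multiset pmf" where
  "D_plus E e C = (let bs = listing C in
     do {
       (i, j) \<leftarrow> pmf_of_set (crossings e bs);
       \<eta> \<leftarrow> pmf_of_set (plaquettes_at E e);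
       return_pmf (C - {#loop_of (bs ! i)#}
         + {#loop_of (rotate j (bs ! i) @ start_at e \<eta>)#})
     })"

definition D_minus ::
  "('v \<times> 'v) set \<Rightarrow> 'v \<times> 'v \<Rightarrow> 'v loop multiset \<Rightarrow> 'v loop multiset pmf" where
  "D_minus E e C = (let bs = listing C in
     do {
       (i, j) \<leftarrow> pmf_of_set (crossings e bs);
       \<eta> \<leftarrow> pmf_of_set (plaquettes_at E (prod.swap e));
       return_pmf (C - {#loop_of (bs ! i)#}
         + {#reduced (loop_of (tl (rotate j (bs ! i)) @ tl (start_at (prod.swap e) \<eta>)))#})
     })"

definition B_D_plus ::
  "nat \<Rightarrow> ((int ^ 'n) loop multiset \<Rightarrow> complex) \<Rightarrow> (int ^ 'n) loop multiset \<Rightarrow> complex" where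
  "B_D_plus L F C = (\<Sum>e\<in>torus L. 2 * (of_nat CARD('n) - 1) * of_nat (occ e C) *
     (kernel_op (D_plus (torus L) e) F C - F C))"

definition B_D_minus ::
  "nat \<Rightarrow> ((int ^ 'n) loop multiset \<Rightarrow> complex) \<Rightarrow> (int ^ 'n) loop multiset \<Rightarrow> complex" where
  "B_D_minus L F C = (\<Sum>e\<in>torus L. 2 * (of_nat CARD('n) - 1) * of_nat (occ e C) *
     (kernel_op (D_minus (torus L) e) F C - F C))"

definition adj :: "complex ^ 'd ^ 'd \<Rightarrow> complex ^ 'd ^ 'd" where
  "adj g = (\<chi> i j. cnj (g $ j $ i))"

definition unitary_group :: "(complex ^ 'd ^ 'd) set" where
  "unitary_group = {g. g ** adj g = mat 1 \<and> adj g ** g = mat 1}"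

type_synonym ('v, 'd) connection = "'v \<times> 'v \<Rightarrow> complex ^ 'd ^ 'd"

definition connections :: "('v \<times> 'v) set \<Rightarrow> ('v, 'd::finite) connection set" where
  "connections E = {m \<in> E \<rightarrow>\<^sub>E unitary_group.
     \<forall>(x, y)\<in>E. m (x, y) = matrix_inv (m (y, x))}"

definition gauge_equiv ::
  "('v \<times> 'v) set \<Rightarrow> (('v, 'd::finite) connection \<times> ('v, 'd::finite) connection) set" where
  "gauge_equiv E = {(m, m'). m \<in> connections E \<and> m' \<in> connections E \<and>
     (\<exists>h. (\<forall>x. h x \<in> unitary_group) \<and>
          (\<forall>(x, y)\<in>E. m' (x, y) = matrix_inv (h y) ** m (x, y) ** h x))}"

definition modulus :: "('v \<times> 'v) set \<Rightarrow> ('v, 'd::finite) connection \<Rightarrow> ('v, 'd::finite) connection set" where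
  "modulus E m = gauge_equiv E `` {m}"

definition moduli :: "('v \<times> 'v) set \<Rightarrow> ('v, 'd::finite) connection set set" where
  "moduli E = connections E // gauge_equiv E"

text \<open>The product \<open>m(\<xi>\<^sub>p\<^sub>-\<^sub>1,\<xi>\<^sub>p) \<cdots> m(\<xi>\<^sub>0,\<xi>\<^sub>1)\<close>: later steps multiply on the left.\<close>

definition based_holonomy :: "('v, 'd::finite) connection \<Rightarrow> 'v list \<Rightarrow> complex ^ 'd ^ 'd" where
  "based_holonomy m \<xi> = foldl (\<lambda>g i. m (edge_at \<xi> i) ** g) (mat 1) [0..<length \<xi>]"

definition conj_class :: "complex ^ 'd ^ 'd \<Rightarrow> (complex ^ 'd ^ 'd) set" where
  "conj_class g = {u ** g ** matrix_inv u | u. u \<in> unitary_group}"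

text \<open>For a modulus \<open>A\<close> and a loop \<open>l\<close>, the conjugacy classes in this union all coincide.\<close>

definition holonomy :: "('v, 'd::finite) connection set \<Rightarrow> 'v loop \<Rightarrow> (complex ^ 'd ^ 'd) set" where
  "holonomy A l = (\<Union>m\<in>A. \<Union>\<xi>\<in>l. conj_class (based_holonomy m \<xi>))"

definition class_trace :: "(complex ^ 'd ^ 'd) set \<Rightarrow> complex" where
  "class_trace K = the_elem (trace ` K)"

definition tau :: "('v, 'd::finite) connection set \<Rightarrow> 'v loop multiset \<Rightarrow> complex" where
  "tau A C = (\<Prod>l\<in>#C. class_trace (holonomy A l))"

definition plaq_sum :: "('v \<times> 'v) set \<Rightarrow> ('v, 'd::finite) connection set \<Rightarrow> complex" where
  "plaq_sum E A = (\<Sum>\<eta>\<in>plaquettes E. class_trace (holonomy A \<eta>))"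

definition mat_exp :: "complex ^ 'd ^ 'd \<Rightarrow> complex ^ 'd ^ 'd" where
  "mat_exp W = (\<Sum>k. (1 / fact k) *\<^sub>R ((((**) W) ^^ k) (mat 1)))"

definition lie_deriv ::
  "complex ^ 'd ^ 'd \<Rightarrow> (complex ^ 'd ^ 'd \<Rightarrow> complex) \<Rightarrow> complex ^ 'd ^ 'd \<Rightarrow> complex" where
  "lie_deriv W f g =
     Lim (at (0::real)) (\<lambda>\<epsilon>. (f (mat_exp (\<epsilon> *\<^sub>R W) ** g) - f g) / of_real \<epsilon>)"

definition antihermitian :: "(complex ^ 'd ^ 'd) set" where
  "antihermitian = {W. adj W = - W}"

text \<open>\<open>independent\<close> and \<open>span\<close> are those of the real vector space structure.\<close>

definition orthonormal_basis :: "(complex ^ 'd ^ 'd) set \<Rightarrow> bool" where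
  "orthonormal_basis B \<longleftrightarrow> independent B \<and> span B = antihermitian \<and>
     (\<forall>W\<in>B. \<forall>W'\<in>B. trace (W ** adj W') = (if W = W' then 1 else 0))"

definition casimir ::
  "(complex ^ 'd ^ 'd) set \<Rightarrow> (complex ^ 'd ^ 'd \<Rightarrow> complex) \<Rightarrow> complex ^ 'd ^ 'd \<Rightarrow> complex" where
  "casimir B f g = (\<Sum>W\<in>B. lie_deriv W (lie_deriv W f) g)"

text \<open>An orientation of the edges identifies a connection with its values on the chosen
  orientations; changing the coordinate at \<open>(x, y)\<close> also changes the value at \<open>(y, x)\<close>.\<close>

definition orientation :: "('v \<times> 'v) set \<Rightarrow> ('v set \<Rightarrow> 'v \<times> 'v) \<Rightarrow> bool" where
  "orientation E \<sigma> \<longleftrightarrow> (\<forall>e\<in>edges E. \<sigma> e \<in> orients E e)"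

definition set_coord ::
  "'v \<times> 'v \<Rightarrow> complex ^ 'd ^ 'd \<Rightarrow> ('v, 'd::finite) connection \<Rightarrow> ('v, 'd::finite) connection" where
  "set_coord a g m = m(a := g, prod.swap a := matrix_inv g)"

definition casimir_edge ::
  "(complex ^ 'd ^ 'd) set \<Rightarrow> 'v \<times> 'v \<Rightarrow>
     (('v, 'd::finite) connection \<Rightarrow> complex) \<Rightarrow> ('v, 'd::finite) connection \<Rightarrow> complex" where
  "casimir_edge B a f m = casimir B (\<lambda>g. f (set_coord a g m)) (m a)"

definition casimir_conn ::
  "(complex ^ 'd ^ 'd) set \<Rightarrow> ('v \<times> 'v) set \<Rightarrow> ('v set \<Rightarrow> 'v \<times> 'v) \<Rightarrow>
     (('v, 'd::finite) connection \<Rightarrow> complex) \<Rightarrow> ('v, 'd::finite) connection \<Rightarrow> complex" where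
  "casimir_conn B E \<sigma> f m = (\<Sum>e\<in>edges E. casimir_edge B (\<sigma> e) f m)"

definition Gamma_conn ::
  "(complex ^ 'd ^ 'd) set \<Rightarrow> ('v \<times> 'v) set \<Rightarrow> ('v set \<Rightarrow> 'v \<times> 'v) \<Rightarrow>
     (('v, 'd::finite) connection \<Rightarrow> complex) \<Rightarrow> (('v, 'd::finite) connection \<Rightarrow> complex) \<Rightarrow>
     ('v, 'd::finite) connection \<Rightarrow> complex" where
  "Gamma_conn B E \<sigma> f1 f2 m = 1 / 2 *
     (casimir_conn B E \<sigma> (\<lambda>m'. f1 m' * f2 m') m
      - f1 m * casimir_conn B E \<sigma> f2 m - f2 m * casimir_conn B E \<sigma> f1 m)"

text \<open>Functions of moduli are regarded as functions of connections through \<open>modulus\<close>.\<close>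

definition casimir_mod ::
  "(complex ^ 'd ^ 'd) set \<Rightarrow> ('v \<times> 'v) set \<Rightarrow> ('v set \<Rightarrow> 'v \<times> 'v) \<Rightarrow> real \<Rightarrow>
     (('v, 'd::finite) connection \<Rightarrow> complex) \<Rightarrow> ('v, 'd::finite) connection \<Rightarrow> complex" where
  "casimir_mod B E \<sigma> k f m = casimir_conn B E \<sigma> f m
     + of_real k / of_nat CARD('d) * Gamma_conn B E \<sigma> (\<lambda>m'. plaq_sum E (modulus E m')) f m"

end

theory Submission
  imports Defs
begin

text \<open>
  Why the identity holds. Read each loop as a cyclic word in oriented edges; then \<open>\<tau>\<close> is a product of
  traces of words in the unitary matrices \<open>m e\<close>, where reversing \<open>e\<close> inverts the matrix. Fix an edge \<open>a\<close> and
  an antihermitian direction \<open>W\<close>. Replacing \<open>m a\<close> by \<open>exp (\<epsilon> W) m a\<close> inserts, to first order, a factor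
  \<open>W\<close> at the far end of every crossing of \<open>a\<close>, and a factor \<open>-W\<close> at the near end of every crossing of the
  reversed edge: both are the same endpoint of the edge. A second differentiation inserts a second \<open>W\<close>, so
  the Casimir operator is a signed sum over ordered pairs of crossings of the edge.

  Summing over an orthonormal basis eliminates \<open>W\<close>. From \<open>\<Sum> tr (X W) W = - X\<close>
  (\<open>basis_completeness\<close>) one gets the fusion rules
  \<open>\<Sum> tr (W X) tr (W Y) = - tr (X Y)\<close> and \<open>\<Sum> tr (W X W Y) = - tr X tr Y\<close>: a pair of crossings on
  different loops merges these loops, a pair on one loop splits it. If the two crossings have the same
  direction, the result is the positive move; if they have opposite directions, the two steps meet and
  cancel, which is the negative move, with the opposite sign (\<open>merge_word\<close>, \<open>split_word\<close>). The reduction that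
  follows a negative move does not change traces, since \<open>m\<close> of a backtrack is the identity
  (\<open>reduced_trace\<close>). A crossing paired with itself splits off a trivial loop and contributes \<open>d \<tau>\<close>, while
  the positive kernel gives it the value \<open>\<tau>\<close>; this is the origin of \<open>(d - 1) S\<close>. The rates
  \<open>N\<^bsub>x,y\<^esub>\<^sup>2\<close> and \<open>N\<^bsub>x,y\<^esub> N\<^bsub>y,x\<^esub>\<close> turn the averages over
  pairs into sums, and \<open>V\<^sup>+\<close> and \<open>V\<^sup>-\<close> compensate the identities subtracted in the generators
  (\<open>casimir_conn_tau\<close>).

  In \<open>\<Gamma> (P, \<tau>)\<close> only products of first derivatives survive. Thus only merges of a crossing of the
  collection with a crossing of a plaquette occur, and these are the deformations (\<open>Gamma_conn_tau\<close>). Their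
  rates match because on the torus with \<open>L \<ge> 5\<close> every oriented edge lies on exactly \<open>2 (n - 1)\<close>
  plaquettes (\<open>card_plaquettes_at_torus\<close>) and each of them crosses it once.
\<close>

section \<open>Unitary matrices and the matrix exponential\<close>

lemma adj_nth [simp]: "adj g $ i $ j = cnj (g $ j $ i)"
  by (simp add: adj_def)

lemma adj_mult: "adj (g ** h) = adj h ** adj g"
  by (simp add: vec_eq_iff matrix_matrix_mult_def mult.commute)

lemma matrix_add_mult_distrib:
  fixes A B C :: "complex ^ 'd ^ 'd"
  shows "(A + B) ** C = A ** C + B ** C" "C ** (A + B) = C ** A + C ** B"
  by (simp_all add: vec_eq_iff matrix_matrix_mult_def distrib_left distrib_right sum.distrib)

lemma adj_adj [simp]: "adj (adj g) = g"
  by (simp add: vec_eq_iff)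

lemma adj_mat_1 [simp]: "adj (mat 1) = mat 1"
  by (auto simp: vec_eq_iff mat_def)

lemma matrix_inv_eqI:
  fixes g h :: "complex ^ 'd ^ 'd"
  assumes "g ** h = mat 1" "h ** g = mat 1"
  shows "matrix_inv g = h"
proof -
  have "g ** matrix_inv g = mat 1 \<and> matrix_inv g ** g = mat 1"
    unfolding matrix_inv_def by (rule someI[of _ h]) (use assms in simp)
  then have "h ** (g ** matrix_inv g) = h" by simp
  then show ?thesis using assms by (simp add: matrix_mul_assoc)
qed

lemma unitary_inv: "g \<in> unitary_group \<Longrightarrow> matrix_inv g = adj g"
  by (rule matrix_inv_eqI) (auto simp: unitary_group_def)

lemma unitary_cancel:
  assumes "g \<in> unitary_group"
  shows "g ** adj g = mat 1" "adj g ** g = mat 1"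
  using assms by (auto simp: unitary_group_def)

lemma unitary_adj: "g \<in> unitary_group \<Longrightarrow> adj g \<in> unitary_group"
  by (auto simp: unitary_group_def)

lemma unitary_mat_1: "mat 1 \<in> unitary_group"
  by (auto simp: unitary_group_def)

lemma unitary_mult:
  assumes "g \<in> unitary_group" "h \<in> unitary_group"
  shows "g ** h \<in> unitary_group"
proof -
  have "g ** h ** (adj h ** adj g) = g ** (h ** adj h) ** adj g"
    "adj h ** adj g ** (g ** h) = adj h ** (adj g ** g) ** h"
    by (simp_all only: matrix_mul_assoc)
  then show ?thesis using assms by (simp add: unitary_group_def adj_mult)
qed

text \<open>Entrywise, so that the rules for complex-valued functions apply to each summand of a matrix
  product.\<close>

definition mat_deriv :: "(real \<Rightarrow> complex ^ 'd ^ 'd) \<Rightarrow> complex ^ 'd ^ 'd \<Rightarrow> real \<Rightarrow> bool" where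
  "mat_deriv M D t \<longleftrightarrow> (\<forall>i j. ((\<lambda>\<epsilon>. M \<epsilon> $ i $ j) has_vector_derivative D $ i $ j) (at t))"

lemma mat_deriv_const: "mat_deriv (\<lambda>_. M) 0 t"
  by (simp add: mat_deriv_def)

lemma mat_deriv_mult:
  assumes "mat_deriv M M' t" "mat_deriv N N' t"
  shows "mat_deriv (\<lambda>\<epsilon>. M \<epsilon> ** N \<epsilon>) (M' ** N t + M t ** N') t"
  unfolding mat_deriv_def
proof (intro allI)
  fix i j
  have "((\<lambda>\<epsilon>. \<Sum>k\<in>UNIV. M \<epsilon> $ i $ k * N \<epsilon> $ k $ j) has_vector_derivative
      (\<Sum>k\<in>UNIV. M t $ i $ k * N' $ k $ j + M' $ i $ k * N t $ k $ j)) (at t)"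
    using assms by (intro has_vector_derivative_sum has_vector_derivative_mult)
      (auto simp: mat_deriv_def)
  then show "((\<lambda>\<epsilon>. (M \<epsilon> ** N \<epsilon>) $ i $ j) has_vector_derivative
      (M' ** N t + M t ** N') $ i $ j) (at t)"
    by (simp add: matrix_matrix_mult_def sum.distrib add.commute)
qed

lemma mat_deriv_adj:
  assumes "mat_deriv M M' t"
  shows "mat_deriv (\<lambda>\<epsilon>. adj (M \<epsilon>)) (adj M') t"
  using assms by (auto simp: mat_deriv_def intro!: has_vector_derivative_cnj)

lemma has_vector_derivative_trace:
  assumes "mat_deriv M M' t"
  shows "((\<lambda>\<epsilon>. trace (M \<epsilon>)) has_vector_derivative trace M') (at t)"
  unfolding trace_def using assms by (intro has_vector_derivative_sum) (auto simp: mat_deriv_def)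

abbreviation mat_pow :: "complex ^ 'd ^ 'd \<Rightarrow> nat \<Rightarrow> complex ^ 'd ^ 'd" where
  "mat_pow W k \<equiv> (((**) W) ^^ k) (mat 1)"

text \<open>The bound is crude, but it is geometric in \<open>k\<close>, as the exponential series requires.\<close>

lemma norm_mat_pow_le:
  "norm (mat_pow W k $ i $ j) \<le> (\<Sum>p\<in>UNIV. \<Sum>q\<in>UNIV. norm (W $ p $ q)) ^ k"
proof (induction k arbitrary: i)
  case 0
  then show ?case by (simp add: mat_def)
next
  case (Suc k)
  let ?M = "\<Sum>p\<in>UNIV. \<Sum>q\<in>UNIV. norm (W $ p $ q)"
  have "norm (mat_pow W (Suc k) $ i $ j) \<le> (\<Sum>l\<in>UNIV. norm (W $ i $ l) * ?M ^ k)"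
    by (simp add: matrix_matrix_mult_def norm_mult)
      (intro sum_norm_le order.trans[OF norm_mult_ineq] mult_left_mono Suc.IH norm_ge_zero)
  also have "\<dots> = (\<Sum>l\<in>UNIV. norm (W $ i $ l)) * ?M ^ k"
    by (simp add: sum_distrib_right)
  also have "\<dots> \<le> ?M * ?M ^ k"
    by (intro mult_right_mono member_le_sum[where f = "\<lambda>p. \<Sum>l\<in>UNIV. norm (W $ p $ l)"])
      (auto intro!: sum_nonneg zero_le_power)
  finally show ?case by simp
qed

lemma scaleR_entry: "(r *\<^sub>R M :: complex ^ 'd ^ 'd) $ i $ j = of_real r * M $ i $ j"
  unfolding vector_scaleR_component by (rule scaleR_conv_of_real)

lemma mat_pow_scaleR: "mat_pow (\<epsilon> *\<^sub>R W) k = (\<epsilon> ^ k) *\<^sub>R mat_pow W k"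
proof (induction k)
  case (Suc k)
  have "(\<epsilon> *\<^sub>R W) ** (\<epsilon> ^ k *\<^sub>R mat_pow W k) = (\<epsilon> ^ Suc k) *\<^sub>R (W ** mat_pow W k)"
    by (simp add: vec_eq_iff matrix_matrix_mult_def scaleR_entry sum_distrib_left ac_simps
        del: vector_scaleR_component)
  then show ?case by (simp add: Suc)
qed simp

definition exp_coeff :: "complex ^ 'd ^ 'd \<Rightarrow> 'd \<Rightarrow> 'd \<Rightarrow> nat \<Rightarrow> complex" where
  "exp_coeff W i j k = mat_pow W k $ i $ j / fact k"

lemma exp_coeff_summable: "summable (\<lambda>k. exp_coeff W i j k * z ^ k)"
proof (rule summable_comparison_test')
  let ?M = "\<Sum>p\<in>UNIV. \<Sum>q\<in>UNIV. norm (W $ p $ q)"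
  show "summable (\<lambda>k. inverse (fact k) * (?M * norm z) ^ k)"
    by (rule summable_exp)
  show "norm (exp_coeff W i j k * z ^ k) \<le> inverse (fact k) * (?M * norm z) ^ k" for k
    using mult_right_mono[OF norm_mat_pow_le[of k W i j], of "norm z ^ k / fact k"]
    by (simp add: exp_coeff_def norm_mult norm_power norm_divide power_mult_distrib field_simps)
qed

lemma mat_exp_entry:
  "mat_exp (\<epsilon> *\<^sub>R W) $ i $ j = (\<Sum>k. exp_coeff W i j k * of_real \<epsilon> ^ k)"
proof -
  let ?f = "\<lambda>k. (1 / fact k) *\<^sub>R mat_pow (\<epsilon> *\<^sub>R W) k"
  have entry: "?f k $ i $ j = exp_coeff W i j k * of_real \<epsilon> ^ k" for i j k
    by (simp add: mat_pow_scaleR exp_coeff_def scaleR_entry del: vector_scaleR_component)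
  have "?f sums (\<chi> i j. \<Sum>k. exp_coeff W i j k * of_real \<epsilon> ^ k)"
    unfolding sums_def
  proof (intro vec_tendstoI)
    fix i j
    have "(\<lambda>k. exp_coeff W i j k * of_real \<epsilon> ^ k) sums (\<Sum>k. exp_coeff W i j k * of_real \<epsilon> ^ k)"
      by (rule summable_sums[OF exp_coeff_summable])
    then show "(\<lambda>n. (\<Sum>k<n. ?f k) $ i $ j) \<longlonglongrightarrow>
        (\<chi> i j. \<Sum>k. exp_coeff W i j k * of_real \<epsilon> ^ k) $ i $ j"
      by (simp add: sums_def entry del: vector_scaleR_component)
  qed
  then show ?thesis by (simp add: mat_exp_def sums_iff)
qed

text \<open>Each entry is a power series in the parameter, and termwise differentiation shifts its
  coefficients, which amounts to one more factor \<open>W\<close> on the left.\<close>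

lemma mat_deriv_mat_exp:
  "mat_deriv (\<lambda>\<epsilon>. mat_exp (\<epsilon> *\<^sub>R W)) (W ** mat_exp (t *\<^sub>R W)) t"
  unfolding mat_deriv_def
proof (intro allI)
  fix i j
  have "((\<lambda>z. \<Sum>k. exp_coeff W i j k * z ^ k) has_field_derivative
      (\<Sum>k. diffs (exp_coeff W i j) k * of_real t ^ k)) (at (of_real t))"
    by (rule termdiffs_strong_converges_everywhere[OF exp_coeff_summable])
  moreover have "diffs (exp_coeff W i j) k * z ^ k =
      (\<Sum>l\<in>UNIV. W $ i $ l * (exp_coeff W l j k * z ^ k))" for k z
    by (simp add: diffs_def exp_coeff_def matrix_matrix_mult_def sum_distrib_left
        sum_distrib_right sum_divide_distrib mult.assoc del: of_nat_Suc)
  moreover have "(\<Sum>k. \<Sum>l\<in>UNIV. W $ i $ l * (exp_coeff W l j k * of_real t ^ k)) =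
      (W ** mat_exp (t *\<^sub>R W)) $ i $ j"
    by (simp add: matrix_matrix_mult_def mat_exp_entry suminf_sum suminf_mult
        summable_mult exp_coeff_summable)
  ultimately have "((\<lambda>z. \<Sum>k. exp_coeff W i j k * z ^ k) has_field_derivative
      (W ** mat_exp (t *\<^sub>R W)) $ i $ j) (at (of_real t))"
    by simp
  from has_vector_derivative_real_field[OF this]
  show "((\<lambda>\<epsilon>. mat_exp (\<epsilon> *\<^sub>R W) $ i $ j) has_vector_derivative
      (W ** mat_exp (t *\<^sub>R W)) $ i $ j) (at t)"
    by (simp add: mat_exp_entry)
qed

lemma mat_exp_0: "mat_exp (0 *\<^sub>R W) = mat 1"
proof -
  have "(\<Sum>k. exp_coeff W i j k * of_real 0 ^ k) = mat 1 $ i $ j" for i j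
    using powser_zero[of "exp_coeff W i j"] by (simp add: exp_coeff_def)
  then show ?thesis by (simp only: vec_eq_iff mat_exp_entry) simp
qed

text \<open>The derivative of \<open>adj U ** U\<close> along \<open>U t = exp (t W)\<close> is
  \<open>adj U ** (adj W + W) ** U = 0\<close>, and the product is the identity at \<open>t = 0\<close>. No functional equation of
  the exponential is involved.\<close>

lemma mat_exp_unitary:
  fixes W :: "complex ^ 'd ^ 'd"
  assumes "W \<in> antihermitian"
  shows "mat_exp (t *\<^sub>R W) \<in> unitary_group"
proof -
  define U where "U t = mat_exp (t *\<^sub>R W)" for t
  have dU: "mat_deriv U (W ** U t) t" for t
    unfolding U_def by (rule mat_deriv_mat_exp)
  have aW: "adj W = - W" using assms by (simp add: antihermitian_def)
  have zero: "adj (W ** U t) ** U t + adj (U t) ** (W ** U t) = 0" for t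
  proof -
    have "adj (W ** U t) ** U t + adj (U t) ** (W ** U t)
        = adj (U t) ** (adj W + W) ** U t"
      by (simp only: adj_mult matrix_add_mult_distrib matrix_mul_assoc)
    then show ?thesis by (simp add: aW)
  qed
  have d0: "mat_deriv (\<lambda>t. adj (U t) ** U t) 0 t" for t
    using mat_deriv_mult[OF mat_deriv_adj[OF dU] dU, of t] by (simp add: zero)
  have "(adj (U t) ** U t) $ i $ j = (mat 1 :: complex ^ 'd ^ 'd) $ i $ j" for i j
  proof -
    have "\<And>x. ((\<lambda>t. (adj (U t) ** U t) $ i $ j) has_vector_derivative 0) (at x within UNIV)"
      using d0 by (simp add: mat_deriv_def)
    then obtain c where "\<And>x. x \<in> UNIV \<Longrightarrow> (adj (U x) ** U x) $ i $ j = c"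
      by (rule has_vector_derivative_zero_constant[OF convex_UNIV]) blast
    moreover have "(adj (U 0) ** U 0) = mat 1"
      by (simp only: U_def mat_exp_0 adj_mat_1 matrix_mul_lid)
    ultimately show ?thesis by (metis (no_types) UNIV_I)
  qed
  then have "adj (U t) ** U t = mat 1" by (simp add: vec_eq_iff)
  then show ?thesis
    using matrix_left_right_inverse[of "adj (U t)" "U t"] by (simp add: unitary_group_def U_def)
qed

lemma lie_deriv_eqI:
  assumes "((\<lambda>\<epsilon>. f (mat_exp (\<epsilon> *\<^sub>R W) ** g)) has_vector_derivative D) (at 0)"
  shows "lie_deriv W f g = D"
proof -
  define \<phi> where "\<phi> \<epsilon> = f (mat_exp (\<epsilon> *\<^sub>R W) ** g)" for \<epsilon> :: real
  have \<phi>0: "\<phi> 0 = f g" by (simp only: \<phi>_def mat_exp_0 matrix_mul_lid)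
  have "((\<lambda>\<epsilon>. norm (\<phi> \<epsilon> - f g - \<epsilon> *\<^sub>R D) / norm \<epsilon>) \<longlongrightarrow> 0) (at 0)"
    using assms \<phi>0 unfolding \<phi>_def[symmetric] has_vector_derivative_def has_derivative_iff_norm by simp
  moreover have "\<forall>\<^sub>F \<epsilon> in at (0::real). norm (\<phi> \<epsilon> - f g - \<epsilon> *\<^sub>R D) / norm \<epsilon>
      = norm ((\<phi> \<epsilon> - f g) / of_real \<epsilon> - D)"
    unfolding eventually_at_filter
  proof (intro always_eventually allI impI)
    fix \<epsilon> :: real assume "\<epsilon> \<noteq> 0"
    then have "(\<phi> \<epsilon> - f g) / of_real \<epsilon> - D = (\<phi> \<epsilon> - f g - \<epsilon> *\<^sub>R D) / of_real \<epsilon>"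
      by (simp add: scaleR_conv_of_real field_simps)
    then show "norm (\<phi> \<epsilon> - f g - \<epsilon> *\<^sub>R D) / norm \<epsilon> = norm ((\<phi> \<epsilon> - f g) / of_real \<epsilon> - D)"
      by (simp add: norm_divide)
  qed
  ultimately have "((\<lambda>\<epsilon>. norm ((\<phi> \<epsilon> - f g) / of_real \<epsilon> - D)) \<longlongrightarrow> 0) (at 0)"
    by (simp cong: tendsto_cong)
  then have "((\<lambda>\<epsilon>. (\<phi> \<epsilon> - f g) / of_real \<epsilon>) \<longlongrightarrow> D) (at 0)"
    by (rule Lim_null[THEN iffD2, OF tendsto_norm_zero_cancel])
  then show ?thesis
    unfolding lie_deriv_def \<phi>_def by (intro tendsto_Lim) auto
qed

section \<open>Fusion rules for an orthonormal basis of antihermitian matrices\<close>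

lemma trace_mult_entries: "trace (X ** Y) = (\<Sum>i\<in>UNIV. \<Sum>j\<in>UNIV. X $ i $ j * Y $ j $ i)"
  by (simp add: trace_def matrix_matrix_mult_def)

lemma orthonormal_basis_finite: "orthonormal_basis B \<Longrightarrow> finite B"
  unfolding orthonormal_basis_def by (blast intro: independent_imp_finite)

lemma orthonormal_basis_antihermitian: "orthonormal_basis B \<Longrightarrow> W \<in> B \<Longrightarrow> W \<in> antihermitian"
  unfolding orthonormal_basis_def by (metis span_base)

text \<open>The coefficients of \<open>Z\<close> are its inner products \<open>tr (Z ** adj W) = - tr (Z ** W)\<close>
  with the basis elements; this is where the sign comes from.\<close>

lemma basis_expansion_antihermitian:
  fixes B :: "(complex ^ 'd ^ 'd) set"
  assumes B: "orthonormal_basis B" and Z: "Z \<in> antihermitian"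
  shows "(\<Sum>W\<in>B. trace (Z ** W) * W $ i $ j) = - Z $ i $ j"
proof -
  have fin: "finite B" by (rule orthonormal_basis_finite[OF B])
  have "Z \<in> span B" using B Z by (simp add: orthonormal_basis_def)
  then obtain u where u: "Z = (\<Sum>V\<in>B. u V *\<^sub>R V)"
    using span_finite[OF fin] by auto
  have Z_entry: "Z $ i $ j = (\<Sum>V\<in>B. of_real (u V) * V $ i $ j)" for i j
    by (simp add: u sum_component scaleR_entry del: vector_scaleR_component)
  have "trace (Z ** W) = - of_real (u W)" if W: "W \<in> B" for W
  proof -
    have "adj W = - W"
      using orthonormal_basis_antihermitian[OF B W] by (simp add: antihermitian_def)
    then have neg: "W $ i $ j = - adj W $ i $ j" for i j
      by (metis minus_minus vector_uminus_component)
    have "trace (Z ** W) = - trace (Z ** adj W)"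
      unfolding trace_mult_entries by (subst neg) (simp only: mult_minus_right sum_negf)
    also have "trace (Z ** adj W) = (\<Sum>V\<in>B. of_real (u V) * trace (V ** adj W))"
      unfolding trace_mult_entries Z_entry sum_distrib_right sum_distrib_left
      by (subst sum.swap, intro sum.cong refl, subst sum.swap) (simp add: mult.assoc)
    also have "\<dots> = (\<Sum>V\<in>B. if V = W then of_real (u V) else 0)"
      using B W by (intro sum.cong) (auto simp: orthonormal_basis_def)
    also have "\<dots> = of_real (u W)" using W fin by simp
    finally show ?thesis .
  qed
  then show ?thesis by (simp add: Z_entry sum_negf cong: sum.cong)
qed

text \<open>Although \<open>B\<close> spans only the real space of antihermitian matrices, the expansion extends
  to all complex matrices: each is a complex combination of two antihermitian ones, and both sides are
  complex linear.\<close>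

lemma basis_completeness:
  fixes B :: "(complex ^ 'd ^ 'd) set"
  assumes B: "orthonormal_basis B"
  shows "(\<Sum>W\<in>B. trace (X ** W) * W $ i $ j) = - X $ i $ j"
proof -
  \<comment> \<open>\<open>X = Z1 + \<i> Z2\<close> with both parts antihermitian\<close>
  define Z1 :: "complex ^ 'd ^ 'd" where "Z1 = (\<chi> i j. (X $ i $ j - cnj (X $ j $ i)) / 2)"
  define Z2 :: "complex ^ 'd ^ 'd" where "Z2 = (\<chi> i j. - \<i> * (X $ i $ j + cnj (X $ j $ i)) / 2)"
  have "Z1 \<in> antihermitian" "Z2 \<in> antihermitian"
    by (simp_all add: antihermitian_def vec_eq_iff Z1_def Z2_def field_simps)
  note Z = this[THEN basis_expansion_antihermitian[OF B], of i j]
  have X: "X $ p $ q = Z1 $ p $ q + \<i> * Z2 $ p $ q" for p q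
    by (simp add: Z1_def Z2_def field_simps)
  have "trace (X ** W) = trace (Z1 ** W) + \<i> * trace (Z2 ** W)" for W
    by (simp add: trace_mult_entries X sum.distrib sum_distrib_left algebra_simps)
  then have "(\<Sum>W\<in>B. trace (X ** W) * W $ i $ j) =
      (\<Sum>W\<in>B. trace (Z1 ** W) * W $ i $ j) + \<i> * (\<Sum>W\<in>B. trace (Z2 ** W) * W $ i $ j)"
    by (simp add: sum.distrib sum_distrib_left algebra_simps)
  then show ?thesis by (simp only: Z) (simp add: X)
qed

text \<open>Completeness for a matrix unit \<open>X\<close>.\<close>

lemma basis_entry_product:
  fixes B :: "(complex ^ 'd ^ 'd) set"
  assumes B: "orthonormal_basis B"
  shows "(\<Sum>W\<in>B. W $ k $ l * W $ i $ j) = - (if i = l \<and> k = j then 1 else 0)"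
proof -
  define X :: "complex ^ 'd ^ 'd" where "X = (\<chi> p q. if q = k then if p = l then 1 else 0 else 0)"
  have "trace (X ** W) = W $ k $ l" for W
    by (simp add: trace_mult_entries X_def if_distrib[where f = "\<lambda>z. z * _"] cong: if_cong)
  then show ?thesis using basis_completeness[OF B, of X i j] by (auto simp: X_def)
qed

text \<open>The merging rule: two traces with one \<open>W\<close> each fuse into one.\<close>

lemma sum_basis_trace_trace:
  fixes B :: "(complex ^ 'd ^ 'd) set"
  assumes B: "orthonormal_basis B"
  shows "(\<Sum>W\<in>B. trace (W ** X) * trace (W ** Y)) = - trace (X ** Y)"
proof -
  have "(\<Sum>W\<in>B. trace (W ** X) * trace (W ** Y)) =
      (\<Sum>i\<in>UNIV. \<Sum>j\<in>UNIV. (\<Sum>W\<in>B. trace (X ** W) * W $ i $ j) * Y $ j $ i)"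
    unfolding trace_mul_sym[of _ X] sum_distrib_right sum_distrib_left trace_mult_entries[of _ Y]
    by (subst sum.swap, intro sum.cong refl, subst sum.swap) (simp add: mult.assoc)
  then show ?thesis
    unfolding basis_completeness[OF B] trace_mult_entries[of X Y] by (simp add: sum_negf)
qed

text \<open>The splitting rule: a trace with two \<open>W\<close> falls apart between them.\<close>

lemma sum_basis_trace_sandwich:
  fixes B :: "(complex ^ 'd ^ 'd) set"
  assumes B: "orthonormal_basis B"
  shows "(\<Sum>W\<in>B. trace (W ** X ** W ** Y)) = - (trace X * trace Y)"
proof -
  have "trace (W ** X ** W ** Y) = (\<Sum>i\<in>UNIV. \<Sum>l\<in>UNIV. \<Sum>k\<in>UNIV. \<Sum>j\<in>UNIV.
      W $ i $ j * W $ k $ l * (X $ j $ k * Y $ l $ i))" for W :: "complex ^ 'd ^ 'd"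
    unfolding trace_def matrix_matrix_mult_def
    by (simp add: sum_distrib_left sum_distrib_right mult.assoc) (simp add: ac_simps)
  then have "(\<Sum>W\<in>B. trace (W ** X ** W ** Y)) = (\<Sum>i\<in>UNIV. \<Sum>l\<in>UNIV. \<Sum>k\<in>UNIV. \<Sum>j\<in>UNIV.
      (\<Sum>W\<in>B. W $ i $ j * W $ k $ l) * (X $ j $ k * Y $ l $ i))"
    by (simp add: sum.swap[where A = B] sum_distrib_right)
  also have "\<dots> = (\<Sum>i\<in>UNIV. \<Sum>l\<in>UNIV. \<Sum>k\<in>UNIV. \<Sum>j\<in>UNIV.
      (if j = k then if l = i then - (X $ j $ k * Y $ l $ i) else 0 else 0))"
    unfolding basis_entry_product[OF B] by (intro sum.cong refl) auto
  also have "\<dots> = (\<Sum>i\<in>UNIV. \<Sum>l\<in>UNIV. if l = i then - (\<Sum>k\<in>UNIV. X $ k $ k) * Y $ l $ i else 0)"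
    by (intro sum.cong refl) (auto simp: sum_negf sum_distrib_right)
  also have "\<dots> = - (trace X * trace Y)"
    by (simp add: trace_def sum_negf sum_distrib_left)
  finally show ?thesis .
qed

section \<open>Holonomies of edge words\<close>

text \<open>Words in oriented edges carry the computation, because they can be cut at any place
  and their pieces need not be closed paths.\<close>

primrec hol :: "('v, 'd::finite) connection \<Rightarrow> ('v \<times> 'v) list \<Rightarrow> complex ^ 'd ^ 'd" where
  "hol m [] = mat 1"
| "hol m (e # es) = hol m es ** m e"

lemma hol_append: "hol m (us @ vs) = hol m vs ** hol m us"
  by (induction us) (simp_all add: matrix_mul_assoc)

lemma trace_hol_swap: "trace (hol m (us @ vs)) = trace (hol m (vs @ us))"
  unfolding hol_append by (rule trace_mul_sym)

lemma trace_hol_rotate: "trace (hol m (rotate k es)) = trace (hol m es)"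
  unfolding rotate_drop_take trace_hol_swap[of m "drop _ _"] by simp

definition steps :: "'v list \<Rightarrow> ('v \<times> 'v) list" where
  "steps \<xi> = map (edge_at \<xi>) [0..<length \<xi>]"

lemma length_steps [simp]: "length (steps \<xi>) = length \<xi>"
  by (simp add: steps_def)

lemma nth_steps: "i < length \<xi> \<Longrightarrow> steps \<xi> ! i = edge_at \<xi> i"
  by (simp add: steps_def)

lemma based_loops_iff: "\<xi> \<in> based_loops E \<longleftrightarrow> set (steps \<xi>) \<subseteq> E"
  by (auto simp: based_loops_def steps_def)

lemma based_holonomy_eq_hol: "based_holonomy m \<xi> = hol m (steps \<xi>)"
proof -
  have "foldl (\<lambda>g i. m (edge_at \<xi> i) ** g) g is = hol m (map (edge_at \<xi>) is) ** g" for g "is"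
    by (induction "is" arbitrary: g) (simp_all add: matrix_mul_assoc)
  from this[of "mat 1" "[0..<length \<xi>]"] show ?thesis
    by (simp add: based_holonomy_def steps_def)
qed

lemma steps_rotate: "steps (rotate k \<xi>) = rotate k (steps \<xi>)"
proof (rule nth_equalityI)
  fix i assume i: "i < length (steps (rotate k \<xi>))"
  then have "\<xi> \<noteq> []" by auto
  then have "(k + Suc i mod length \<xi>) mod length \<xi> = Suc ((k + i) mod length \<xi>) mod length \<xi>"
    by (simp add: mod_simps)
  then show "steps (rotate k \<xi>) ! i = rotate k (steps \<xi>) ! i"
    using i \<open>\<xi> \<noteq> []\<close> by (simp add: nth_steps edge_at_def nth_rotate)
qed simp

text \<open>The steps of the open path through the listed vertices that ends at \<open>z\<close>. Unlike \<open>steps\<close>,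
  this is compatible with concatenation.\<close>

primrec walk :: "'v list \<Rightarrow> 'v \<Rightarrow> ('v \<times> 'v) list" where
  "walk [] z = []"
| "walk (x # xs) z = (x, hd (xs @ [z])) # walk xs z"

lemma length_walk [simp]: "length (walk xs z) = length xs"
  by (induction xs) auto

lemma walk_append: "walk (xs @ ys) z = walk xs (hd (ys @ [z])) @ walk ys z"
  by (induction xs) (auto simp: hd_append)

lemma nth_walk: "i < length xs \<Longrightarrow> walk xs z ! i = (xs ! i, (xs @ [z]) ! Suc i)"
  by (induction xs arbitrary: i) (auto simp: nth_Cons' hd_conv_nth hd_append nth_append)

lemma steps_eq_walk: "steps \<xi> = walk \<xi> (hd \<xi>)"
proof (rule nth_equalityI)
  fix i assume "i < length (steps \<xi>)"
  then show "steps \<xi> ! i = walk \<xi> (hd \<xi>) ! i"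
    by (cases "Suc i = length \<xi>"; cases \<xi>)
      (auto simp: nth_steps nth_walk edge_at_def nth_append simp del: walk.simps)
qed simp

lemma steps_append:
  assumes "xs \<noteq> [] \<Longrightarrow> hd xs = z" "ys \<noteq> [] \<Longrightarrow> hd ys = z"
  shows "steps (xs @ ys) = steps xs @ steps ys"
proof (cases "xs = [] \<or> ys = []")
  case False
  then show ?thesis using assms by (simp add: steps_eq_walk walk_append)
qed (auto simp: steps_eq_walk)

text \<open>Two opposite steps on one loop: when the starting points of both are dropped, the remaining
  pieces are closed, one at \<open>y\<close> and one at \<open>x\<close>, so their cyclic closing step is the right one.\<close>

lemma steps_cancel_inside:
  assumes "steps \<xi> = (x, y) # us @ (y, x) # vs"
  defines "\<zeta> \<equiv> take (length us) (tl \<xi>)" and "\<zeta>' \<equiv> drop (Suc (Suc (length us))) \<xi>"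
  shows "steps \<zeta> = us" "steps \<zeta>' = vs"
proof -
  have len: "length \<xi> = Suc (Suc (length us + length vs))"
    using arg_cong[OF assms(1), of length] by simp
  obtain x' \<xi>1 where \<xi>: "\<xi> = x' # \<xi>1" using len by (cases \<xi>) auto
  have "length us < length \<xi>1" using len \<xi> by simp
  then have \<xi>1: "\<xi>1 = \<zeta> @ \<xi>1 ! length us # \<zeta>'"
    unfolding \<zeta>_def \<zeta>'_def \<xi> by (simp add: id_take_nth_drop[symmetric])
  define y' where "y' = \<xi>1 ! length us"
  have lz: "length \<zeta> = length us" using \<open>length us < length \<xi>1\<close> by (simp add: \<zeta>_def \<xi>)
  have "\<xi> = x' # \<zeta> @ y' # \<zeta>'" using \<xi> \<xi>1 by (simp add: y'_def)
  then have "(x', hd (\<zeta> @ [y'])) # walk \<zeta> y' @ (y', hd (\<zeta>' @ [x'])) # walk \<zeta>' x'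
      = (x, y) # us @ (y, x) # vs"
    unfolding assms(1)[symmetric] steps_eq_walk by (simp add: walk_append hd_append)
  then have *: "x' = x" "hd (\<zeta> @ [y]) = y" "walk \<zeta> y = us" "hd (\<zeta>' @ [x]) = x" "walk \<zeta>' x = vs"
    using lz by (auto simp: append_eq_append_conv)
  from *(2,3) show "steps \<zeta> = us" by (cases \<zeta>) (auto simp: steps_eq_walk)
  from *(4,5) show "steps \<zeta>' = vs" by (cases \<zeta>') (auto simp: steps_eq_walk)
qed

text \<open>Two loops that start with opposite steps. For \<open>x = y\<close> the loop could consist of the single
  step \<open>(x, x)\<close>, and its empty tail would no longer determine where the pieces are joined.\<close>

lemma steps_cancel_between:
  assumes "steps \<xi> = (x, y) # us" "steps \<zeta> = (y, x) # vs" "x \<noteq> y"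
  shows "steps (tl \<xi> @ tl \<zeta>) = us @ vs"
proof -
  obtain M where \<xi>: "\<xi> = x # M" "hd (M @ [x]) = y" "walk M x = us"
    using assms(1) by (cases \<xi>) (auto simp: steps_eq_walk)
  obtain N where \<zeta>: "\<zeta> = y # N" "hd (N @ [y]) = x" "walk N y = vs"
    using assms(2) by (cases \<zeta>) (auto simp: steps_eq_walk)
  have "M \<noteq> []" using \<xi>(2) assms(3) by auto
  then have "hd M = y" using \<xi> by simp
  then show ?thesis using \<xi> \<zeta> \<open>M \<noteq> []\<close> by (simp add: steps_eq_walk walk_append)
qed

lemma loop_of_iff: "\<zeta> \<in> loop_of \<xi> \<longleftrightarrow> (\<exists>k. \<zeta> = rotate k \<xi>)"
  by (auto simp: loop_of_def cyclic_shift_def)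

lemma self_in_loop_of [simp]: "\<xi> \<in> loop_of \<xi>"
  unfolding loop_of_iff by (metis rotate0 id_apply)

lemma loop_of_rotate [simp]: "loop_of (rotate k \<xi>) = loop_of \<xi>"
proof (intro set_eqI iffI)
  fix \<zeta> assume "\<zeta> \<in> loop_of (rotate k \<xi>)"
  then show "\<zeta> \<in> loop_of \<xi>" by (auto simp: loop_of_iff rotate_rotate)
next
  fix \<zeta> assume "\<zeta> \<in> loop_of \<xi>"
  then obtain n where n: "\<zeta> = rotate n \<xi>" by (auto simp: loop_of_iff)
  show "\<zeta> \<in> loop_of (rotate k \<xi>)"
  proof (cases "\<xi> = []")
    case False
    have "(n + (length \<xi> - k mod length \<xi>) + k) mod length \<xi>
        = (n + (length \<xi> - k mod length \<xi>) + k mod length \<xi>) mod length \<xi>"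
      by (simp add: mod_simps)
    also have "k mod length \<xi> < length \<xi>" using False by simp
    then have "n + (length \<xi> - k mod length \<xi>) + k mod length \<xi> = n + length \<xi>" by linarith
    finally have "rotate (n + (length \<xi> - k mod length \<xi>) + k) \<xi> = rotate n \<xi>"
      by (metis mod_add_self2 rotate_conv_mod)
    then show ?thesis unfolding loop_of_iff rotate_rotate n by metis
  qed (simp add: n)
qed

lemma loop_of_eqI: "\<zeta> \<in> loop_of \<xi> \<Longrightarrow> loop_of \<zeta> = loop_of \<xi>"
  by (auto simp: loop_of_iff)

lemma loop_of_steps:
  assumes "\<zeta> \<in> loop_of \<xi>"
  shows "set (steps \<zeta>) = set (steps \<xi>)" "length \<zeta> = length \<xi>"
    "trace (hol m (steps \<zeta>)) = trace (hol m (steps \<xi>))"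
  using assms by (auto simp: loop_of_iff steps_rotate trace_hol_rotate)

lemma loops_obtain:
  assumes "l \<in> loops E"
  obtains \<xi> where "\<xi> \<in> based_loops E" "l = loop_of \<xi>"
  using assms by (auto simp: loops_def quotient_def loop_of_def)

lemma connection_unitary: "m \<in> connections E \<Longrightarrow> e \<in> E \<Longrightarrow> m e \<in> unitary_group"
  by (auto simp: connections_def)

lemma connection_swap:
  assumes "m \<in> connections E" "(x, y) \<in> E" "sym E"
  shows "m (y, x) = adj (m (x, y))"
proof -
  have "(y, x) \<in> E" using assms by (auto dest: symD)
  then have "m (y, x) = matrix_inv (m (x, y))" using assms by (auto simp: connections_def)
  then show ?thesis using assms by (simp add: connection_unitary unitary_inv)
qed

lemma connection_backtrack:
  assumes "m \<in> connections E" "(x, y) \<in> E" "sym E"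
  shows "m (y, x) ** m (x, y) = mat 1"
  using assms by (simp add: connection_swap unitary_cancel[OF connection_unitary])

lemma hol_cancel:
  assumes "m \<in> connections E" "(x, y) \<in> E" "sym E"
  shows "hol m (us @ (x, y) # (y, x) # vs) = hol m (us @ vs)"
proof -
  have "hol m (us @ (x, y) # (y, x) # vs) = hol m vs ** (m (y, x) ** m (x, y)) ** hol m us"
    by (simp only: hol_append hol.simps matrix_mul_assoc)
  then show ?thesis by (simp add: connection_backtrack[OF assms] hol_append)
qed

lemma trace_conj:
  fixes u g :: "complex ^ 'd ^ 'd"
  assumes "u \<in> unitary_group"
  shows "trace (u ** g ** matrix_inv u) = trace g"
proof -
  have "trace (u ** g ** matrix_inv u) = trace (adj u ** (u ** g))"
    unfolding unitary_inv[OF assms] by (rule trace_mul_sym)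
  then show ?thesis using assms by (simp add: matrix_mul_assoc unitary_cancel)
qed

text \<open>Along a path the gauge factors at the intermediate vertices telescope.\<close>

lemma hol_gauge:
  assumes "\<forall>x. h x \<in> unitary_group"
    and "\<forall>(x, y)\<in>E. m' (x, y) = matrix_inv (h y) ** m (x, y) ** h x"
    and "set (walk xs z) \<subseteq> E"
  shows "hol m' (walk xs z) = adj (h z) ** hol m (walk xs z) ** h (hd (xs @ [z]))"
  using assms(3)
proof (induction xs)
  case Nil
  then show ?case using assms(1) by (simp add: unitary_cancel)
next
  case (Cons x xs)
  let ?w = "hd (xs @ [z])"
  have "m' (x, ?w) = adj (h ?w) ** m (x, ?w) ** h x"
    using assms(1,2) Cons.prems by (auto simp: unitary_inv)
  moreover have "hol m' (walk xs z) = adj (h z) ** hol m (walk xs z) ** h ?w"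
    using Cons by simp
  ultimately have "hol m' (walk (x # xs) z)
      = adj (h z) ** hol m (walk xs z) ** (h ?w ** adj (h ?w)) ** m (x, ?w) ** h x"
    by (simp only: walk.simps hol.simps matrix_mul_assoc)
  moreover have "h ?w ** adj (h ?w) = mat 1" using assms(1) by (simp add: unitary_cancel)
  ultimately show ?case
    by (simp only: matrix_mul_rid walk.simps hol.simps matrix_mul_assoc append_Cons list.sel)
qed

lemma trace_hol_gauge:
  assumes "(m, m') \<in> gauge_equiv E" "\<xi> \<in> based_loops E"
  shows "trace (hol m' (steps \<xi>)) = trace (hol m (steps \<xi>))"
proof -
  obtain h where h: "\<forall>x. h x \<in> unitary_group"
    "\<forall>(x, y)\<in>E. m' (x, y) = matrix_inv (h y) ** m (x, y) ** h x"
    using assms(1) by (auto simp: gauge_equiv_def)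
  show ?thesis
  proof (cases \<xi>)
    case (Cons x xs)
    have "hol m' (steps \<xi>) = adj (h x) ** hol m (steps \<xi>) ** h x"
      using hol_gauge[OF h, of \<xi> "hd \<xi>"] assms(2)
      by (simp add: based_loops_iff steps_eq_walk Cons)
    moreover have "trace (adj (h x) ** hol m (steps \<xi>) ** h x) = trace (h x ** (adj (h x) ** hol m (steps \<xi>)))"
      by (rule trace_mul_sym)
    ultimately show ?thesis using h by (simp add: matrix_mul_assoc unitary_cancel)
  qed (simp add: steps_def)
qed

text \<open>Gauge transformations and changes of the base point conjugate the based holonomy, so all
  representatives share the same trace.\<close>

lemma class_trace_holonomy:
  assumes A: "A = gauge_equiv E `` {m0}" "m \<in> A" and \<xi>: "\<xi> \<in> based_loops E"
  shows "class_trace (holonomy A (loop_of \<xi>)) = trace (hol m (steps \<xi>))"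
proof -
  have const: "trace g = trace (hol m (steps \<xi>))" if mem: "g \<in> holonomy A (loop_of \<xi>)" for g
  proof -
    obtain m' \<zeta> u where m': "m' \<in> A" "\<zeta> \<in> loop_of \<xi>" "u \<in> unitary_group"
      and g: "g = u ** hol m' (steps \<zeta>) ** matrix_inv u"
      using mem unfolding holonomy_def conj_class_def based_holonomy_eq_hol by blast
    have "trace g = trace (hol m' (steps \<xi>))"
      using m' g by (simp add: trace_conj loop_of_steps)
    also have "\<dots> = trace (hol m0 (steps \<xi>))"
      using m' A \<xi> by (intro trace_hol_gauge) auto
    also have "\<dots> = trace (hol m (steps \<xi>))"
      using A \<xi> by (intro trace_hol_gauge[symmetric]) auto
    finally show ?thesis .
  qed
  have inhabited: "mat 1 ** hol m (steps \<xi>) ** matrix_inv (mat 1) \<in> holonomy A (loop_of \<xi>)"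
    unfolding holonomy_def conj_class_def based_holonomy_eq_hol
    using A(2) self_in_loop_of[of \<xi>] unitary_mat_1 by blast
  have "trace ` holonomy A (loop_of \<xi>) = {trace (hol m (steps \<xi>))}"
  proof (intro equalityI image_subsetI)
    show "{trace (hol m (steps \<xi>))} \<subseteq> trace ` holonomy A (loop_of \<xi>)"
      using imageI[OF inhabited, of trace] const[OF inhabited] by simp
  qed (simp add: const)
  then show ?thesis by (simp add: class_trace_def)
qed

lemma reduction_step_trace:
  fixes E :: "('v \<times> 'v) set"
  assumes E: "sym E" and \<xi>: "\<xi> \<in> based_loops E" and step: "reduction_step (loop_of \<xi>) l"
  obtains \<zeta> where "\<zeta> \<in> based_loops E" "l = loop_of \<zeta>"
    "\<And>m :: ('v, 'd::finite) connection. m \<in> connections E \<Longrightarrow> trace (hol m (steps \<zeta>)) = trace (hol m (steps \<xi>))"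
proof -
  obtain \<xi>' where \<xi>': "\<xi>' \<in> loop_of \<xi>" "2 \<le> length \<xi>'"
      "edge_at \<xi>' 1 = prod.swap (edge_at \<xi>' 0)" "l = loop_of (drop 2 \<xi>')"
    using step by (auto simp: reduction_step_def)
  obtain x y where xy: "edge_at \<xi>' 0 = (x, y)" by fastforce
  have "2 \<le> length (steps \<xi>')" using \<xi>' by simp
  then obtain a b R where ab: "steps \<xi>' = a # b # R"
    by (metis One_nat_def Suc_1 Suc_le_length_iff)
  have "0 < length \<xi>'" "1 < length \<xi>'" using \<xi>'(2) by linarith+
  then have "a = (x, y)" "b = (y, x)"
    using nth_steps[of 0 \<xi>'] nth_steps[of 1 \<xi>'] \<xi>'(3) xy ab by auto
  with ab have dec: "steps \<xi>' = (x, y) # [] @ (y, x) # R" by simp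
  from steps_cancel_inside(2)[OF this]
  have drop: "steps (drop 2 \<xi>') = R" by (simp add: numeral_2_eq_2)
  have sub: "set (steps \<xi>') \<subseteq> E" using \<xi> \<xi>' by (simp add: based_loops_iff loop_of_steps)
  then have "(x, y) \<in> E" by (simp add: dec)
  show thesis
  proof
    show "drop 2 \<xi>' \<in> based_loops E"
      using sub by (simp add: based_loops_iff drop dec)
    show "l = loop_of (drop 2 \<xi>')" by fact
    fix m :: "('v, 'd::finite) connection" assume m: "m \<in> connections E"
    have "hol m (steps \<xi>') = hol m R"
      using hol_cancel[OF m \<open>(x, y) \<in> E\<close> E, of "[]" R] dec by simp
    then show "trace (hol m (steps (drop 2 \<xi>'))) = trace (hol m (steps \<xi>))"
      using loop_of_steps(3)[OF \<xi>'(1), of m] by (simp add: drop)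
  qed
qed

text \<open>Moving the base point brings any backtrack to the front, and its removal shortens the loop
  by two steps. A loop with a single step, which would be its own opposite, is excluded by
  irreflexivity.\<close>

lemma exists_geodesic_reduction:
  assumes E: "sym E" "irrefl E" and \<xi>: "\<xi> \<in> based_loops E"
  shows "\<exists>l. reduction_step\<^sup>*\<^sup>* (loop_of \<xi>) l \<and> geodesic l"
  using \<xi>
proof (induction "length \<xi>" arbitrary: \<xi> rule: less_induct)
  case less
  show ?case
  proof (cases "geodesic (loop_of \<xi>)")
    case False
    then obtain \<zeta> i where \<zeta>: "\<zeta> \<in> loop_of \<xi>" "i < length \<zeta>"
      "edge_at \<zeta> (Suc i mod length \<zeta>) = prod.swap (edge_at \<zeta> i)"
      by (auto simp: geodesic_def)
    define \<zeta>' where "\<zeta>' = rotate i \<zeta>"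
    have \<zeta>': "\<zeta>' \<in> loop_of \<xi>" "length \<zeta>' = length \<xi>"
      using \<zeta>(1) by (auto simp: \<zeta>'_def loop_of_iff rotate_rotate)
    have sub: "set (steps \<zeta>') \<subseteq> E"
      using less.prems \<zeta>'(1) by (simp add: based_loops_iff loop_of_steps)
    have len: "length \<zeta>' = length \<zeta>" by (simp add: \<zeta>'_def)
    have s0: "steps \<zeta>' ! 0 = edge_at \<zeta> i"
      using \<zeta>(2) by (cases "\<zeta> = []") (auto simp: \<zeta>'_def steps_rotate nth_rotate nth_steps)
    have "length \<zeta>' \<noteq> 1"
    proof
      assume 1: "length \<zeta>' = 1"
      then obtain x where "\<zeta>' = [x]" by (auto simp: length_Suc_conv)
      then have "(x, x) \<in> E" using sub by (simp add: steps_def edge_at_def)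
      then show False using E(2) by (simp add: irrefl_def)
    qed
    then have len2: "1 < length \<zeta>'" using \<zeta>(2) len by linarith
    then have s1: "steps \<zeta>' ! 1 = edge_at \<zeta> (Suc i mod length \<zeta>)"
      using \<zeta>(2) len by (cases "\<zeta> = []") (auto simp: \<zeta>'_def steps_rotate nth_rotate nth_steps)
    have "reduction_step (loop_of \<xi>) (loop_of (drop 2 \<zeta>'))"
      unfolding reduction_step_def
      using \<zeta>'(1) len2 s0 s1 \<zeta>(3) nth_steps[of 0 \<zeta>'] nth_steps[of 1 \<zeta>']
      by (cases "\<zeta>' = []"; intro bexI[of _ \<zeta>']) auto
    moreover obtain \<eta> where \<eta>: "\<eta> \<in> based_loops E" "loop_of (drop 2 \<zeta>') = loop_of \<eta>"
      by (rule reduction_step_trace[OF E(1) less.prems calculation])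
    moreover have "length \<eta> = length (drop 2 \<zeta>')"
      using \<eta>(2) self_in_loop_of[of \<eta>] by (metis loop_of_steps(2))
    then have "length \<eta> < length \<xi>" using len2 \<zeta>'(2) by simp
    from less.hyps[OF this \<eta>(1)] obtain l where "reduction_step\<^sup>*\<^sup>* (loop_of \<eta>) l" "geodesic l"
      by blast
    ultimately show ?thesis by (metis converse_rtranclp_into_rtranclp)
  qed auto
qed

text \<open>Every sequence of reductions preserves the trace, so it suffices that some reduced loop exists;
  which one the choice in \<open>reduced\<close> selects is immaterial.\<close>

lemma reduced_trace:
  fixes E :: "('v \<times> 'v) set"
  assumes E: "sym E" "irrefl E" and \<xi>: "\<xi> \<in> based_loops E"
  obtains \<zeta> where "\<zeta> \<in> based_loops E" "reduced (loop_of \<xi>) = loop_of \<zeta>"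
    "\<And>m :: ('v, 'd::finite) connection. m \<in> connections E \<Longrightarrow> trace (hol m (steps \<zeta>)) = trace (hol m (steps \<xi>))"
proof -
  have "reduction_step\<^sup>*\<^sup>* (loop_of \<xi>) (reduced (loop_of \<xi>))"
    unfolding reduced_def using someI_ex[OF exists_geodesic_reduction[OF E \<xi>]] by blast
  then have "\<exists>\<zeta>. \<zeta> \<in> based_loops E \<and> reduced (loop_of \<xi>) = loop_of \<zeta> \<and>
      (\<forall>m::('v, 'd::finite) connection. m \<in> connections E \<longrightarrow>
        trace (hol m (steps \<zeta>)) = trace (hol m (steps \<xi>)))"
  proof (induction rule: rtranclp_induct)
    case base
    then show ?case using \<xi> by blast
  next
    case (step l l')
    then obtain \<zeta> where \<zeta>: "\<zeta> \<in> based_loops E" "l = loop_of \<zeta>"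
      "\<And>m::('v, 'd) connection. m \<in> connections E \<Longrightarrow>
        trace (hol m (steps \<zeta>)) = trace (hol m (steps \<xi>))"
      by blast
    obtain \<eta> where "\<eta> \<in> based_loops E" "l' = loop_of \<eta>"
      "\<And>m::('v, 'd) connection. m \<in> connections E \<Longrightarrow>
        trace (hol m (steps \<eta>)) = trace (hol m (steps \<zeta>))"
      using reduction_step_trace[OF E(1) \<zeta>(1) step.hyps(2)[unfolded \<zeta>(2)]] by metis
    then show ?case using \<zeta> by (intro exI[of _ \<eta>]) simp
  qed
  then show thesis using that by blast
qed

section \<open>Derivatives along an edge\<close>

lemma matrix_mult_uminus:
  fixes X Y :: "complex ^ 'd ^ 'd"
  shows "X ** (- Y) = - (X ** Y)"
  by (simp add: vec_eq_iff matrix_matrix_mult_def sum_negf)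

lemma matrix_sum_mult:
  fixes M :: "'i \<Rightarrow> complex ^ 'd ^ 'd"
  and N :: "complex ^ 'd ^ 'd"
  shows "(\<Sum>t\<in>T. M t) ** N = (\<Sum>t\<in>T. M t ** N)"
  by (induction T rule: infinite_finite_induct) (simp_all add: matrix_add_mult_distrib)

lemma matrix_scaleR_mult:
  fixes M :: "complex ^ 'd ^ 'd"
  and N :: "complex ^ 'd ^ 'd"
  shows "(r *\<^sub>R M) ** N = r *\<^sub>R (M ** N)"
  by (simp add: vec_eq_iff matrix_matrix_mult_def scaleR_sum_right)

lemma trace_sum:
  fixes M :: "'i \<Rightarrow> complex ^ 'd ^ 'd"
  shows "trace (\<Sum>t\<in>T. M t) = (\<Sum>t\<in>T. trace (M t))"
  unfolding trace_def sum_component by (rule sum.swap)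

lemma trace_scaleR:
  fixes M :: "complex ^ 'd ^ 'd"
  shows "trace (r *\<^sub>R M) = of_real r * trace M"
  by (simp add: trace_def scaleR_entry sum_distrib_left del: vector_scaleR_component)

definition perturb ::
  "'v \<times> 'v \<Rightarrow> complex ^ 'd ^ 'd \<Rightarrow> real \<Rightarrow> ('v, 'd::finite) connection \<Rightarrow> ('v, 'd) connection" where
  "perturb a W \<epsilon> m = set_coord a (mat_exp (\<epsilon> *\<^sub>R W) ** m a) m"

text \<open>Required at every connection, not just at one, so that \<open>f'\<close> can be differentiated again.
  For antihermitian \<open>W\<close> the curves stay among the connections, where \<open>\<tau>\<close> is a product of traces
  of holonomies.\<close>

definition edge_deriv ::
  "('v \<times> 'v) set \<Rightarrow> 'v \<times> 'v \<Rightarrow> complex ^ 'd ^ 'd \<Rightarrow> (('v, 'd::finite) connection \<Rightarrow> complex) \<Rightarrow>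
     (('v, 'd) connection \<Rightarrow> complex) \<Rightarrow> bool" where
  "edge_deriv E a W f f' \<longleftrightarrow>
     (\<forall>m\<in>connections E. ((\<lambda>\<epsilon>. f (perturb a W \<epsilon> m)) has_vector_derivative f' m) (at 0))"

text \<open>The reversed edge carries the inverse matrix, whose derivative is \<open>- m e ** W\<close>.\<close>

definition edge_sign :: "'v \<times> 'v \<Rightarrow> 'v \<times> 'v \<Rightarrow> real" where
  "edge_sign a e = (if e = a then 1 else if e = prod.swap a then -1 else 0)"

text \<open>The place where \<open>W\<close> enters the word. In \<open>exp (\<epsilon> W) ** m a\<close> it stands to the left of
  \<open>m a\<close>, that is after the crossing, as later steps multiply on the left; for the reversed edge it stands
  to the right, before the crossing.\<close>

definition cut_pos :: "'v \<times> 'v \<Rightarrow> 'v \<times> 'v \<Rightarrow> nat \<Rightarrow> nat" where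
  "cut_pos a e t = (if e = a then Suc t else t)"

text \<open>The cyclic word read from the place where \<open>W\<close> is inserted by step \<open>t\<close>.\<close>

definition cut_word :: "'v \<times> 'v \<Rightarrow> ('v \<times> 'v) list \<Rightarrow> nat \<Rightarrow> ('v \<times> 'v) list" where
  "cut_word a es t = (let c = cut_pos a (es ! t) t in drop c es @ take c es)"

locale finite_graph =
  fixes E :: "('v \<times> 'v) set"
  assumes finite_E: "finite E" and sym_E: "sym E" and irrefl_E: "irrefl E"
begin

lemma swap_in_E: "e \<in> E \<Longrightarrow> prod.swap e \<in> E"
  using sym_E by (cases e) (auto dest: symD)

lemma swap_neq: "e \<in> E \<Longrightarrow> prod.swap e \<noteq> e"
  using irrefl_E by (cases e) (auto simp: irrefl_def)

lemma connection_swap_adj: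
  assumes "m \<in> connections E" "e \<in> E"
  shows "m (prod.swap e) = adj (m e)"
  using connection_swap[OF assms(1) _ sym_E, of "fst e" "snd e"] assms(2) by (cases e) simp

lemma set_coord_connection:
  assumes m: "m \<in> connections E" and a: "a \<in> E" and g: "g \<in> unitary_group"
  shows "set_coord a g m \<in> connections E"
proof -
  have inv: "matrix_inv g = adj g" "matrix_inv (adj g) = g"
    using g by (simp_all add: unitary_inv unitary_adj)
  have neq: "prod.swap a \<noteq> a" by (rule swap_neq[OF a])
  have "set_coord a g m \<in> E \<rightarrow>\<^sub>E unitary_group"
    using m a g swap_in_E[OF a] unitary_adj[OF g]
    by (auto simp: connections_def set_coord_def inv PiE_iff extensional_def)
  moreover have "set_coord a g m (x, y) = matrix_inv (set_coord a g m (y, x))" if "(x, y) \<in> E" for x y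
  proof -
    have "(x, y) = a \<or> (y, x) = a \<or> {(x, y), (y, x)} \<inter> {a, prod.swap a} = {}"
      by (cases a) auto
    then show ?thesis
    proof (elim disjE)
      assume *: "(x, y) = a"
      then show ?thesis using neq inv by (auto simp: set_coord_def)
    next
      assume "(y, x) = a"
      then show ?thesis using neq inv by (auto simp: set_coord_def)
    next
      assume "{(x, y), (y, x)} \<inter> {a, prod.swap a} = {}"
      then have "set_coord a g m (x, y) = m (x, y)" "set_coord a g m (y, x) = m (y, x)"
        by (auto simp: set_coord_def)
      then show ?thesis using m that by (auto simp: connections_def)
    qed
  qed
  ultimately show ?thesis by (auto simp: connections_def)
qed

lemma perturb_0:
  assumes "m \<in> connections E" "a \<in> E"
  shows "perturb a W 0 m = m"
proof -
  have "matrix_inv (m a) = m (prod.swap a)"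
    using assms by (simp add: connection_swap_adj unitary_inv connection_unitary)
  then have "set_coord a (m a) m = m" by (auto simp: set_coord_def fun_eq_iff)
  then show ?thesis unfolding perturb_def mat_exp_0 by simp
qed

lemma perturb_unitary:
  assumes "m \<in> connections E" "a \<in> E" "W \<in> antihermitian"
  shows "mat_exp (\<epsilon> *\<^sub>R W) ** m a \<in> unitary_group"
  using assms by (intro unitary_mult mat_exp_unitary connection_unitary)

lemma perturb_connection:
  assumes "m \<in> connections E" "a \<in> E" "W \<in> antihermitian"
  shows "perturb a W \<epsilon> m \<in> connections E"
  unfolding perturb_def using assms by (intro set_coord_connection perturb_unitary)

lemma mat_deriv_perturb:
  assumes m: "m \<in> connections E" and a: "a \<in> E" and W: "W \<in> antihermitian"
  shows "mat_deriv (\<lambda>\<epsilon>. perturb a W \<epsilon> m e)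
    (if e = a then W ** m a else if e = prod.swap a then - (m e ** W) else 0) 0"
proof -
  have neq: "prod.swap a \<noteq> a" by (rule swap_neq[OF a])
  have d: "mat_deriv (\<lambda>\<epsilon>. mat_exp (\<epsilon> *\<^sub>R W) ** m a) (W ** m a) 0"
    using mat_deriv_mult[OF mat_deriv_mat_exp[of W 0] mat_deriv_const[of "m a"]]
    unfolding mat_exp_0 by simp
  consider "e = a" | "e = prod.swap a" | "e \<noteq> a" "e \<noteq> prod.swap a" by blast
  then show ?thesis
  proof cases
    case 1
    then show ?thesis using d neq by (simp add: perturb_def set_coord_def)
  next
    case 2
    have "perturb a W \<epsilon> m e = adj (mat_exp (\<epsilon> *\<^sub>R W) ** m a)" for \<epsilon>
      using perturb_unitary[OF m a W] neq 2 by (simp add: perturb_def set_coord_def unitary_inv)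
    moreover have "adj (W ** m a) = - (m e ** W)"
    proof -
      have "adj (W ** m a) = m e ** adj W"
        using 2 m a by (simp add: adj_mult connection_swap_adj)
      also have "adj W = - W" using W by (simp add: antihermitian_def)
      also have "m e ** (- W) = - (m e ** W)" by (rule matrix_mult_uminus)
      finally show ?thesis .
    qed
    ultimately show ?thesis using mat_deriv_adj[OF d] 2 neq by simp
  next
    case 3
    then show ?thesis using mat_deriv_const by (simp add: perturb_def set_coord_def)
  qed
qed

text \<open>The Leibniz rule along the word, one summand for each step.\<close>

lemma mat_deriv_hol:
  assumes m: "m \<in> connections E" and a: "a \<in> E" and W: "W \<in> antihermitian"
  shows "mat_deriv (\<lambda>\<epsilon>. hol (perturb a W \<epsilon> m) es)
    (\<Sum>t<length es. edge_sign a (es ! t) *\<^sub>R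
       (hol m (drop (cut_pos a (es ! t) t) es) ** W ** hol m (take (cut_pos a (es ! t) t) es))) 0"
proof (induction es)
  case Nil
  then show ?case by (simp add: mat_deriv_const)
next
  case (Cons e es)
  let ?D = "\<Sum>t<length es. edge_sign a (es ! t) *\<^sub>R
       (hol m (drop (cut_pos a (es ! t) t) es) ** W ** hol m (take (cut_pos a (es ! t) t) es))"
  let ?De = "if e = a then W ** m a else if e = prod.swap a then - (m e ** W) else 0"
  have "mat_deriv (\<lambda>\<epsilon>. hol (perturb a W \<epsilon> m) es ** perturb a W \<epsilon> m e)
      (?D ** m e + hol m es ** ?De) 0"
    using mat_deriv_mult[OF Cons mat_deriv_perturb[OF m a W]] by (simp only: perturb_0[OF m a])
  moreover have "hol m es ** ?De = edge_sign a e *\<^sub>R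
      (hol m (drop (cut_pos a e 0) (e # es)) ** W ** hol m (take (cut_pos a e 0) (e # es)))"
    using swap_neq[OF a] by (auto simp: edge_sign_def cut_pos_def matrix_mult_uminus matrix_mul_assoc)
  moreover have "?D ** m e = (\<Sum>t<length es. edge_sign a (es ! t) *\<^sub>R
      (hol m (drop (cut_pos a (es ! t) (Suc t)) (e # es)) ** W **
       hol m (take (cut_pos a (es ! t) (Suc t)) (e # es))))"
    unfolding matrix_sum_mult matrix_scaleR_mult
    by (intro sum.cong refl) (simp add: cut_pos_def matrix_mul_assoc)
  ultimately show ?case by (simp add: sum.lessThan_Suc_shift add.commute del: sum.lessThan_Suc)
qed

lemma edge_deriv_cong:
  assumes "edge_deriv E a W f f'" "a \<in> E" "W \<in> antihermitian"
    and "\<And>m. m \<in> connections E \<Longrightarrow> g m = f m" "\<And>m. m \<in> connections E \<Longrightarrow> g' m = f' m"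
  shows "edge_deriv E a W g g'"
  using assms perturb_connection[OF _ assms(2,3)] unfolding edge_deriv_def by simp

lemma edge_deriv_sum:
  assumes "\<And>i. i \<in> I \<Longrightarrow> edge_deriv E a W (f i) (f' i)"
  shows "edge_deriv E a W (\<lambda>m. \<Sum>i\<in>I. f i m) (\<lambda>m. \<Sum>i\<in>I. f' i m)"
  using assms unfolding edge_deriv_def by (auto intro!: has_vector_derivative_sum)

lemma edge_deriv_add:
  assumes "edge_deriv E a W f f'" "edge_deriv E a W g g'"
  shows "edge_deriv E a W (\<lambda>m. f m + g m) (\<lambda>m. f' m + g' m)"
  using assms unfolding edge_deriv_def by (auto intro!: has_vector_derivative_add)

lemma edge_deriv_mult:
  fixes W :: "complex ^ 'd::finite ^ 'd"
  assumes "edge_deriv E a W f f'" "edge_deriv E a W g g'" "a \<in> E"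
  shows "edge_deriv E a W (\<lambda>m. f m * g m) (\<lambda>m. f' m * g m + f m * g' m)"
  unfolding edge_deriv_def
proof
  fix m :: "('v, 'd) connection" assume m: "m \<in> connections E"
  have "((\<lambda>\<epsilon>. f (perturb a W \<epsilon> m) * g (perturb a W \<epsilon> m)) has_vector_derivative
      f (perturb a W 0 m) * g' m + f' m * g (perturb a W 0 m)) (at 0)"
    using assms m unfolding edge_deriv_def by (intro has_vector_derivative_mult) auto
  then show "((\<lambda>\<epsilon>. f (perturb a W \<epsilon> m) * g (perturb a W \<epsilon> m)) has_vector_derivative
      f' m * g m + f m * g' m) (at 0)"
    by (simp add: perturb_0[OF m assms(3)] add.commute)
qed

lemma edge_deriv_const: "edge_deriv E a W (\<lambda>_. c) (\<lambda>_. 0)"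
  by (simp add: edge_deriv_def)

lemma edge_deriv_cmult:
  assumes "edge_deriv E a W f f'" "a \<in> E"
  shows "edge_deriv E a W (\<lambda>m. c * f m) (\<lambda>m. c * f' m)"
  using edge_deriv_mult[OF edge_deriv_const assms] by simp

lemma edge_deriv_prod:
  assumes "finite I" "\<And>i. i \<in> I \<Longrightarrow> edge_deriv E a W (f i) (f' i)" "a \<in> E"
  shows "edge_deriv E a W (\<lambda>m. \<Prod>i\<in>I. f i m) (\<lambda>m. \<Sum>i\<in>I. f' i m * (\<Prod>k\<in>I - {i}. f k m))"
  using assms(1,2)
proof (induction I)
  case empty
  then show ?case by (simp add: edge_deriv_const)
next
  case (insert j I)
  have "(\<Sum>i\<in>insert j I. f' i m * (\<Prod>k\<in>insert j I - {i}. f k m)) =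
      f' j m * (\<Prod>k\<in>I. f k m) + f j m * (\<Sum>i\<in>I. f' i m * (\<Prod>k\<in>I - {i}. f k m))" for m
  proof -
    have "(\<Prod>k\<in>insert j I - {i}. f k m) = f j m * (\<Prod>k\<in>I - {i}. f k m)" if "i \<in> I" for i
    proof -
      have "insert j I - {i} = insert j (I - {i})" using insert.hyps that by auto
      then show ?thesis using insert.hyps by simp
    qed
    moreover have "insert j I - {j} = I" using insert.hyps by auto
    ultimately show ?thesis
      using insert.hyps by (simp add: sum_distrib_left mult.left_commute cong: sum.cong)
  qed
  moreover have "edge_deriv E a W (\<lambda>m. f j m * (\<Prod>i\<in>I. f i m))
      (\<lambda>m. f' j m * (\<Prod>k\<in>I. f k m) + f j m * (\<Sum>i\<in>I. f' i m * (\<Prod>k\<in>I - {i}. f k m)))"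
    using insert assms(3) by (intro edge_deriv_mult) auto
  ultimately show ?case using insert.hyps by simp
qed

text \<open>By cyclicity of the trace the inserted \<open>W\<close> is moved to the front.\<close>

lemma edge_deriv_trace_hol:
  fixes W :: "complex ^ 'd::finite ^ 'd"
  assumes a: "a \<in> E" and W: "W \<in> antihermitian"
  shows "edge_deriv E a W (\<lambda>m. trace (hol m es))
    (\<lambda>m. \<Sum>t<length es. of_real (edge_sign a (es ! t)) * trace (W ** hol m (cut_word a es t)))"
  unfolding edge_deriv_def
proof
  fix m :: "('v, 'd) connection" assume m: "m \<in> connections E"
  have "trace (X ** W ** Y) = trace (W ** (Y ** X))" for X Y :: "complex ^ 'd ^ 'd"
    using trace_mul_sym[of X "W ** Y"] by (simp only: matrix_mul_assoc)
  then show "((\<lambda>\<epsilon>. trace (hol (perturb a W \<epsilon> m) es)) has_vector_derivative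
      (\<Sum>t<length es. of_real (edge_sign a (es ! t)) * trace (W ** hol m (cut_word a es t)))) (at 0)"
    using has_vector_derivative_trace[OF mat_deriv_hol[OF m a W, of es]]
    by (simp only: trace_sum trace_scaleR cut_word_def Let_def hol_append)
qed

text \<open>For the second derivative: the first \<open>W\<close> is now a constant factor, and a second one is inserted
  in the word that follows it.\<close>

lemma edge_deriv_trace_W_hol:
  fixes W :: "complex ^ 'd::finite ^ 'd"
  assumes a: "a \<in> E" and W: "W \<in> antihermitian"
  shows "edge_deriv E a W (\<lambda>m. trace (W ** hol m es))
    (\<lambda>m. \<Sum>t<length es. of_real (edge_sign a (es ! t)) *
       trace (W ** hol m (drop (cut_pos a (es ! t) t) es) ** W ** hol m (take (cut_pos a (es ! t) t) es)))"
  unfolding edge_deriv_def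
proof
  fix m :: "('v, 'd) connection" assume m: "m \<in> connections E"
  have sum: "W ** (\<Sum>t\<in>T. r t *\<^sub>R (X t ** W ** Y t)) = (\<Sum>t\<in>T. r t *\<^sub>R (W ** X t ** W ** Y t))"
    for T :: "nat set" and r and X Y :: "nat \<Rightarrow> complex ^ 'd ^ 'd"
  proof -
    have scale: "W ** (s *\<^sub>R Z) = s *\<^sub>R (W ** Z)" for s and Z :: "complex ^ 'd ^ 'd"
      by (simp add: vec_eq_iff matrix_matrix_mult_def scaleR_sum_right)
    show ?thesis
      by (induction T rule: infinite_finite_induct)
        (simp_all add: matrix_add_mult_distrib scale matrix_mul_assoc)
  qed
  have "mat_deriv (\<lambda>\<epsilon>. W ** hol (perturb a W \<epsilon> m) es) (\<Sum>t<length es. edge_sign a (es ! t) *\<^sub>R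
       (W ** hol m (drop (cut_pos a (es ! t) t) es) ** W ** hol m (take (cut_pos a (es ! t) t) es))) 0"
    using mat_deriv_mult[OF mat_deriv_const[of W] mat_deriv_hol[OF m a W, of es]]
    unfolding sum by simp
  from has_vector_derivative_trace[OF this]
  show "((\<lambda>\<epsilon>. trace (W ** hol (perturb a W \<epsilon> m) es)) has_vector_derivative
     (\<Sum>t<length es. of_real (edge_sign a (es ! t)) *
       trace (W ** hol m (drop (cut_pos a (es ! t) t) es) ** W ** hol m (take (cut_pos a (es ! t) t) es))))
     (at 0)"
    by (simp only: trace_sum trace_scaleR)
qed

text \<open>The outer Lie derivative differentiates a function that is known only on unitary matrices.
  This suffices, because the curve \<open>exp (\<epsilon> W) ** g\<close> stays in the unitary group.\<close>

lemma casimir_edge_eq: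
  assumes m: "m \<in> connections E" and a: "a \<in> E" and B: "orthonormal_basis B"
    and f: "\<And>W. W \<in> B \<Longrightarrow> edge_deriv E a W f (f1 W)"
    and f1: "\<And>W. W \<in> B \<Longrightarrow> edge_deriv E a W (f1 W) (f2 W)"
  shows "casimir_edge B a f m = (\<Sum>W\<in>B. f2 W m)"
proof -
  have coord: "set_coord a g m a = g" for g
    using swap_neq[OF a] by (auto simp: set_coord_def)
  have shift: "perturb a W \<epsilon> (set_coord a g m) = set_coord a (mat_exp (\<epsilon> *\<^sub>R W) ** g) m" for W \<epsilon> g
    unfolding perturb_def coord by (auto simp: set_coord_def)
  have lie: "lie_deriv W (\<lambda>g. f (set_coord a g m)) g = f1 W (set_coord a g m)"
    if "W \<in> B" "g \<in> unitary_group" for W g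
    using f[OF that(1)] set_coord_connection[OF m a that(2)]
    by (intro lie_deriv_eqI) (auto simp: edge_deriv_def shift)
  have "lie_deriv W (lie_deriv W (\<lambda>g. f (set_coord a g m))) (m a) = f2 W m" if W: "W \<in> B" for W
  proof (rule lie_deriv_eqI)
    have "W \<in> antihermitian" by (rule orthonormal_basis_antihermitian[OF B W])
    then have "lie_deriv W (\<lambda>g. f (set_coord a g m)) (mat_exp (\<epsilon> *\<^sub>R W) ** m a) = f1 W (perturb a W \<epsilon> m)"
      for \<epsilon> using lie[OF W perturb_unitary[OF m a]] by (simp add: perturb_def)
    then show "((\<lambda>\<epsilon>. lie_deriv W (\<lambda>g. f (set_coord a g m)) (mat_exp (\<epsilon> *\<^sub>R W) ** m a))
        has_vector_derivative f2 W m) (at 0)"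
      using f1[OF W] m by (simp add: edge_deriv_def)
  qed
  then show ?thesis by (simp add: casimir_edge_def casimir_def)
qed

text \<open>The second derivatives cancel, as usual for a carre du champ operator.\<close>

lemma Gamma_conn_eq:
  assumes m: "m \<in> connections E" and \<sigma>: "\<And>e. e \<in> edges E \<Longrightarrow> \<sigma> e \<in> E" and B: "orthonormal_basis B"
    and f: "\<And>a W. a \<in> E \<Longrightarrow> W \<in> B \<Longrightarrow> edge_deriv E a W f (f1 a W) \<and> edge_deriv E a W (f1 a W) (f2 a W)"
    and g: "\<And>a W. a \<in> E \<Longrightarrow> W \<in> B \<Longrightarrow> edge_deriv E a W g (g1 a W) \<and> edge_deriv E a W (g1 a W) (g2 a W)"
  shows "Gamma_conn B E \<sigma> f g m = (\<Sum>e\<in>edges E. \<Sum>W\<in>B. f1 (\<sigma> e) W m * g1 (\<sigma> e) W m)"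
proof -
  have F: "casimir_edge B a f m = (\<Sum>W\<in>B. f2 a W m)"
    and G: "casimir_edge B a g m = (\<Sum>W\<in>B. g2 a W m)"
    and FG: "casimir_edge B a (\<lambda>m. f m * g m) m =
      (\<Sum>W\<in>B. (f2 a W m * g m + f1 a W m * g1 a W m) + (f1 a W m * g1 a W m + f m * g2 a W m))"
    if a: "a \<in> E" for a
  proof -
    show "casimir_edge B a f m = (\<Sum>W\<in>B. f2 a W m)"
      using f[OF a] by (intro casimir_edge_eq[OF m a B]) blast+
    show "casimir_edge B a g m = (\<Sum>W\<in>B. g2 a W m)"
      using g[OF a] by (intro casimir_edge_eq[OF m a B]) blast+
    show "casimir_edge B a (\<lambda>m. f m * g m) m =
      (\<Sum>W\<in>B. (f2 a W m * g m + f1 a W m * g1 a W m) + (f1 a W m * g1 a W m + f m * g2 a W m))"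
      using f[OF a] g[OF a] a
      by (intro casimir_edge_eq[OF m a B, where ?f1.0 = "\<lambda>W m. f1 a W m * g m + f m * g1 a W m"]
          edge_deriv_add edge_deriv_mult) blast+
  qed
  have "casimir_edge B (\<sigma> e) (\<lambda>m. f m * g m) m - f m * casimir_edge B (\<sigma> e) g m
      - g m * casimir_edge B (\<sigma> e) f m = 2 * (\<Sum>W\<in>B. f1 (\<sigma> e) W m * g1 (\<sigma> e) W m)"
    if "e \<in> edges E" for e
    using that by (simp add: F G FG \<sigma> sum.distrib sum_distrib_left algebra_simps)
  then have "2 * Gamma_conn B E \<sigma> f g m = 2 * (\<Sum>e\<in>edges E. \<Sum>W\<in>B. f1 (\<sigma> e) W m * g1 (\<sigma> e) W m)"
    by (simp add: Gamma_conn_def casimir_conn_def sum_distrib_left sum_subtractf[symmetric] cong: sum.cong)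
  then show ?thesis by simp
qed

end

section \<open>Recombining words at pairs of crossings\<close>

text \<open>This replaces the distance of the second crossing from the first one by its position on the
  loop.\<close>

lemma sum_shift_offset:
  fixes g :: "nat \<Rightarrow> 'a::comm_monoid_add"
  assumes "j < n"
  shows "(\<Sum>s<n. g s) = (\<Sum>j'<n. g ((j' + n - j) mod n))"
proof (rule sum.reindex_bij_witness[where i = "\<lambda>j'. (j' + n - j) mod n" and j = "\<lambda>s. (s + j) mod n"])
  fix s assume "s \<in> {..<n}"
  then have s: "s < n" by simp
  show "((s + j) mod n + n - j) mod n = s"
  proof (cases "s + j < n")
    case False
    then have "(s + j) mod n = s + j - n" using s assms by (simp add: mod_if)
    then show ?thesis using s assms False by simp
  qed (use s in simp)
  then show "g (((s + j) mod n + n - j) mod n) = g s" by simp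
next
  fix j' assume "j' \<in> {..<n}"
  then have j': "j' < n" by simp
  have "((j' + n - j) mod n + j) mod n = (j' + n - j + j) mod n" by (rule mod_add_left_eq)
  also have "\<dots> = j'" using j' assms by simp
  finally show "((j' + n - j) mod n + j) mod n = j'" .
qed (use assms in auto)

lemma offset_less: "j' < length \<xi> \<Longrightarrow> offset \<xi> j j' < length \<xi>"
  unfolding offset_def by (rule mod_less_divisor) (cases \<xi>; simp)

lemma nth_rotate_offset:
  assumes "j < length \<xi>" "j' < length \<xi>" "length w = length \<xi>"
  shows "rotate j w ! offset \<xi> j j' = w ! j'"
proof -
  have "offset \<xi> j j' < length w" using assms offset_less by simp
  then have "rotate j w ! offset \<xi> j j' = w ! ((j + offset \<xi> j j') mod length \<xi>)"
    using assms by (simp add: nth_rotate)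
  also have "(j + offset \<xi> j j') mod length \<xi> = (j + (j' + length \<xi> - j)) mod length \<xi>"
    unfolding offset_def by (rule mod_add_right_eq)
  also have "\<dots> = j'" using assms by simp
  finally show ?thesis .
qed

lemma offset_eq_0_iff:
  assumes "j < length \<xi>" "j' < length \<xi>"
  shows "offset \<xi> j j' = 0 \<longleftrightarrow> j' = j"
proof
  assume "offset \<xi> j j' = 0"
  then have "(j + (j' + length \<xi> - j)) mod length \<xi> = j mod length \<xi>"
    unfolding offset_def by (metis add.right_neutral mod_add_right_eq)
  then show "j' = j" using assms by simp
qed (simp add: offset_def)

lemma cut_word_conv_rotate:
  assumes "t < length es"
  shows "cut_word a es t = rotate (cut_pos a (es ! t) t) es"
  using assms by (cases "Suc t = length es") (auto simp: cut_word_def cut_pos_def rotate_drop_take)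

text \<open>Cutting at step \<open>t\<close> can be done after the rotation that makes this step the first one, so the
  combinatorics below only deals with words beginning with the chosen crossing.\<close>

lemma cut_word_rotate:
  assumes "t < length es"
  shows "cut_word a es t = cut_word a (rotate t es) 0"
proof -
  have "rotate t es ! 0 = es ! t" using assms nth_rotate[of 0 es t] by (cases es) auto
  moreover have "0 < length (rotate t es)" using assms by (cases es) auto
  ultimately show ?thesis using assms
    by (simp only: cut_word_conv_rotate cut_pos_def) (simp add: rotate_rotate)
qed

context finite_graph
begin

lemma hol_cancel_edge:
  assumes "m \<in> connections E" "a \<in> E"
  shows "hol m (us @ a # prod.swap a # vs) = hol m (us @ vs)"
    "hol m (us @ prod.swap a # a # vs) = hol m (us @ vs)"
  using hol_cancel[OF assms(1) _ sym_E, of "fst a" "snd a" us vs]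
    hol_cancel[OF assms(1) _ sym_E, of "snd a" "fst a" us vs] assms(2) swap_in_E[OF assms(2)]
  by (cases a; simp)+

lemma trace_hol_cancel_ends:
  assumes "m \<in> connections E" "a \<in> E"
  shows "trace (hol m (a # us @ [prod.swap a])) = trace (hol m us)"
    "trace (hol m (prod.swap a # us @ [a])) = trace (hol m us)"
  using trace_hol_swap[of m "a # us" "[prod.swap a]"] trace_hol_swap[of m "prod.swap a # us" "[a]"]
    hol_cancel_edge[OF assms, of "[]" us] by simp_all

text \<open>The merging rule joins the words where \<open>W\<close> was inserted. If \<open>Q\<close> starts with the same oriented
  edge as \<open>R\<close>, this agrees up to a cyclic shift with joining them at the start of their first steps. If it
  starts with the opposite edge, the two first steps become neighbours and cancel; the signs then multiply
  to \<open>-1\<close>.\<close>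

lemma merge_word:
  assumes m: "m \<in> connections E" and a: "a \<in> E" and b: "b \<in> {a, prod.swap a}"
    and R: "R \<noteq> []" "R ! 0 = b" and Q: "Q \<noteq> []"
  shows "of_real (edge_sign a b) * (of_real (edge_sign a (Q ! 0)) *
      trace (hol m (cut_word a Q 0 @ cut_word a R 0))) =
    (if Q ! 0 = b then trace (hol m (R @ Q))
     else if Q ! 0 = prod.swap b then - trace (hol m (tl R @ tl Q)) else 0)"
proof -
  obtain R' where R': "R = b # R'" using R by (cases R) auto
  obtain c Q' where Q': "Q = c # Q'" using Q by (cases Q) auto
  have neq: "prod.swap a \<noteq> a" "a \<noteq> prod.swap a" using swap_neq[OF a] by auto
  note sw = trace_hol_swap[of m]
  consider "b = a" "c = a" | "b = prod.swap a" "c = prod.swap a" | "b = a" "c = prod.swap a"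
    | "b = prod.swap a" "c = a" | "c \<notin> {a, prod.swap a}" using b by auto
  then show ?thesis
  proof cases
    case 1
    have "trace (hol m ((Q' @ [a]) @ (R' @ [a]))) = trace (hol m (a # R' @ a # Q'))"
      using sw[of "Q'" "[a] @ R' @ [a]"] sw[of "[a] @ R'" "[a] @ Q'"] sw[of "a # R' @ [a]" Q'] by simp
    then show ?thesis using 1 by (simp add: R' Q' cut_word_def cut_pos_def edge_sign_def)
  next
    case 2
    then show ?thesis using neq sw[of "prod.swap a # R'" "prod.swap a # Q'"]
      by (simp add: R' Q' cut_word_def cut_pos_def edge_sign_def)
  next
    case 3
    then show ?thesis using neq trace_hol_cancel_ends(2)[OF m a, of "Q' @ R'"] sw[of R' Q']
      by (simp add: R' Q' cut_word_def cut_pos_def edge_sign_def)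
  next
    case 4
    then show ?thesis using neq hol_cancel_edge(1)[OF m a, of Q' R'] sw[of R' Q']
      by (simp add: R' Q' cut_word_def cut_pos_def edge_sign_def)
  next
    case 5
    then show ?thesis using b by (auto simp: Q' edge_sign_def)
  qed
qed

text \<open>The same analysis for two insertions in one word. The summand \<open>s = 0\<close> is the crossing paired
  with itself: one of the two pieces is empty and has trace \<open>tr 1 = d\<close>.\<close>

lemma split_word:
  fixes m :: "('v, 'd::finite) connection"
  assumes m: "m \<in> connections E" and a: "a \<in> E" and b: "b \<in> {a, prod.swap a}"
    and R: "R \<noteq> []" "R ! 0 = b"
  defines "K \<equiv> cut_word a R 0"
  shows "of_real (edge_sign a b) * (\<Sum>t<length R. of_real (edge_sign a (K ! t)) *
      (trace (hol m (drop (cut_pos a (K ! t) t) K)) * trace (hol m (take (cut_pos a (K ! t) t) K)))) =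
    (\<Sum>s<length R.
      if R ! s = b then
        if s = 0 then of_nat CARD('d) * trace (hol m R)
        else trace (hol m (take s R)) * trace (hol m (drop s R))
      else if R ! s = prod.swap b then
        - (trace (hol m (tl (take s R))) * trace (hol m (drop (Suc s) R)))
      else 0)" (is "of_real _ * (\<Sum>t<_. ?g t) = (\<Sum>s<_. ?h s)")
proof -
  obtain R' where R': "R = b # R'" using R by (cases R) auto
  have neq: "prod.swap a \<noteq> a" "a \<noteq> prod.swap a" using swap_neq[OF a] by auto
  have d: "trace (mat 1 :: complex ^ 'd ^ 'd) = of_nat CARD('d)"
    by (simp add: trace_def mat_def)
  note sw = trace_hol_swap[of m]
  show ?thesis
  proof (cases "b = a")
    case True
    \<comment> \<open>\<open>W\<close> is inserted after the first step, so \<open>K\<close> is \<open>R\<close> with its first letter moved to the end: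
      position \<open>s\<close> of \<open>R\<close> is position \<open>s - 1\<close> of \<open>K\<close>, and position \<open>0\<close> is the last one\<close>
    have K: "K = R' @ [a]" using True by (simp add: K_def R' cut_word_def cut_pos_def)
    have eq0: "?g (length R') = ?h 0"
      by (simp add: K R' True cut_pos_def edge_sign_def d trace_hol_swap[of m R' "[a]"])
    have eqS: "?g s = ?h (Suc s)" if s: "s < length R'" for s
    proof -
      define U V where "U = take s R'" and "V = drop (Suc s) R'"
      define e where "e = R' ! s"
      have R'_eq: "R' = U @ e # V" using id_take_nth_drop[OF s] by (simp add: U_def V_def e_def)
      have len: "length U = s" using s by (simp add: U_def)
      have K': "K = U @ e # V @ [a]" and RR: "R = a # U @ e # V" by (simp_all add: K R'_eq R' True)
      have nth: "K ! s = e" "R ! Suc s = e" using len by (simp_all add: K' RR nth_append)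
      consider "e = a" | "e = prod.swap a" | "e \<notin> {a, prod.swap a}" by auto
      then show ?thesis
      proof cases
        case 1
        then show ?thesis unfolding nth
          using sw[of U "[a]"] sw[of V "[a]"] len
          by (simp add: K' RR True cut_pos_def edge_sign_def)
      next
        case 2
        then show ?thesis unfolding nth
          using neq trace_hol_cancel_ends(2)[OF m a, of V] len
          by (simp add: K' RR True cut_pos_def edge_sign_def)
      next
        case 3
        then show ?thesis unfolding nth using True by (simp add: edge_sign_def)
      qed
    qed
    have "(\<Sum>t<length R. ?g t) = ?g (length R') + (\<Sum>s<length R'. ?g s)"
      by (simp add: R')
    also have "\<dots> = ?h 0 + (\<Sum>s<length R'. ?h (Suc s))"
      using eq0 eqS by simp
    also have "\<dots> = (\<Sum>s<length R. ?h s)"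
      unfolding R' list.size sum.lessThan_Suc_shift add_0_right add_Suc_right by simp
    finally show ?thesis using True by (simp add: edge_sign_def)
  next
    case False
    then have ba: "b = prod.swap a" using b by simp
    have K: "K = R" using False by (simp add: K_def R' cut_word_def cut_pos_def)
    have "- ?g s = ?h s" if s: "s < length R" for s
    proof (cases s)
      case 0
      then show ?thesis using neq by (simp add: K R' ba cut_pos_def edge_sign_def d)
    next
      case (Suc s')
      have s': "s' < length R'" using s Suc by (simp add: R')
      define U V where "U = take s' R'" and "V = drop (Suc s') R'"
      define e where "e = R' ! s'"
      have R'_eq: "R' = U @ e # V" using id_take_nth_drop[OF s'] by (simp add: U_def V_def e_def)
      have len: "length U = s'" using s' by (simp add: U_def)
      have RR: "R = b # U @ e # V" by (simp add: R'_eq R')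
      have nth: "R ! s = e" using len Suc by (simp add: RR nth_append)
      consider "e = a" | "e = prod.swap a" | "e \<notin> {a, prod.swap a}" by auto
      then show ?thesis
      proof cases
        case 1
        then show ?thesis unfolding nth K
          using neq trace_hol_cancel_ends(2)[OF m a, of U] len Suc
          by (simp add: RR ba cut_pos_def edge_sign_def)
      next
        case 2
        then show ?thesis unfolding nth K using neq Suc
          by (simp add: ba cut_pos_def edge_sign_def)
      next
        case 3
        then show ?thesis unfolding nth K using ba by (simp add: edge_sign_def)
      qed
    qed
    then have "- (\<Sum>t<length R. ?g t) = (\<Sum>s<length R. ?h s)"
      by (simp add: sum_negf[symmetric] cong: sum.cong_simp)
    then show ?thesis using neq by (simp add: edge_sign_def ba)
  qed
qed

end

section \<open>The Casimir operator on a product of loop traces\<close>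

definition positions :: "'v list list \<Rightarrow> (nat \<times> nat) set" where
  "positions bs = Sigma {..<length bs} (\<lambda>i. {..<length (bs ! i)})"

lemma finite_positions [simp]: "finite (positions bs)"
  by (simp add: positions_def)

definition step_at :: "'v list list \<Rightarrow> nat \<times> nat \<Rightarrow> 'v \<times> 'v" where
  "step_at bs p = edge_at (bs ! fst p) (snd p)"

lemma crossings_eq: "crossings b bs = {p \<in> positions bs. step_at bs p = b}"
  by (auto simp: crossings_def positions_def step_at_def)

definition word_at :: "'v list list \<Rightarrow> nat \<times> nat \<Rightarrow> ('v \<times> 'v) list" where
  "word_at bs p = steps (rotate (snd p) (bs ! fst p))"

text \<open>The factor of \<open>\<tau>\<close> that a move leaves alone; \<open>J\<close> contains the loops that it consumes.\<close>

definition rest_trace :: "('v, 'd::finite) connection \<Rightarrow> 'v list list \<Rightarrow> nat set \<Rightarrow> complex" where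
  "rest_trace m bs J = (\<Prod>k\<in>{..<length bs} - J. trace (hol m (steps (bs ! k))))"

text \<open>The value of \<open>\<tau>\<close> after the positive move at the crossings \<open>p\<close> and \<open>q\<close>, in terms of words.\<close>

definition plus_value ::
  "('v, 'd::finite) connection \<Rightarrow> 'v list list \<Rightarrow> nat \<times> nat \<Rightarrow> nat \<times> nat \<Rightarrow> complex" where
  "plus_value m bs p q =
    (if fst p \<noteq> fst q then
       trace (hol m (word_at bs p @ word_at bs q)) * rest_trace m bs {fst p, fst q}
     else if snd p \<noteq> snd q then
       let s = offset (bs ! fst p) (snd p) (snd q) in
       trace (hol m (take s (word_at bs p))) * trace (hol m (drop s (word_at bs p))) *
         rest_trace m bs {fst p}
     else rest_trace m bs {})"

text \<open>The value of \<open>\<tau>\<close> after the negative move. Reduction is absent here, because it does not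
  affect traces.\<close>

definition minus_value ::
  "('v, 'd::finite) connection \<Rightarrow> 'v list list \<Rightarrow> nat \<times> nat \<Rightarrow> nat \<times> nat \<Rightarrow> complex" where
  "minus_value m bs p q =
    (if fst p \<noteq> fst q then
       trace (hol m (tl (word_at bs p) @ tl (word_at bs q))) * rest_trace m bs {fst p, fst q}
     else
       let s = offset (bs ! fst p) (snd p) (snd q) in
       trace (hol m (tl (take s (word_at bs p)))) * trace (hol m (drop (Suc s) (word_at bs p))) *
         rest_trace m bs {fst p})"

definition trace_deriv ::
  "'v \<times> 'v \<Rightarrow> ('v \<times> 'v) list \<Rightarrow> complex ^ 'd ^ 'd \<Rightarrow> ('v, 'd::finite) connection \<Rightarrow> complex" where
  "trace_deriv a es W m =
     (\<Sum>t<length es. of_real (edge_sign a (es ! t)) * trace (W ** hol m (cut_word a es t)))"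

definition trace_deriv2 ::
  "'v \<times> 'v \<Rightarrow> ('v \<times> 'v) list \<Rightarrow> complex ^ 'd ^ 'd \<Rightarrow> ('v, 'd::finite) connection \<Rightarrow> complex" where
  "trace_deriv2 a es W m =
     (\<Sum>t<length es. of_real (edge_sign a (es ! t)) *
       (let K = cut_word a es t in
        \<Sum>t'<length es. of_real (edge_sign a (K ! t')) *
          trace (W ** hol m (drop (cut_pos a (K ! t') t') K) ** W **
            hol m (take (cut_pos a (K ! t') t') K))))"

lemma length_cut_word [simp]: "t < length es \<Longrightarrow> length (cut_word a es t) = length es"
  by (simp add: cut_word_conv_rotate)

lemma sum_trace_deriv_trace_deriv:
  assumes "orthonormal_basis B"
  shows "(\<Sum>W\<in>B. trace_deriv a es W m * trace_deriv a fs W m) =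
    - (\<Sum>t<length es. of_real (edge_sign a (es ! t)) * (\<Sum>t'<length fs. of_real (edge_sign a (fs ! t')) *
        trace (hol m (cut_word a fs t' @ cut_word a es t))))"
proof -
  have "(\<Sum>W\<in>B. trace_deriv a es W m * trace_deriv a fs W m) =
    (\<Sum>t<length es. \<Sum>t'<length fs. of_real (edge_sign a (es ! t)) * of_real (edge_sign a (fs ! t')) *
      (\<Sum>W\<in>B. trace (W ** hol m (cut_word a es t)) * trace (W ** hol m (cut_word a fs t'))))"
    unfolding trace_deriv_def sum_product
    by (subst sum.swap, intro sum.cong refl, subst sum.swap) (simp add: sum_distrib_left ac_simps)
  then show ?thesis
    unfolding sum_basis_trace_trace[OF assms] hol_append
    by (simp add: sum_negf sum_distrib_left mult.assoc)
qed

lemma sum_trace_deriv2: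
  assumes "orthonormal_basis B"
  shows "(\<Sum>W\<in>B. trace_deriv2 a es W m) =
    - (\<Sum>t<length es. of_real (edge_sign a (es ! t)) * (let K = cut_word a es t in
        \<Sum>t'<length es. of_real (edge_sign a (K ! t')) *
          (trace (hol m (drop (cut_pos a (K ! t') t') K)) *
           trace (hol m (take (cut_pos a (K ! t') t') K)))))"
proof -
  have "(\<Sum>W\<in>B. trace_deriv2 a es W m) =
    (\<Sum>t<length es. of_real (edge_sign a (es ! t)) * (let K = cut_word a es t in
        \<Sum>t'<length es. of_real (edge_sign a (K ! t')) *
          (\<Sum>W\<in>B. trace (W ** hol m (drop (cut_pos a (K ! t') t') K) ** W **
            hol m (take (cut_pos a (K ! t') t') K)))))"
    unfolding trace_deriv2_def Let_def sum_distrib_left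
    by (subst sum.swap, intro sum.cong refl, subst sum.swap) simp
  then show ?thesis
    unfolding sum_basis_trace_sandwich[OF assms] Let_def by (simp add: sum_negf)
qed

context finite_graph
begin

lemma edge_deriv_trace_deriv:
  assumes "a \<in> E" "W \<in> antihermitian"
  shows "edge_deriv E a W (\<lambda>m. trace (hol m es)) (trace_deriv a es W)"
    and "edge_deriv E a W (trace_deriv a es W) (trace_deriv2 a es W)"
proof -
  show "edge_deriv E a W (\<lambda>m. trace (hol m es)) (trace_deriv a es W)"
    using edge_deriv_trace_hol[OF assms] by (simp add: trace_deriv_def[abs_def])
  have "edge_deriv E a W
     (\<lambda>m. \<Sum>t<length es. of_real (edge_sign a (es ! t)) * trace (W ** hol m (cut_word a es t)))
     (\<lambda>m. \<Sum>t<length es. of_real (edge_sign a (es ! t)) *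
       (\<Sum>t'<length (cut_word a es t). of_real (edge_sign a (cut_word a es t ! t')) *
          trace (W ** hol m (drop (cut_pos a (cut_word a es t ! t') t') (cut_word a es t)) ** W **
            hol m (take (cut_pos a (cut_word a es t ! t') t') (cut_word a es t)))))"
    using assms by (intro edge_deriv_sum edge_deriv_cmult edge_deriv_trace_W_hol)
  moreover have "trace_deriv2 a es W = (\<lambda>m. \<Sum>t<length es. of_real (edge_sign a (es ! t)) *
       (\<Sum>t'<length (cut_word a es t). of_real (edge_sign a (cut_word a es t ! t')) *
          trace (W ** hol m (drop (cut_pos a (cut_word a es t ! t') t') (cut_word a es t)) ** W **
            hol m (take (cut_pos a (cut_word a es t ! t') t') (cut_word a es t)))))"
    unfolding trace_deriv2_def[abs_def] Let_def by (intro ext sum.cong refl) simp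
  ultimately show "edge_deriv E a W (trace_deriv a es W) (trace_deriv2 a es W)"
    by (simp only: trace_deriv_def[abs_def])
qed

definition loops_deriv ::
  "'v \<times> 'v \<Rightarrow> 'v list list \<Rightarrow> complex ^ 'd ^ 'd \<Rightarrow> ('v, 'd::finite) connection \<Rightarrow> complex" where
  "loops_deriv a bs W m =
    (\<Sum>i<length bs. trace_deriv a (steps (bs ! i)) W m * rest_trace m bs {i})"

definition loops_deriv2 ::
  "'v \<times> 'v \<Rightarrow> 'v list list \<Rightarrow> complex ^ 'd ^ 'd \<Rightarrow> ('v, 'd::finite) connection \<Rightarrow> complex" where
  "loops_deriv2 a bs W m =
    (\<Sum>i<length bs. trace_deriv2 a (steps (bs ! i)) W m * rest_trace m bs {i} +
      trace_deriv a (steps (bs ! i)) W m *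
        (\<Sum>i'\<in>{..<length bs} - {i}. trace_deriv a (steps (bs ! i')) W m * rest_trace m bs {i, i'}))"

lemma edge_deriv_loops:
  fixes W :: "complex ^ 'd::finite ^ 'd"
  assumes a: "a \<in> E" and W: "W \<in> antihermitian"
  shows "edge_deriv E a W (\<lambda>m. rest_trace m bs {}) (loops_deriv a bs W)"
    and "edge_deriv E a W (loops_deriv a bs W) (loops_deriv2 a bs W)"
proof -
  have rest: "edge_deriv E a W (\<lambda>m. rest_trace m bs J)
      (\<lambda>m. \<Sum>i\<in>{..<length bs} - J. trace_deriv a (steps (bs ! i)) W m * rest_trace m bs (insert i J))" for J
  proof -
    have "{..<length bs} - insert i J = {..<length bs} - J - {i}" for i by auto
    then show ?thesis
      unfolding rest_trace_def using a W
      by (simp only:) (intro edge_deriv_prod edge_deriv_trace_deriv; simp)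
  qed
  from rest[of "{}"] show "edge_deriv E a W (\<lambda>m. rest_trace m bs {}) (loops_deriv a bs W)"
    by (simp add: loops_deriv_def[abs_def])
  have rest1: "edge_deriv E a W (\<lambda>m. rest_trace m bs {i})
      (\<lambda>m. \<Sum>i'\<in>{..<length bs} - {i}. trace_deriv a (steps (bs ! i')) W m * rest_trace m bs {i, i'})" for i
  proof -
    have "{i', i} = {i, i'}" for i' by auto
    then show ?thesis using rest[of "{i}"] by simp
  qed
  show "edge_deriv E a W (loops_deriv a bs W) (loops_deriv2 a bs W)"
    unfolding loops_deriv_def[abs_def] loops_deriv2_def[abs_def]
    by (intro edge_deriv_sum edge_deriv_mult edge_deriv_trace_deriv[OF a W] rest1 a)
qed

lemma sum_loops_deriv2:
  assumes B: "orthonormal_basis B"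
  shows "- (\<Sum>W\<in>B. loops_deriv2 a bs W m) =
    (\<Sum>i<length bs. \<Sum>t<length (bs ! i). of_real (edge_sign a (steps (bs ! i) ! t)) *
      ((let K = cut_word a (steps (bs ! i)) t in
        \<Sum>t'<length (bs ! i). of_real (edge_sign a (K ! t')) *
          (trace (hol m (drop (cut_pos a (K ! t') t') K)) *
           trace (hol m (take (cut_pos a (K ! t') t') K)))) * rest_trace m bs {i} +
       (\<Sum>i'\<in>{..<length bs} - {i}. (\<Sum>t'<length (bs ! i'). of_real (edge_sign a (steps (bs ! i') ! t')) *
          trace (hol m (cut_word a (steps (bs ! i')) t' @ cut_word a (steps (bs ! i)) t))) *
          rest_trace m bs {i, i'})))"
proof -
  let ?w = "\<lambda>i. steps (bs ! i)"
  have "(\<Sum>W\<in>B. loops_deriv2 a bs W m) =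
    (\<Sum>i<length bs. (\<Sum>W\<in>B. trace_deriv2 a (?w i) W m) * rest_trace m bs {i} +
      (\<Sum>i'\<in>{..<length bs} - {i}.
        (\<Sum>W\<in>B. trace_deriv a (?w i) W m * trace_deriv a (?w i') W m) * rest_trace m bs {i, i'}))"
    unfolding loops_deriv2_def
    by (subst sum.swap, intro sum.cong refl, subst sum.distrib)
      (simp add: sum_distrib_right sum_distrib_left mult.assoc sum.swap[of _ _ B])
  then show ?thesis
    unfolding sum_trace_deriv2[OF B] sum_trace_deriv_trace_deriv[OF B] Let_def
    by (simp add: sum_negf[symmetric] sum.distrib sum_distrib_left sum_distrib_right distrib_left mult.assoc
        sum.swap[of _ "{..<length (bs ! _)}" "{..<length bs} - {_}"])
qed

end

lemma rest_trace_insert: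
  assumes "i < length bs" "i \<notin> J"
  shows "rest_trace m bs J = trace (hol m (steps (bs ! i))) * rest_trace m bs (insert i J)"
proof -
  have eq: "{..<length bs} - J = insert i ({..<length bs} - insert i J)" using assms by auto
  show ?thesis unfolding rest_trace_def by (subst eq, subst prod.insert) simp_all
qed

lemma sum_positions: "(\<Sum>q\<in>positions bs. f q) = (\<Sum>i<length bs. \<Sum>j<length (bs ! i). f (i, j))"
  by (simp add: positions_def sum.Sigma)

lemma word_at_conv: "word_at bs (i, j) = rotate j (steps (bs ! i))"
  by (simp add: word_at_def steps_rotate)

lemma word_at_first:
  assumes "j < length (bs ! i)"
  shows "word_at bs (i, j) \<noteq> []" "word_at bs (i, j) ! 0 = step_at bs (i, j)"
proof -
  have "bs ! i \<noteq> []" using assms by auto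
  then show "word_at bs (i, j) \<noteq> []" "word_at bs (i, j) ! 0 = step_at bs (i, j)"
    using assms nth_rotate[of 0 "steps (bs ! i)" j]
    by (auto simp: word_at_conv step_at_def nth_steps simp flip: length_greater_0_conv)
qed

lemma trace_word_at: "trace (hol m (word_at bs p)) = trace (hol m (steps (bs ! fst p)))"
  by (cases p) (simp add: word_at_conv trace_hol_rotate)

context finite_graph
begin

text \<open>All second insertions for a fixed first crossing \<open>(i, t)\<close>: those on the same loop split it, those
  on another loop merge the two.\<close>

lemma sum_pair_terms:
  fixes m :: "('v, 'd::finite) connection"
  assumes m: "m \<in> connections E" and a: "a \<in> E"
    and p: "i < length bs" "t < length (bs ! i)"
    and b: "step_at bs (i, t) = b" "b \<in> {a, prod.swap a}"
  shows "of_real (edge_sign a b) *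
      ((let K = cut_word a (steps (bs ! i)) t in
        \<Sum>t'<length (bs ! i). of_real (edge_sign a (K ! t')) *
          (trace (hol m (drop (cut_pos a (K ! t') t') K)) *
           trace (hol m (take (cut_pos a (K ! t') t') K)))) * rest_trace m bs {i} +
       (\<Sum>i'\<in>{..<length bs} - {i}. (\<Sum>t'<length (bs ! i'). of_real (edge_sign a (steps (bs ! i') ! t')) *
          trace (hol m (cut_word a (steps (bs ! i')) t' @ cut_word a (steps (bs ! i)) t))) *
          rest_trace m bs {i, i'})) =
    (\<Sum>q\<in>positions bs.
      if step_at bs q = b then
        if q = (i, t) then of_nat CARD('d) * rest_trace m bs {} else plus_value m bs (i, t) q
      else if step_at bs q = prod.swap b then - minus_value m bs (i, t) q else 0)"
    (is "?s * (?X * _ + (\<Sum>i'\<in>_. ?Y i' * _)) = (\<Sum>q\<in>_. ?f q)")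
proof -
  let ?R = "word_at bs (i, t)"
  have R: "?R \<noteq> []" "?R ! 0 = b" "length ?R = length (bs ! i)"
    using word_at_first[OF p(2)] b(1) by (simp_all add: word_at_conv)
  have cutR: "cut_word a (steps (bs ! i)) t = cut_word a ?R 0"
    using p(2) cut_word_rotate[of t "steps (bs ! i)"] by (simp add: word_at_conv)
  have same: "?s * ?X * rest_trace m bs {i} = (\<Sum>j<length (bs ! i). ?f (i, j))"
  proof -
    let ?h = "\<lambda>s. if ?R ! s = b then
        if s = 0 then of_nat CARD('d) * trace (hol m ?R)
        else trace (hol m (take s ?R)) * trace (hol m (drop s ?R))
      else if ?R ! s = prod.swap b then
        - (trace (hol m (tl (take s ?R))) * trace (hol m (drop (Suc s) ?R)))
      else 0"
    have "?s * ?X = (\<Sum>s<length (bs ! i). ?h s)"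
      unfolding Let_def cutR using split_word[OF m a b(2) R(1,2)] by (simp only: R(3))
    also have "\<dots> = (\<Sum>j<length (bs ! i). ?h (offset (bs ! i) t j))"
      using sum_shift_offset[OF p(2), of ?h] by (simp only: offset_def)
    finally have *: "?s * ?X * rest_trace m bs {i} =
        (\<Sum>j<length (bs ! i). ?h (offset (bs ! i) t j) * rest_trace m bs {i})"
      by (simp only: sum_distrib_right)
    have "?h (offset (bs ! i) t j) * rest_trace m bs {i} = ?f (i, j)" if j: "j < length (bs ! i)" for j
    proof -
      have "?R ! offset (bs ! i) t j = step_at bs (i, j)"
        using nth_rotate_offset[OF p(2) j, of "steps (bs ! i)"] j
        by (simp add: word_at_conv step_at_def nth_steps)
      moreover have "offset (bs ! i) t j = 0 \<longleftrightarrow> (i, j) = (i, t)"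
        using offset_eq_0_iff[OF p(2) j] by simp
      moreover have "trace (hol m ?R) * rest_trace m bs {i} = rest_trace m bs {}"
        using rest_trace_insert[OF p(1), of "{}" m] by (simp add: trace_word_at)
      ultimately show ?thesis
        by (auto simp: plus_value_def minus_value_def Let_def mult.assoc)
    qed
    then show ?thesis unfolding * by (intro sum.cong) auto
  qed
  have other: "?s * (?Y i' * rest_trace m bs {i, i'}) = (\<Sum>j<length (bs ! i'). ?f (i', j))"
    if i': "i' < length bs" "i' \<noteq> i" for i'
  proof -
    have "?s * (of_real (edge_sign a (steps (bs ! i') ! j)) *
          trace (hol m (cut_word a (steps (bs ! i')) j @ cut_word a (steps (bs ! i)) t))) *
        rest_trace m bs {i, i'} = ?f (i', j)" if j: "j < length (bs ! i')" for j
    proof -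
      let ?Q = "word_at bs (i', j)"
      have cutQ: "cut_word a (steps (bs ! i')) j = cut_word a ?Q 0"
        using j cut_word_rotate[of j "steps (bs ! i')"] by (simp add: word_at_conv)
      have Q0: "steps (bs ! i') ! j = ?Q ! 0" and Q1: "?Q ! 0 = step_at bs (i', j)"
        using j word_at_first(2)[OF j] by (simp_all add: step_at_def nth_steps)
      show ?thesis
        unfolding cutR cutQ Q0 merge_word[OF m a b(2) R(1,2) word_at_first(1)[OF j]]
        using i' by (simp add: Q1 plus_value_def minus_value_def)
    qed
    then show ?thesis
      by (simp add: sum_distrib_left sum_distrib_right mult.assoc)
  qed
  have "(\<Sum>q\<in>positions bs. ?f q) =
      (\<Sum>j<length (bs ! i). ?f (i, j)) + (\<Sum>i'\<in>{..<length bs} - {i}. \<Sum>j<length (bs ! i'). ?f (i', j))"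
    unfolding sum_positions using p(1) by (subst sum.remove[of _ i]) auto
  also have "\<dots> = ?s * ?X * rest_trace m bs {i} +
      (\<Sum>i'\<in>{..<length bs} - {i}. ?s * (?Y i' * rest_trace m bs {i, i'}))"
    unfolding same by (intro arg_cong2[of _ _ _ _ "(+)"] refl sum.cong other[symmetric]) auto
  finally show ?thesis by (simp only: distrib_left sum_distrib_left mult.assoc)
qed

text \<open>The positive move at \<open>(p, p)\<close> changes nothing and has the value \<open>rest_trace m bs {}\<close>, whereas the
  Casimir operator assigns \<open>d\<close> times this value to the pair. The difference gives the factor \<open>d - 1\<close>.\<close>

lemma sum_pair_terms_crossings:
  fixes m :: "('v, 'd::finite) connection"
  assumes b: "b \<in> E" and p: "p \<in> crossings b bs"
  shows "(\<Sum>q\<in>positions bs.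
      if step_at bs q = b then
        if q = p then of_nat CARD('d) * rest_trace m bs {} else plus_value m bs p q
      else if step_at bs q = prod.swap b then - minus_value m bs p q else 0) =
    (of_nat CARD('d) - 1) * rest_trace m bs {} + (\<Sum>q\<in>crossings b bs. plus_value m bs p q)
      - (\<Sum>q\<in>crossings (prod.swap b) bs. minus_value m bs p q)"
proof -
  have neq: "prod.swap b \<noteq> b" by (rule swap_neq[OF b])
  have diag: "plus_value m bs p p = rest_trace m bs {}" by (simp add: plus_value_def)
  have "(\<Sum>q\<in>positions bs.
      if step_at bs q = b then
        if q = p then of_nat CARD('d) * rest_trace m bs {} else plus_value m bs p q
      else if step_at bs q = prod.swap b then - minus_value m bs p q else 0) =
    (\<Sum>q\<in>positions bs. (if q = p then (of_nat CARD('d) - 1) * rest_trace m bs {} else 0) +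
      ((if step_at bs q = b then plus_value m bs p q else 0) -
       (if step_at bs q = prod.swap b then minus_value m bs p q else 0)))"
    using p neq neq[symmetric] by (intro sum.cong refl) (auto simp: crossings_eq diag left_diff_distrib)
  also have "\<dots> = (of_nat CARD('d) - 1) * rest_trace m bs {} + ((\<Sum>q\<in>crossings b bs. plus_value m bs p q)
      - (\<Sum>q\<in>crossings (prod.swap b) bs. minus_value m bs p q))"
    using p by (simp add: sum.distrib sum_subtractf crossings_eq sum.inter_filter)
  finally show ?thesis by simp
qed

text \<open>Steps along other edges have sign zero.\<close>

lemma sum_signed_positions:
  fixes g :: "nat \<times> nat \<Rightarrow> complex"
  assumes a: "a \<in> E"
    and g: "\<And>b p. b \<in> {a, prod.swap a} \<Longrightarrow> p \<in> crossings b bs \<Longrightarrow> of_real (edge_sign a b) * g p = h b p"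
  shows "(\<Sum>i<length bs. \<Sum>t<length (bs ! i). of_real (edge_sign a (steps (bs ! i) ! t)) * g (i, t)) =
    (\<Sum>b\<in>{a, prod.swap a}. \<Sum>p\<in>crossings b bs. h b p)"
proof -
  have neq: "prod.swap a \<noteq> a" by (rule swap_neq[OF a])
  have "(\<Sum>i<length bs. \<Sum>t<length (bs ! i). of_real (edge_sign a (steps (bs ! i) ! t)) * g (i, t)) =
      (\<Sum>p\<in>positions bs. of_real (edge_sign a (step_at bs p)) * g p)"
    unfolding sum_positions by (intro sum.cong refl) (simp add: step_at_def nth_steps)
  also have "\<dots> = (\<Sum>p\<in>positions bs. (if step_at bs p = a then h a p else 0) +
      (if step_at bs p = prod.swap a then h (prod.swap a) p else 0))"
    using g[of a] g[of "prod.swap a"] neq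
    by (intro sum.cong refl) (auto simp: crossings_eq edge_sign_def)
  also have "\<dots> = (\<Sum>p\<in>crossings a bs. h a p) + (\<Sum>p\<in>crossings (prod.swap a) bs. h (prod.swap a) p)"
    by (simp add: sum.distrib crossings_eq sum.inter_filter)
  finally show ?thesis using neq by simp
qed

lemma casimir_edge_loops:
  fixes m :: "('v, 'd::finite) connection"
  assumes m: "m \<in> connections E" and a: "a \<in> E" and B: "orthonormal_basis B"
    and f: "\<And>m. m \<in> connections E \<Longrightarrow> f m = rest_trace m bs {}"
  shows "- casimir_edge B a f m = (\<Sum>b\<in>{a, prod.swap a}. \<Sum>p\<in>crossings b bs.
      (of_nat CARD('d) - 1) * rest_trace m bs {} + (\<Sum>q\<in>crossings b bs. plus_value m bs p q)
      - (\<Sum>q\<in>crossings (prod.swap b) bs. minus_value m bs p q))"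
proof -
  have "casimir_edge B a f m = (\<Sum>W\<in>B. loops_deriv2 a bs W m)"
  proof (rule casimir_edge_eq[OF m a B])
    fix W assume "W \<in> B"
    then have W: "W \<in> antihermitian" by (rule orthonormal_basis_antihermitian[OF B])
    show "edge_deriv E a W f (loops_deriv a bs W)"
      by (rule edge_deriv_cong[OF edge_deriv_loops(1)[OF a W] a W]) (simp_all add: f)
    show "edge_deriv E a W (loops_deriv a bs W) (loops_deriv2 a bs W)"
      by (rule edge_deriv_loops(2)[OF a W])
  qed
  then have "- casimir_edge B a f m = - (\<Sum>W\<in>B. loops_deriv2 a bs W m)" by simp
  also have "\<dots> = (\<Sum>i<length bs. \<Sum>t<length (bs ! i). of_real (edge_sign a (steps (bs ! i) ! t)) *
      (case (i, t) of (i, t) \<Rightarrow> (let K = cut_word a (steps (bs ! i)) t in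
        \<Sum>t'<length (bs ! i). of_real (edge_sign a (K ! t')) *
          (trace (hol m (drop (cut_pos a (K ! t') t') K)) *
           trace (hol m (take (cut_pos a (K ! t') t') K)))) * rest_trace m bs {i} +
       (\<Sum>i'\<in>{..<length bs} - {i}. (\<Sum>t'<length (bs ! i'). of_real (edge_sign a (steps (bs ! i') ! t')) *
          trace (hol m (cut_word a (steps (bs ! i')) t' @ cut_word a (steps (bs ! i)) t))) *
          rest_trace m bs {i, i'})))"
    unfolding sum_loops_deriv2[OF B] prod.case ..
  also have "\<dots> = (\<Sum>b\<in>{a, prod.swap a}. \<Sum>p\<in>crossings b bs.
      (of_nat CARD('d) - 1) * rest_trace m bs {} + (\<Sum>q\<in>crossings b bs. plus_value m bs p q)
      - (\<Sum>q\<in>crossings (prod.swap b) bs. minus_value m bs p q))"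
  proof (rule sum_signed_positions[OF a], goal_cases)
    case (1 b p)
    have b: "b \<in> E" using 1(1) a swap_in_E[OF a] by blast
    obtain i t where p: "p = (i, t)" by (cases p)
    then have it: "i < length bs" "t < length (bs ! i)" "step_at bs (i, t) = b"
      using 1 by (auto simp: crossings_eq positions_def)
    show ?case
      unfolding p prod.case
      by (rule trans[OF sum_pair_terms[OF m a it 1(1)] sum_pair_terms_crossings[OF b 1(2)[unfolded p]]])
  qed
  finally show ?thesis .
qed

end

section \<open>Plaquettes\<close>

lemma crossings_loop_loop_of:
  "crossings_loop e (loop_of \<xi>) = card {i. i < length \<xi> \<and> edge_at \<xi> i = e}"
proof -
  have count: "card {i. i < length \<zeta> \<and> edge_at \<zeta> i = e} = length (filter (\<lambda>x. x = e) (steps \<zeta>))" for \<zeta>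
    unfolding length_filter_conv_card by (rule arg_cong[of _ _ card]) (auto simp: nth_steps)
  have "(SOME \<zeta>. \<zeta> \<in> loop_of \<xi>) \<in> loop_of \<xi>" by (rule someI[of "\<lambda>\<zeta>. \<zeta> \<in> loop_of \<xi>", OF self_in_loop_of])
  then obtain k where "(SOME \<zeta>. \<zeta> \<in> loop_of \<xi>) = rotate k \<xi>" by (auto simp: loop_of_iff)
  moreover have "length (filter P (rotate k xs)) = length (filter P xs)" for P and xs :: "('a \<times> 'a) list"
    unfolding rotate_drop_take filter_append length_append
    by (metis add.commute append_take_drop_id filter_append length_append)
  ultimately show ?thesis by (simp add: crossings_loop_def count steps_rotate)
qed

lemma steps_first:
  assumes "\<zeta> \<noteq> []"
  shows "steps \<zeta> ! 0 = edge_at \<zeta> 0" "hd \<zeta> = fst (edge_at \<zeta> 0)"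
  using assms by (simp_all add: nth_steps edge_at_def hd_conv_nth)

lemma edge_at_rotate:
  assumes "j < length \<xi>"
  shows "edge_at (rotate j \<xi>) 0 = edge_at \<xi> j"
proof -
  have "\<xi> \<noteq> []" using assms by auto
  then show ?thesis
    using nth_rotate[of 0 "steps \<xi>" j] assms nth_steps[of 0 "rotate j \<xi>"]
    by (simp add: steps_rotate nth_steps)
qed

context finite_graph
begin

text \<open>The four vertices are distinct: neighbours differ because the graph is irreflexive, and opposite
  vertices differ because the loop does not backtrack.\<close>

lemma plaquette_based:
  assumes "\<eta> \<in> plaquettes E" "\<zeta> \<in> \<eta>"
  shows "\<zeta> \<in> based_loops E" "\<eta> = loop_of \<zeta>" "length \<zeta> = 4" "distinct \<zeta>"
proof -
  obtain \<xi> where \<xi>: "\<xi> \<in> based_loops E" "\<eta> = loop_of \<xi>"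
    using assms(1) by (auto simp: plaquettes_def geodesic_loops_def elim: loops_obtain)
  show based: "\<zeta> \<in> based_loops E"
    using \<xi> assms(2) loop_of_steps(1)[of \<zeta> \<xi>] by (simp add: based_loops_iff)
  show "\<eta> = loop_of \<zeta>" using \<xi> assms(2) loop_of_eqI by blast
  show len: "length \<zeta> = 4" using assms by (auto simp: plaquettes_def)
  then obtain x y z w where \<zeta>: "\<zeta> = [x, y, z, w]"
    by (auto simp: numeral_eq_Suc length_Suc_conv)
  have edges: "(x, y) \<in> E" "(y, z) \<in> E" "(z, w) \<in> E" "(w, x) \<in> E"
    using based by (auto simp: based_loops_iff \<zeta> steps_eq_walk)
  have "edge_at \<zeta> (Suc i mod length \<zeta>) \<noteq> prod.swap (edge_at \<zeta> i)" if "i < length \<zeta>" for i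
    using assms that by (auto simp: plaquettes_def geodesic_loops_def geodesic_def)
  from this[of 0] this[of 1] have "x \<noteq> z" "y \<noteq> w" by (auto simp: \<zeta> edge_at_def)
  moreover have "u \<noteq> v" if "(u, v) \<in> E" for u v using irrefl_E that by (auto simp: irrefl_def)
  ultimately show "distinct \<zeta>" using edges by (auto simp: \<zeta>)
qed

lemma plaquettes_at_iff:
  assumes "\<eta> \<in> plaquettes E" "\<zeta> \<in> \<eta>"
  shows "\<eta> \<in> plaquettes_at E b \<longleftrightarrow> (\<exists>t<length \<zeta>. edge_at \<zeta> t = b)"
proof -
  have "crossings_loop b \<eta> = card {i. i < length \<zeta> \<and> edge_at \<zeta> i = b}"
    using crossings_loop_loop_of[of b \<zeta>] plaquette_based(2)[OF assms] by simp
  then show ?thesis using assms(1) by (auto simp: plaquettes_at_def card_gt_0_iff)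
qed

text \<open>Distinct vertices allow only one crossing of \<open>b\<close>, hence only one representative starting with
  it.\<close>

lemma start_at_plaquette:
  assumes \<eta>: "\<eta> \<in> plaquettes E" "\<zeta> \<in> \<eta>" and t: "t < length \<zeta>" "edge_at \<zeta> t = b"
  shows "start_at b \<eta> = rotate t \<zeta>"
  unfolding start_at_def
proof (rule some_equality)
  have ne: "\<zeta> \<noteq> []" using t by auto
  show "rotate t \<zeta> \<in> \<eta> \<and> rotate t \<zeta> \<noteq> [] \<and> edge_at (rotate t \<zeta>) 0 = b"
    using plaquette_based(2)[OF \<eta>] t ne by (auto simp: loop_of_iff edge_at_rotate)
  fix \<xi> assume \<xi>: "\<xi> \<in> \<eta> \<and> \<xi> \<noteq> [] \<and> edge_at \<xi> 0 = b"
  then obtain k where k: "\<xi> = rotate k \<zeta>" using plaquette_based(2)[OF \<eta>] by (auto simp: loop_of_iff)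
  define t' where "t' = k mod length \<zeta>"
  have t': "t' < length \<zeta>" "\<xi> = rotate t' \<zeta>"
    using ne k rotate_conv_mod[of k \<zeta>] by (simp_all add: t'_def)
  then have "\<zeta> ! t' = \<zeta> ! t" using \<xi> t edge_at_rotate[OF t'(1)] by (simp add: edge_at_def)
  then have "t' = t" using t'(1) t(1) plaquette_based(4)[OF \<eta>] by (simp add: nth_eq_iff_index_eq)
  then show "\<xi> = rotate t \<zeta>" using t' by simp
qed

lemma start_at_props:
  assumes "\<eta> \<in> plaquettes_at E b"
  shows "start_at b \<eta> \<in> based_loops E" "start_at b \<eta> \<noteq> []" "edge_at (start_at b \<eta>) 0 = b"
    "loop_of (start_at b \<eta>) = \<eta>" "length (start_at b \<eta>) = 4"
proof -
  have \<eta>: "\<eta> \<in> plaquettes E" using assms by (simp add: plaquettes_at_def)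
  then obtain \<zeta> where \<zeta>: "\<zeta> \<in> \<eta>"
    by (auto simp: plaquettes_def geodesic_loops_def elim!: loops_obtain intro: self_in_loop_of)
  obtain t where t: "t < length \<zeta>" "edge_at \<zeta> t = b" using assms plaquettes_at_iff[OF \<eta> \<zeta>] by auto
  have s: "start_at b \<eta> = rotate t \<zeta>" by (rule start_at_plaquette[OF \<eta> \<zeta> t])
  have "rotate t \<zeta> \<in> \<eta>" using plaquette_based(2)[OF \<eta> \<zeta>] by (auto simp: loop_of_iff)
  note pl = plaquette_based[OF \<eta> this]
  show "start_at b \<eta> \<in> based_loops E" "loop_of (start_at b \<eta>) = \<eta>" "length (start_at b \<eta>) = 4"
    unfolding s using pl by simp_all
  then show "start_at b \<eta> \<noteq> []" by auto
  show "edge_at (start_at b \<eta>) 0 = b" using t by (simp add: s edge_at_rotate)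
qed

lemma sum_plaquette_crossings:
  fixes X :: "'v list \<Rightarrow> complex"
  assumes \<eta>: "\<eta> \<in> plaquettes E" "\<zeta> \<in> \<eta>"
  shows "(\<Sum>t<length \<zeta>. if edge_at \<zeta> t = b then X (rotate t \<zeta>) else 0) =
    (if \<eta> \<in> plaquettes_at E b then X (start_at b \<eta>) else 0)"
proof (cases "\<exists>t<length \<zeta>. edge_at \<zeta> t = b")
  case True
  then obtain t where t: "t < length \<zeta>" "edge_at \<zeta> t = b" by blast
  have "edge_at \<zeta> t' = b \<longleftrightarrow> t' = t" if "t' < length \<zeta>" for t'
  proof
    assume "edge_at \<zeta> t' = b"
    then have "\<zeta> ! t' = \<zeta> ! t" using t by (auto simp: edge_at_def)
    then show "t' = t" using that t(1) plaquette_based(4)[OF \<eta>] by (simp add: nth_eq_iff_index_eq)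
  qed (use t in simp)
  then have "(\<Sum>t<length \<zeta>. if edge_at \<zeta> t = b then X (rotate t \<zeta>) else 0) =
      (\<Sum>t'<length \<zeta>. if t' = t then X (rotate t \<zeta>) else 0)"
    by (intro sum.cong) auto
  then show ?thesis using t True by (simp add: plaquettes_at_iff[OF \<eta>] start_at_plaquette[OF \<eta> t])
next
  case False
  then have "(\<Sum>t<length \<zeta>. if edge_at \<zeta> t = b then X (rotate t \<zeta>) else 0) = 0"
    by (intro sum.neutral) auto
  moreover have "\<eta> \<notin> plaquettes_at E b" using False plaquettes_at_iff[OF \<eta>] by simp
  ultimately show ?thesis by simp
qed

lemma finite_plaquettes: "finite (plaquettes E)"
proof (rule finite_subset)
  show "plaquettes E \<subseteq> loop_of ` {\<zeta>. set \<zeta> \<subseteq> fst ` E \<and> length \<zeta> = 4}"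
  proof
    fix \<eta> assume \<eta>: "\<eta> \<in> plaquettes E"
    then obtain \<zeta> where "\<zeta> \<in> \<eta>"
      by (auto simp: plaquettes_def geodesic_loops_def elim!: loops_obtain intro: self_in_loop_of)
    note \<zeta> = plaquette_based[OF \<eta> this]
    have "\<zeta> ! i \<in> fst ` E" if "i < length \<zeta>" for i
      using \<zeta>(1) that by (force simp: based_loops_def edge_at_def)
    then have "set \<zeta> \<subseteq> fst ` E" by (auto simp: in_set_conv_nth)
    then show "\<eta> \<in> loop_of ` {\<zeta>. set \<zeta> \<subseteq> fst ` E \<and> length \<zeta> = 4}" using \<zeta> by auto
  qed
  show "finite (loop_of ` {\<zeta>. set \<zeta> \<subseteq> fst ` E \<and> length \<zeta> = 4})"
    using finite_E by (intro finite_imageI finite_lists_length_eq)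
qed

lemma gauge_equiv_refl:
  fixes m :: "('v, 'd::finite) connection"
  assumes "m \<in> connections E"
  shows "m \<in> gauge_equiv E `` {m}"
proof -
  have "matrix_inv (mat 1) = (mat 1 :: complex ^ 'd ^ 'd)" by (rule matrix_inv_eqI) simp_all
  then show ?thesis using assms
    by (auto simp: gauge_equiv_def unitary_mat_1 intro!: exI[of _ "\<lambda>_. mat 1"])
qed

definition plaq_base :: "'v loop \<Rightarrow> 'v list" where
  "plaq_base \<eta> = (SOME \<zeta>. \<zeta> \<in> \<eta>)"

lemma plaq_base_in:
  assumes "\<eta> \<in> plaquettes E"
  shows "plaq_base \<eta> \<in> \<eta>"
proof -
  obtain \<xi> where "\<eta> = loop_of \<xi>"
    using assms by (auto simp: plaquettes_def geodesic_loops_def elim!: loops_obtain)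
  then show ?thesis unfolding plaq_base_def some_in_eq using self_in_loop_of[of \<xi>] by blast
qed

lemma plaq_sum_eq:
  assumes "m \<in> connections E"
  shows "plaq_sum E (modulus E m) = (\<Sum>\<eta>\<in>plaquettes E. trace (hol m (steps (plaq_base \<eta>))))"
  unfolding plaq_sum_def
proof (intro sum.cong refl)
  fix \<eta> assume \<eta>: "\<eta> \<in> plaquettes E"
  note pl = plaquette_based[OF \<eta> plaq_base_in[OF \<eta>]]
  show "class_trace (holonomy (modulus E m) \<eta>) = trace (hol m (steps (plaq_base \<eta>)))"
    using class_trace_holonomy[OF refl gauge_equiv_refl[OF assms] pl(1)] pl(2)
    by (simp add: modulus_def)
qed

lemma edge_deriv_plaq_sum:
  assumes a: "a \<in> E" and W: "W \<in> antihermitian"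
  shows "edge_deriv E a W (\<lambda>m. plaq_sum E (modulus E m))
      (\<lambda>m. \<Sum>\<eta>\<in>plaquettes E. trace_deriv a (steps (plaq_base \<eta>)) W m)"
    and "edge_deriv E a W (\<lambda>m. \<Sum>\<eta>\<in>plaquettes E. trace_deriv a (steps (plaq_base \<eta>)) W m)
      (\<lambda>m. \<Sum>\<eta>\<in>plaquettes E. trace_deriv2 a (steps (plaq_base \<eta>)) W m)"
proof -
  show "edge_deriv E a W (\<lambda>m. plaq_sum E (modulus E m))
      (\<lambda>m. \<Sum>\<eta>\<in>plaquettes E. trace_deriv a (steps (plaq_base \<eta>)) W m)"
    by (rule edge_deriv_cong[OF edge_deriv_sum[OF edge_deriv_trace_deriv(1)[OF a W]] a W])
      (simp_all add: plaq_sum_eq)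
  show "edge_deriv E a W (\<lambda>m. \<Sum>\<eta>\<in>plaquettes E. trace_deriv a (steps (plaq_base \<eta>)) W m)
      (\<lambda>m. \<Sum>\<eta>\<in>plaquettes E. trace_deriv2 a (steps (plaq_base \<eta>)) W m)"
    by (rule edge_deriv_sum[OF edge_deriv_trace_deriv(2)[OF a W]])
qed

text \<open>Since only first derivatives occur, the two insertions lie on different loops, one of the
  collection and one plaquette, and only the merging rule is used.\<close>

lemma sum_plaq_deriv_loops_deriv:
  assumes m: "m \<in> connections E" and a: "a \<in> E" and B: "orthonormal_basis B"
  shows "- (\<Sum>W\<in>B. (\<Sum>\<eta>\<in>plaquettes E. trace_deriv a (steps (plaq_base \<eta>)) W m) * loops_deriv a bs W m) =
    (\<Sum>b\<in>{a, prod.swap a}. \<Sum>p\<in>crossings b bs.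
      (\<Sum>\<eta>\<in>plaquettes_at E b. trace (hol m (word_at bs p @ steps (start_at b \<eta>))) * rest_trace m bs {fst p}) -
      (\<Sum>\<eta>\<in>plaquettes_at E (prod.swap b).
        trace (hol m (tl (word_at bs p) @ tl (steps (start_at (prod.swap b) \<eta>)))) * rest_trace m bs {fst p}))"
proof -
  let ?w = "\<lambda>i. steps (bs ! i)" and ?v = "\<lambda>\<eta>. steps (plaq_base \<eta>)"
  let ?g = "\<lambda>p. (\<Sum>\<eta>\<in>plaquettes E. \<Sum>t'<length (plaq_base \<eta>). of_real (edge_sign a (?v \<eta> ! t')) *
      trace (hol m (cut_word a (?v \<eta>) t' @ cut_word a (?w (fst p)) (snd p)))) * rest_trace m bs {fst p}"
  have "- (\<Sum>W\<in>B. (\<Sum>\<eta>\<in>plaquettes E. trace_deriv a (?v \<eta>) W m) * loops_deriv a bs W m) =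
      - (\<Sum>i<length bs. \<Sum>\<eta>\<in>plaquettes E.
          (\<Sum>W\<in>B. trace_deriv a (?w i) W m * trace_deriv a (?v \<eta>) W m) * rest_trace m bs {i})"
    unfolding loops_deriv_def sum_product
    by (subst sum.swap, subst (2) sum.swap, intro arg_cong[of _ _ uminus] sum.cong refl, subst sum.swap)
      (simp add: sum_distrib_left sum_distrib_right ac_simps)
  also have "\<dots> = (\<Sum>i<length bs. \<Sum>t<length (bs ! i). of_real (edge_sign a (?w i ! t)) * ?g (i, t))"
    unfolding sum_trace_deriv_trace_deriv[OF B]
    by (simp add: sum_negf sum_distrib_left sum_distrib_right mult.assoc
        sum.swap[of _ "{..<length (bs ! _)}" "plaquettes E"])
  also have "\<dots> = (\<Sum>b\<in>{a, prod.swap a}. \<Sum>p\<in>crossings b bs.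
      (\<Sum>\<eta>\<in>plaquettes_at E b. trace (hol m (word_at bs p @ steps (start_at b \<eta>))) * rest_trace m bs {fst p}) -
      (\<Sum>\<eta>\<in>plaquettes_at E (prod.swap b).
        trace (hol m (tl (word_at bs p) @ tl (steps (start_at (prod.swap b) \<eta>)))) * rest_trace m bs {fst p}))"
  proof (rule sum_signed_positions[OF a], goal_cases)
    case (1 b p)
    have "b \<in> E" using 1(1) a swap_in_E[OF a] by blast
    then have neq: "prod.swap b \<noteq> b" "b \<noteq> prod.swap b" using swap_neq[of b] by auto
    obtain i t where p: "p = (i, t)" by (cases p)
    then have it: "i < length bs" "t < length (bs ! i)" "step_at bs (i, t) = b"
      using 1 by (auto simp: crossings_eq positions_def)
    let ?R = "word_at bs p"
    have R: "?R \<noteq> []" "?R ! 0 = b" using word_at_first[OF it(2)] it(3) p by simp_all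
    have cutR: "cut_word a (?w i) t = cut_word a ?R 0"
      using it(2) cut_word_rotate[of t "?w i"] by (simp add: word_at_conv p)
    let ?X = "\<lambda>\<zeta>. trace (hol m (?R @ steps \<zeta>))" and ?Y = "\<lambda>\<zeta>. trace (hol m (tl ?R @ tl (steps \<zeta>)))"
    have plaq: "of_real (edge_sign a b) * (\<Sum>t'<length (plaq_base \<eta>). of_real (edge_sign a (?v \<eta> ! t')) *
        trace (hol m (cut_word a (?v \<eta>) t' @ cut_word a (?w i) t))) =
      (if \<eta> \<in> plaquettes_at E b then ?X (start_at b \<eta>) else 0) -
      (if \<eta> \<in> plaquettes_at E (prod.swap b) then ?Y (start_at (prod.swap b) \<eta>) else 0)"
      if \<eta>: "\<eta> \<in> plaquettes E" for \<eta>
    proof -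
      let ?\<zeta> = "plaq_base \<eta>"
      have summand: "of_real (edge_sign a b) * (of_real (edge_sign a (?v \<eta> ! t')) *
          trace (hol m (cut_word a (?v \<eta>) t' @ cut_word a (?w i) t))) =
        (if edge_at ?\<zeta> t' = b then ?X (rotate t' ?\<zeta>) else 0) -
        (if edge_at ?\<zeta> t' = prod.swap b then ?Y (rotate t' ?\<zeta>) else 0)"
        if t': "t' < length ?\<zeta>" for t'
      proof -
        let ?Q = "steps (rotate t' ?\<zeta>)"
        have ne: "rotate t' ?\<zeta> \<noteq> []" using t' by auto
        then have Q: "?Q \<noteq> []" by (metis length_0_conv length_steps)
        have Q0: "?Q ! 0 = edge_at ?\<zeta> t'"
          unfolding steps_first(1)[OF ne] by (rule edge_at_rotate[OF t'])
        have cutQ: "cut_word a (?v \<eta>) t' = cut_word a ?Q 0"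
          using cut_word_rotate[of t' "?v \<eta>"] t' by (simp add: steps_rotate)
        have Qv: "?v \<eta> ! t' = ?Q ! 0" using Q0 t' by (simp add: nth_steps)
        show ?thesis
          unfolding cutR cutQ Qv merge_word[OF m a 1(1) R Q] using neq by (simp add: Q0)
      qed
      show ?thesis
        unfolding sum_plaquette_crossings[OF \<eta> plaq_base_in[OF \<eta>], of b ?X, symmetric]
          sum_plaquette_crossings[OF \<eta> plaq_base_in[OF \<eta>], of "prod.swap b" ?Y, symmetric]
          sum_subtractf[symmetric] sum_distrib_left
        by (intro sum.cong refl) (use summand in auto)
    qed
    have "of_real (edge_sign a b) * ?g p =
        (\<Sum>\<eta>\<in>plaquettes E. of_real (edge_sign a b) * (\<Sum>t'<length (plaq_base \<eta>).
          of_real (edge_sign a (?v \<eta> ! t')) *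
          trace (hol m (cut_word a (?v \<eta>) t' @ cut_word a (?w i) t)))) * rest_trace m bs {i}"
      unfolding p fst_conv snd_conv by (simp only: mult.assoc[symmetric] sum_distrib_left)
    also have "\<dots> = (\<Sum>\<eta>\<in>plaquettes E. (if \<eta> \<in> plaquettes_at E b then ?X (start_at b \<eta>) else 0) -
      (if \<eta> \<in> plaquettes_at E (prod.swap b) then ?Y (start_at (prod.swap b) \<eta>) else 0)) * rest_trace m bs {i}"
      by (simp only: plaq cong: sum.cong)
    also have "\<dots> = ((\<Sum>\<eta>\<in>plaquettes_at E b. ?X (start_at b \<eta>)) -
      (\<Sum>\<eta>\<in>plaquettes_at E (prod.swap b). ?Y (start_at (prod.swap b) \<eta>))) * rest_trace m bs {i}"
    proof -
      have "(\<Sum>\<eta>\<in>plaquettes E. if \<eta> \<in> plaquettes_at E c then G \<eta> else 0) = (\<Sum>\<eta>\<in>plaquettes_at E c. G \<eta>)"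
        for c and G :: "'v loop \<Rightarrow> complex"
        using sum.inter_restrict[OF finite_plaquettes, of G "plaquettes_at E c"]
        by (simp add: plaquettes_at_def Int_def conj_commute cong: conj_cong)
      then show ?thesis by (simp only: sum_subtractf)
    qed
    finally show ?case by (simp add: p left_diff_distrib sum_distrib_right)
  qed
  finally show ?thesis .
qed

end

section \<open>The kernels as sums over pairs of crossings\<close>

lemma expectation_pick_two:
  fixes F :: "'c \<Rightarrow> complex"
  assumes "finite X" "finite Y" "X \<noteq> {}" "Y \<noteq> {}"
  shows "of_nat (card X) * of_nat (card Y) *
      kernel_op (\<lambda>_. pmf_of_set X \<bind> (\<lambda>p. pmf_of_set Y \<bind> (\<lambda>q. return_pmf (r p q)))) F C =
    (\<Sum>p\<in>X. \<Sum>q\<in>Y. F (r p q))"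
proof -
  have fin: "finite (set_pmf (pmf_of_set Y \<bind> (\<lambda>q. return_pmf (r p q))))" for p
    using assms by (auto simp: set_bind_pmf)
  have inner: "measure_pmf.expectation (pmf_of_set Y \<bind> (\<lambda>q. return_pmf (r p q))) F
      = (\<Sum>q\<in>Y. F (r p q)) / of_nat (card Y)" for p
    using assms by (subst pmf_expectation_bind_pmf_of_set)
      (auto simp: sum_divide_distrib scaleR_conv_of_real field_simps)
  have "kernel_op (\<lambda>_. pmf_of_set X \<bind> (\<lambda>p. pmf_of_set Y \<bind> (\<lambda>q. return_pmf (r p q)))) F C
      = (\<Sum>p\<in>X. (\<Sum>q\<in>Y. F (r p q)) / of_nat (card Y) /\<^sub>R real (card X))"
    unfolding kernel_op_def using assms fin by (subst pmf_expectation_bind_pmf_of_set) (simp_all add: inner)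
  also have "\<dots> = (\<Sum>p\<in>X. \<Sum>q\<in>Y. F (r p q)) / (of_nat (card X) * of_nat (card Y))"
    by (simp add: sum_divide_distrib scaleR_conv_of_real field_simps)
  finally show ?thesis using assms by simp
qed

lemma set_tl_subset: "set (tl xs) \<subseteq> set xs"
  by (cases xs) auto

lemma image_mset_diff_one:
  assumes "finite I" "i \<in> I"
  shows "image_mset f (mset_set I) - {#f i#} = image_mset f (mset_set (I - {i}))"
  using assms by (simp add: mset_set.remove)

lemma image_mset_diff_two:
  assumes "finite I" "i \<in> I" "j \<in> I" "i \<noteq> j"
  shows "image_mset f (mset_set I) - {#f i, f j#} = image_mset f (mset_set (I - {i, j}))"
proof -
  have I: "I - {i, j} = I - {i} - {j}" by auto
  show ?thesis unfolding I using assms by (simp add: mset_set.remove[of I i] mset_set.remove[of "I - {i}" j])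
qed

locale loop_system = finite_graph E for E :: "('v \<times> 'v) set" +
  fixes A :: "('v, 'd::finite) connection set" and m :: "('v, 'd) connection"
    and C :: "'v loop multiset"
  assumes A_class: "\<exists>m0. A = gauge_equiv E `` {m0}" and m_in: "m \<in> A" and m_conn: "m \<in> connections E"
    and C_loops: "\<And>l. l \<in># C \<Longrightarrow> l \<in> loops E"
begin

definition bs :: "'v list list" where "bs = listing C"

lemma listing_loops: "image_mset loop_of (mset bs) = C"
proof -
  obtain ls where ls: "mset ls = C" using ex_mset by blast
  have "\<forall>l\<in>set ls. \<exists>\<xi>. loop_of \<xi> = l"
    using C_loops ls by (metis loops_obtain set_mset_mset)
  then obtain r where "\<forall>l\<in>set ls. loop_of (r l) = l" by metis
  then have "image_mset loop_of (mset (map r ls)) = C"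
    using ls by (auto simp: multiset.map_comp intro!: multiset.map_ident_strong)
  then show ?thesis unfolding bs_def listing_def by (rule someI)
qed

lemma listing_based:
  assumes "i < length bs"
  shows "bs ! i \<in> based_loops E"
proof -
  have "loop_of (bs ! i) \<in># C" using assms listing_loops by (metis image_eqI nth_mem set_image_mset set_mset_mset)
  then obtain \<xi> where \<xi>: "\<xi> \<in> based_loops E" "loop_of (bs ! i) = loop_of \<xi>"
    using C_loops by (metis loops_obtain)
  then have "bs ! i \<in> loop_of \<xi>" using self_in_loop_of[of "bs ! i"] by simp
  then show ?thesis using \<xi>(1) by (simp add: based_loops_iff loop_of_steps)
qed

text \<open>Kernels refer to loops by their place in the listing but remove them from the multiset. Indexing
  the multiset by places turns removal into a difference of index sets.\<close>

lemma collection_eq: "C = image_mset (\<lambda>i. loop_of (bs ! i)) (mset_set {..<length bs})"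
proof -
  have "mset bs = image_mset ((!) bs) (mset [0..<length bs])"
    by (metis map_nth mset_map)
  also have "mset [0..<length bs] = mset_set {..<length bs}"
    by (simp add: atLeast0LessThan mset_upt)
  finally show ?thesis using listing_loops by (simp add: multiset.map_comp comp_def)
qed

lemma class_trace_based:
  assumes "\<xi> \<in> based_loops E"
  shows "class_trace (holonomy A (loop_of \<xi>)) = trace (hol m (steps \<xi>))"
  using A_class class_trace_holonomy[OF _ m_in assms] by blast

lemma tau_plus: "tau A (X + Y) = tau A X * tau A Y"
  by (simp add: tau_def)

lemma tau_loop:
  assumes "set (steps \<xi>) \<subseteq> E"
  shows "tau A {#loop_of \<xi>#} = trace (hol m (steps \<xi>))"
  using assms by (simp add: tau_def class_trace_based based_loops_iff)

lemma tau_reduced: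
  assumes "set (steps \<xi>) \<subseteq> E"
  shows "tau A {#reduced (loop_of \<xi>)#} = trace (hol m (steps \<xi>))"
proof -
  have "\<xi> \<in> based_loops E" using assms by (simp add: based_loops_iff)
  then obtain \<zeta> where \<zeta>: "\<zeta> \<in> based_loops E" "reduced (loop_of \<xi>) = loop_of \<zeta>"
    "trace (hol m (steps \<zeta>)) = trace (hol m (steps \<xi>))"
    using reduced_trace[OF sym_E irrefl_E, of \<xi>] m_conn by metis
  then show ?thesis by (simp add: tau_def class_trace_based)
qed

lemma tau_pair: "tau A {#l, l'#} = tau A {#l#} * tau A {#l'#}"
  by (simp add: tau_def)

lemma tau_indices:
  assumes "J \<subseteq> {..<length bs}"
  shows "tau A (image_mset (\<lambda>i. loop_of (bs ! i)) (mset_set J)) = (\<Prod>i\<in>J. trace (hol m (steps (bs ! i))))"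
proof -
  have "tau A (image_mset (\<lambda>i. loop_of (bs ! i)) (mset_set J)) =
      (\<Prod>i\<in>J. class_trace (holonomy A (loop_of (bs ! i))))"
    by (simp add: tau_def prod_unfold_prod_mset multiset.map_comp comp_def)
  also have "\<dots> = (\<Prod>i\<in>J. trace (hol m (steps (bs ! i))))"
    using assms by (intro prod.cong refl class_trace_based listing_based) auto
  finally show ?thesis .
qed

lemma tau_collection: "tau A C = rest_trace m bs {}"
  by (subst collection_eq) (simp add: tau_indices rest_trace_def)

lemma tau_remove_one:
  assumes "i < length bs"
  shows "tau A (C - {#loop_of (bs ! i)#}) = rest_trace m bs {i}"
  using assms tau_indices[of "{..<length bs} - {i}"]
  by (subst collection_eq) (simp add: image_mset_diff_one[where f = "\<lambda>i. loop_of (bs ! i)"] rest_trace_def)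

lemma tau_remove_two:
  assumes "i < length bs" "i' < length bs" "i \<noteq> i'"
  shows "tau A (C - {#loop_of (bs ! i), loop_of (bs ! i')#}) = rest_trace m bs {i, i'}"
  using assms tau_indices[of "{..<length bs} - {i, i'}"]
  by (subst collection_eq) (simp add: image_mset_diff_two[where f = "\<lambda>i. loop_of (bs ! i)"] rest_trace_def)

lemma occ_eq: "occ e C = card (crossings e bs)"
proof -
  have "occ e C = (\<Sum>i<length bs. crossings_loop e (loop_of (bs ! i)))"
    unfolding occ_def by (subst collection_eq)
      (simp add: sum_unfold_sum_mset multiset.map_comp comp_def)
  also have "\<dots> = card (SIGMA i:{..<length bs}. {j. j < length (bs ! i) \<and> edge_at (bs ! i) j = e})"
    by (simp add: card_SigmaI crossings_loop_loop_of)
  also have "(SIGMA i:{..<length bs}. {j. j < length (bs ! i) \<and> edge_at (bs ! i) j = e}) = crossings e bs"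
    by (auto simp: crossings_def)
  finally show ?thesis .
qed

lemma finite_crossings: "finite (crossings e bs)"
  by (simp add: crossings_eq)

lemma crossing_rotate:
  assumes "p \<in> crossings e bs"
  defines "\<xi> \<equiv> rotate (snd p) (bs ! fst p)"
  shows "fst p < length bs" "snd p < length (bs ! fst p)" "\<xi> \<noteq> []" "steps \<xi> = word_at bs p"
    "set (steps \<xi>) \<subseteq> E" "edge_at \<xi> 0 = e" "word_at bs p = e # tl (word_at bs p)"
    "hd \<xi> = fst e" "length \<xi> = length (bs ! fst p)"
proof -
  show p: "fst p < length bs" "snd p < length (bs ! fst p)"
    using assms(1) by (auto simp: crossings_eq positions_def)
  show ne: "\<xi> \<noteq> []" using p unfolding \<xi>_def by auto
  show st: "steps \<xi> = word_at bs p" by (simp add: \<xi>_def word_at_def)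
  show "set (steps \<xi>) \<subseteq> E"
    using listing_based[OF p(1)] by (simp add: \<xi>_def steps_rotate based_loops_iff)
  show e0: "edge_at \<xi> 0 = e"
    using assms(1) p by (simp add: \<xi>_def edge_at_rotate crossings_eq step_at_def)
  show "hd \<xi> = fst e" using steps_first(2)[OF ne] e0 by simp
  show "length \<xi> = length (bs ! fst p)" by (simp add: \<xi>_def)
  have "word_at bs p \<noteq> []" "word_at bs p ! 0 = e"
    using ne steps_first(1)[OF ne] e0 by (auto simp flip: st simp: steps_def)
  then show "word_at bs p = e # tl (word_at bs p)" by (cases "word_at bs p") auto
qed

text \<open>Two crossings on the same loop: the word started at the first one, broken at the second.\<close>

lemma crossing_word_decomp:
  assumes p: "p \<in> crossings e bs" and q: "q \<in> crossings e' bs" and "fst p = fst q" "snd p \<noteq> snd q"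
  defines "s \<equiv> offset (bs ! fst p) (snd p) (snd q)" and "\<xi> \<equiv> rotate (snd p) (bs ! fst p)"
  shows "0 < s" "s < length \<xi>" "\<xi> ! s = fst e'"
    "word_at bs p = e # tl (take s (word_at bs p)) @ e' # drop (Suc s) (word_at bs p)"
proof -
  note P = crossing_rotate[OF p, folded \<xi>_def] and Q = crossing_rotate[OF q]
  have q2: "snd q < length (bs ! fst p)" using Q(2) assms(3) by simp
  show s0: "0 < s" using offset_eq_0_iff[OF P(2) q2] assms(4) by (auto simp: s_def)
  show s1: "s < length \<xi>" using offset_less[OF q2] P(9) by (simp add: s_def)
  have "word_at bs p ! s = steps (bs ! fst p) ! snd q"
    using nth_rotate_offset[OF P(2) q2, of "steps (bs ! fst p)"]
    by (simp add: s_def word_at_def steps_rotate)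
  also have "\<dots> = e'" using q q2 assms(3) by (simp add: nth_steps crossings_eq step_at_def)
  finally have es: "word_at bs p ! s = e'" .
  then show "\<xi> ! s = fst e'" using s1 by (auto simp flip: P(4) simp: nth_steps edge_at_def)
  have "word_at bs p = take s (word_at bs p) @ e' # drop (Suc s) (word_at bs p)"
    using id_take_nth_drop[of s "word_at bs p"] s1 es by (simp flip: P(4))
  moreover have "take s (word_at bs p) = e # tl (take s (word_at bs p))"
    by (subst (1 2) P(7)) (use s0 in \<open>cases s; simp\<close>)
  ultimately show "word_at bs p = e # tl (take s (word_at bs p)) @ e' # drop (Suc s) (word_at bs p)"
    by (metis append_Cons)
qed

definition plus_result :: "nat \<times> nat \<Rightarrow> nat \<times> nat \<Rightarrow> 'v loop multiset" where
  "plus_result p q =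
    (if fst p \<noteq> fst q then
       C - {#loop_of (bs ! fst p), loop_of (bs ! fst q)#}
         + {#loop_of (rotate (snd p) (bs ! fst p) @ rotate (snd q) (bs ! fst q))#}
     else if snd p \<noteq> snd q then
       let \<xi> = rotate (snd p) (bs ! fst p); t = offset \<xi> (snd p) (snd q) in
       C - {#loop_of (bs ! fst p)#} + {#loop_of (take t \<xi>), loop_of (drop t \<xi>)#}
     else C)"

lemma tau_plus_result:
  assumes p: "p \<in> crossings e bs" and q: "q \<in> crossings e bs"
  shows "tau A (plus_result p q) = plus_value m bs p q"
proof -
  define \<xi> \<zeta> where "\<xi> = rotate (snd p) (bs ! fst p)" and "\<zeta> = rotate (snd q) (bs ! fst q)"
  note P = crossing_rotate[OF p, folded \<xi>_def] and Q = crossing_rotate[OF q, folded \<zeta>_def]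
  consider "fst p \<noteq> fst q" | "fst p = fst q" "snd p \<noteq> snd q" | "p = q"
    by (cases p; cases q) auto
  then show ?thesis
  proof cases
    case 1
    have "steps (\<xi> @ \<zeta>) = word_at bs p @ word_at bs q"
      using steps_append[of \<xi> "fst e" \<zeta>] P Q by simp
    moreover have "set (steps (\<xi> @ \<zeta>)) \<subseteq> E" using calculation P(4,5) Q(4,5) by simp
    ultimately show ?thesis
      using 1 P(1) Q(1) unfolding plus_result_def plus_value_def \<xi>_def[symmetric] \<zeta>_def[symmetric]
      by (simp add: tau_plus tau_loop tau_remove_two del: union_mset_add_mset_right)
  next
    case 2
    define s where "s = offset (bs ! fst p) (snd p) (snd q)"
    note S = crossing_word_decomp[OF p q 2, folded s_def \<xi>_def]
    have "take s \<xi> \<noteq> []" "drop s \<xi> \<noteq> []" using S P(3) by auto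
    moreover have "hd (take s \<xi>) = fst e" "hd (drop s \<xi>) = fst e"
      using S P(8) by (simp_all add: hd_drop_conv_nth)
    ultimately have "steps (take s \<xi> @ drop s \<xi>) = steps (take s \<xi>) @ steps (drop s \<xi>)"
      by (intro steps_append)
    then have "word_at bs p = steps (take s \<xi>) @ steps (drop s \<xi>)" using P(4) by simp
    moreover have "length (steps (take s \<xi>)) = s" using S by simp
    ultimately have st: "steps (take s \<xi>) = take s (word_at bs p)" "steps (drop s \<xi>) = drop s (word_at bs p)"
      by auto
    have sub: "set (steps (take s \<xi>)) \<subseteq> E" "set (steps (drop s \<xi>)) \<subseteq> E"
      using P(4,5) set_take_subset[of s "word_at bs p"] set_drop_subset[of s "word_at bs p"]
      unfolding st by auto
    have off: "offset \<xi> (snd p) (snd q) = s" using P(9) by (simp add: offset_def s_def)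
    show ?thesis
      using 2 P(1) unfolding plus_result_def plus_value_def \<xi>_def[symmetric] Let_def off s_def[symmetric]
      by (simp add: tau_plus tau_pair tau_loop[OF sub(1)] tau_loop[OF sub(2)] tau_remove_one st
          del: union_mset_add_mset_right)
  next
    case 3
    then show ?thesis by (simp add: plus_result_def plus_value_def tau_collection)
  qed
qed

lemma kernel_plus:
  "(of_nat (occ e C))\<^sup>2 * kernel_op (K_plus e) (tau A) C =
    (\<Sum>p\<in>crossings e bs. \<Sum>q\<in>crossings e bs. plus_value m bs p q)"
proof (cases "crossings e bs = {}")
  case False
  have "K_plus e C = pmf_of_set (crossings e bs) \<bind> (\<lambda>p. pmf_of_set (crossings e bs) \<bind>
      (\<lambda>q. return_pmf (plus_result p q)))"
    unfolding K_plus_def Let_def bs_def[symmetric] plus_result_def by (simp add: case_prod_beta')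
  then have "kernel_op (K_plus e) (tau A) C = kernel_op (\<lambda>_. pmf_of_set (crossings e bs) \<bind>
      (\<lambda>p. pmf_of_set (crossings e bs) \<bind> (\<lambda>q. return_pmf (plus_result p q)))) (tau A) C"
    by (simp add: kernel_op_def)
  then show ?thesis
    using expectation_pick_two[OF finite_crossings[of e] finite_crossings[of e] False False, of plus_result "tau A" C]
    by (simp add: occ_eq power2_eq_square tau_plus_result cong: sum.cong)
qed (simp add: occ_eq)

definition minus_result :: "nat \<times> nat \<Rightarrow> nat \<times> nat \<Rightarrow> 'v loop multiset" where
  "minus_result p q =
    (if fst p = fst q then
       let \<xi> = rotate (snd p) (bs ! fst p); t = offset \<xi> (snd p) (snd q) in
       C - {#loop_of (bs ! fst p)#}
         + {#reduced (loop_of (tl (take t \<xi>))), reduced (loop_of (drop (Suc t) \<xi>))#}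
     else
       C - {#loop_of (bs ! fst p), loop_of (bs ! fst q)#}
         + {#reduced (loop_of (tl (rotate (snd p) (bs ! fst p)) @ tl (rotate (snd q) (bs ! fst q))))#})"

text \<open>The crossings that are cancelled are the first steps of the words, so dropping the first vertex
  of a list has the same effect as dropping the first letter of its word.\<close>

lemma tau_minus_result:
  assumes e: "e \<in> E" and p: "p \<in> crossings e bs" and q: "q \<in> crossings (prod.swap e) bs"
  shows "tau A (minus_result p q) = minus_value m bs p q"
proof -
  obtain x y where xy: "e = (x, y)" by (cases e)
  have "x \<noteq> y" using e irrefl_E by (auto simp: xy irrefl_def)
  define \<xi> \<zeta> where "\<xi> = rotate (snd p) (bs ! fst p)" and "\<zeta> = rotate (snd q) (bs ! fst q)"
  note P = crossing_rotate[OF p, folded \<xi>_def] and Q = crossing_rotate[OF q, folded \<zeta>_def]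
  show ?thesis
  proof (cases "fst p = fst q")
    case False
    have "steps (tl \<xi> @ tl \<zeta>) = tl (word_at bs p) @ tl (word_at bs q)"
      using P(4,7) Q(4,7) \<open>x \<noteq> y\<close> by (intro steps_cancel_between[of _ x y]) (simp_all add: xy)
    moreover have "set (tl (word_at bs p) @ tl (word_at bs q)) \<subseteq> E"
      using P(4,5) Q(4,5) set_tl_subset[of "word_at bs p"] set_tl_subset[of "word_at bs q"] by auto
    ultimately show ?thesis
      using False P(1) Q(1) unfolding minus_result_def minus_value_def \<xi>_def[symmetric] \<zeta>_def[symmetric]
      by (simp add: tau_plus tau_reduced tau_remove_two del: union_mset_add_mset_right)
  next
    case True
    have "snd p \<noteq> snd q"
    proof
      assume "snd p = snd q"
      then have "p = q" using True by (simp add: prod_eq_iff)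
      then show False using p q swap_neq[OF e] by (auto simp: crossings_eq)
    qed
    define s where "s = offset (bs ! fst p) (snd p) (snd q)"
    note S = crossing_word_decomp[OF p q True \<open>snd p \<noteq> snd q\<close>, folded s_def \<xi>_def]
    let ?u = "tl (take s (word_at bs p))" and ?v = "drop (Suc s) (word_at bs p)"
    have "length (word_at bs p) = length \<xi>" by (simp flip: P(4))
    then have lu: "length ?u = s - 1" using S by simp
    have "steps \<xi> = (x, y) # ?u @ (y, x) # ?v" using S(4) P(4) by (simp add: xy)
    from steps_cancel_inside[OF this] have st: "steps (tl (take s \<xi>)) = ?u" "steps (drop (Suc s) \<xi>) = ?v"
      unfolding lu using S(1) by (simp_all add: tl_take)
    have "set (word_at bs p) \<subseteq> E" using P(4,5) by simp
    then have sub: "set ?u \<subseteq> E" "set ?v \<subseteq> E" by (subst (asm) S(4), simp)+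
    have off: "offset \<xi> (snd p) (snd q) = s" using P(9) by (simp add: offset_def s_def)
    have "tau A {#reduced (loop_of (tl (take s \<xi>)))#} = trace (hol m ?u)"
      "tau A {#reduced (loop_of (drop (Suc s) \<xi>))#} = trace (hol m ?v)"
      using tau_reduced[of "tl (take s \<xi>)"] tau_reduced[of "drop (Suc s) \<xi>"] sub by (simp_all only: st)
    then show ?thesis
      using True P(1) unfolding minus_result_def minus_value_def \<xi>_def[symmetric] Let_def off s_def[symmetric]
      by (simp add: tau_plus tau_pair tau_remove_one del: union_mset_add_mset_right)
  qed
qed

lemma kernel_minus:
  assumes "e \<in> E"
  shows "of_nat (occ e C) * of_nat (occ (prod.swap e) C) * kernel_op (K_minus e) (tau A) C =
    (\<Sum>p\<in>crossings e bs. \<Sum>q\<in>crossings (prod.swap e) bs. minus_value m bs p q)"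
proof (cases "crossings e bs = {} \<or> crossings (prod.swap e) bs = {}")
  case False
  then have ne: "crossings e bs \<noteq> {}" "crossings (prod.swap e) bs \<noteq> {}" by auto
  have "K_minus e C = pmf_of_set (crossings e bs) \<bind> (\<lambda>p. pmf_of_set (crossings (prod.swap e) bs) \<bind>
      (\<lambda>q. return_pmf (minus_result p q)))"
    unfolding K_minus_def Let_def bs_def[symmetric] minus_result_def by (simp add: case_prod_beta')
  then have "kernel_op (K_minus e) (tau A) C = kernel_op (\<lambda>_. pmf_of_set (crossings e bs) \<bind>
      (\<lambda>p. pmf_of_set (crossings (prod.swap e) bs) \<bind> (\<lambda>q. return_pmf (minus_result p q)))) (tau A) C"
    by (simp add: kernel_op_def)
  then show ?thesis
    using expectation_pick_two[OF finite_crossings finite_crossings ne, of minus_result "tau A" C]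
    by (simp add: occ_eq tau_minus_result[OF assms] cong: sum.cong)
qed (auto simp: occ_eq)

lemma finite_plaquettes_at: "finite (plaquettes_at E e)"
  using finite_plaquettes by (simp add: plaquettes_at_def)

lemma kernel_deform_plus:
  assumes "plaquettes_at E e \<noteq> {}"
  shows "of_nat (card (plaquettes_at E e)) * of_nat (occ e C) * kernel_op (D_plus E e) (tau A) C =
    (\<Sum>p\<in>crossings e bs. \<Sum>\<eta>\<in>plaquettes_at E e.
      trace (hol m (word_at bs p @ steps (start_at e \<eta>))) * rest_trace m bs {fst p})"
proof (cases "crossings e bs = {}")
  case False
  let ?r = "\<lambda>p \<eta>. C - {#loop_of (bs ! fst p)#}
     + {#loop_of (rotate (snd p) (bs ! fst p) @ start_at e \<eta>)#}"
  have "D_plus E e C = pmf_of_set (crossings e bs) \<bind> (\<lambda>p. pmf_of_set (plaquettes_at E e) \<bind>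
      (\<lambda>\<eta>. return_pmf (?r p \<eta>)))"
    unfolding D_plus_def Let_def bs_def[symmetric] by (simp add: case_prod_beta')
  then have "kernel_op (D_plus E e) (tau A) C = kernel_op (\<lambda>_. pmf_of_set (crossings e bs) \<bind>
      (\<lambda>p. pmf_of_set (plaquettes_at E e) \<bind> (\<lambda>\<eta>. return_pmf (?r p \<eta>)))) (tau A) C"
    by (simp add: kernel_op_def)
  then have "of_nat (card (plaquettes_at E e)) * of_nat (occ e C) * kernel_op (D_plus E e) (tau A) C =
      (\<Sum>p\<in>crossings e bs. \<Sum>\<eta>\<in>plaquettes_at E e. tau A (?r p \<eta>))"
    using expectation_pick_two[OF finite_crossings finite_plaquettes_at False assms, of ?r "tau A" C]
    by (simp add: occ_eq mult.commute)
  also have "\<dots> = (\<Sum>p\<in>crossings e bs. \<Sum>\<eta>\<in>plaquettes_at E e.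
      trace (hol m (word_at bs p @ steps (start_at e \<eta>))) * rest_trace m bs {fst p})"
  proof (intro sum.cong refl)
    fix p \<eta> assume p: "p \<in> crossings e bs" and \<eta>: "\<eta> \<in> plaquettes_at E e"
    define \<xi> where "\<xi> = rotate (snd p) (bs ! fst p)"
    note P = crossing_rotate[OF p, folded \<xi>_def] and Q = start_at_props[OF \<eta>]
    have "steps (\<xi> @ start_at e \<eta>) = word_at bs p @ steps (start_at e \<eta>)"
      using steps_append[of \<xi> "fst e" "start_at e \<eta>"] P steps_first(2)[OF Q(2)] Q(3) by simp
    moreover have "set (steps (\<xi> @ start_at e \<eta>)) \<subseteq> E"
      using calculation P(4,5) Q(1) by (simp add: based_loops_iff)
    ultimately show "tau A (?r p \<eta>) =
        trace (hol m (word_at bs p @ steps (start_at e \<eta>))) * rest_trace m bs {fst p}"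
      using P(1) unfolding \<xi>_def[symmetric] by (simp add: tau_plus tau_loop tau_remove_one del: union_mset_add_mset_right)
  qed
  finally show ?thesis .
qed (simp add: occ_eq)

lemma kernel_deform_minus:
  assumes e: "e \<in> E" and "plaquettes_at E (prod.swap e) \<noteq> {}"
  shows "of_nat (card (plaquettes_at E (prod.swap e))) * of_nat (occ e C) * kernel_op (D_minus E e) (tau A) C =
    (\<Sum>p\<in>crossings e bs. \<Sum>\<eta>\<in>plaquettes_at E (prod.swap e).
      trace (hol m (tl (word_at bs p) @ tl (steps (start_at (prod.swap e) \<eta>)))) * rest_trace m bs {fst p})"
proof (cases "crossings e bs = {}")
  case False
  let ?r = "\<lambda>p \<eta>. C - {#loop_of (bs ! fst p)#}
     + {#reduced (loop_of (tl (rotate (snd p) (bs ! fst p)) @ tl (start_at (prod.swap e) \<eta>)))#}"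
  have "D_minus E e C = pmf_of_set (crossings e bs) \<bind> (\<lambda>p. pmf_of_set (plaquettes_at E (prod.swap e)) \<bind>
      (\<lambda>\<eta>. return_pmf (?r p \<eta>)))"
    unfolding D_minus_def Let_def bs_def[symmetric] by (simp add: case_prod_beta')
  then have "kernel_op (D_minus E e) (tau A) C = kernel_op (\<lambda>_. pmf_of_set (crossings e bs) \<bind>
      (\<lambda>p. pmf_of_set (plaquettes_at E (prod.swap e)) \<bind> (\<lambda>\<eta>. return_pmf (?r p \<eta>)))) (tau A) C"
    by (simp add: kernel_op_def)
  then have "of_nat (card (plaquettes_at E (prod.swap e))) * of_nat (occ e C) * kernel_op (D_minus E e) (tau A) C =
      (\<Sum>p\<in>crossings e bs. \<Sum>\<eta>\<in>plaquettes_at E (prod.swap e). tau A (?r p \<eta>))"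
    using expectation_pick_two[OF finite_crossings finite_plaquettes_at False assms(2), of ?r "tau A" C]
    by (simp add: occ_eq mult.commute)
  also have "\<dots> = (\<Sum>p\<in>crossings e bs. \<Sum>\<eta>\<in>plaquettes_at E (prod.swap e).
      trace (hol m (tl (word_at bs p) @ tl (steps (start_at (prod.swap e) \<eta>)))) * rest_trace m bs {fst p})"
  proof (intro sum.cong refl)
    fix p \<eta> assume p: "p \<in> crossings e bs" and \<eta>: "\<eta> \<in> plaquettes_at E (prod.swap e)"
    obtain x y where xy: "e = (x, y)" by (cases e)
    have "x \<noteq> y" using e irrefl_E by (auto simp: xy irrefl_def)
    define \<xi> where "\<xi> = rotate (snd p) (bs ! fst p)"
    note P = crossing_rotate[OF p, folded \<xi>_def] and Q = start_at_props[OF \<eta>]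
    let ?\<zeta> = "start_at (prod.swap e) \<eta>"
    have "steps ?\<zeta> \<noteq> []" using Q(2) by (metis length_0_conv length_steps)
    then have "steps ?\<zeta> = prod.swap e # tl (steps ?\<zeta>)"
      using Q(3) steps_first(1)[OF Q(2)] by (cases "steps ?\<zeta>") simp_all
    then have "steps (tl \<xi> @ tl ?\<zeta>) = tl (word_at bs p) @ tl (steps ?\<zeta>)"
      using P(4,7) \<open>x \<noteq> y\<close> by (intro steps_cancel_between[of _ x y]) (simp_all add: xy)
    moreover have "set (tl (word_at bs p) @ tl (steps ?\<zeta>)) \<subseteq> E"
      using P(4,5) Q(1) set_tl_subset[of "word_at bs p"] set_tl_subset[of "steps ?\<zeta>"]
      by (auto simp: based_loops_iff)
    ultimately show "tau A (?r p \<eta>) =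
        trace (hol m (tl (word_at bs p) @ tl (steps ?\<zeta>))) * rest_trace m bs {fst p}"
      using P(1) unfolding \<xi>_def[symmetric] by (simp add: tau_plus tau_reduced tau_remove_one del: union_mset_add_mset_right)
  qed
  finally show ?thesis .
qed (simp add: occ_eq)

end

section \<open>The identity on a finite graph\<close>

context finite_graph
begin

lemma orients_orientation:
  assumes "orientation E \<sigma>" "e \<in> edges E"
  shows "orients E e = {\<sigma> e, prod.swap (\<sigma> e)}" "\<sigma> e \<in> E"
proof -
  have \<sigma>: "\<sigma> e \<in> E" "{fst (\<sigma> e), snd (\<sigma> e)} = e"
    using assms by (auto simp: orientation_def orients_def)
  then show "\<sigma> e \<in> E" by simp
  obtain x y where xy: "\<sigma> e = (x, y)" by (cases "\<sigma> e")
  have "e = {x, y}" "(x, y) \<in> E" "(y, x) \<in> E"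
    using \<sigma> swap_in_E[OF \<sigma>(1)] by (simp_all add: xy)
  then have "orients E e = {(x, y), (y, x)}"
    unfolding orients_def by (auto simp: doubleton_eq_iff)
  then show "orients E e = {\<sigma> e, prod.swap (\<sigma> e)}" by (simp add: xy)
qed

lemma sum_edges_orients:
  fixes f :: "'v \<times> 'v \<Rightarrow> 'a::comm_monoid_add"
  shows "(\<Sum>e\<in>edges E. \<Sum>b\<in>orients E e. f b) = (\<Sum>b\<in>E. f b)"
proof -
  have edges: "edges E = (\<lambda>b. {fst b, snd b}) ` E" by (force simp: edges_def)
  have "orients E e = {b \<in> E. {fst b, snd b} = e}" for e by (auto simp: orients_def)
  then show ?thesis
    using sum.group[OF finite_E, of "edges E" "\<lambda>b. {fst b, snd b}" f] finite_E by (simp add: edges)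
qed

end

context loop_system
begin

lemma tau_modulus:
  assumes "m' \<in> connections E"
  shows "tau (modulus E m') C = rest_trace (m' :: ('v, 'd) connection) bs {}"
proof -
  interpret M: loop_system E "modulus E m'" m' C
    using assms C_loops gauge_equiv_refl[OF assms] by unfold_locales (auto simp: modulus_def)
  show ?thesis by (rule M.tau_collection)
qed

lemma V_plus_eq: "V_plus E C = (\<Sum>b\<in>E. (occ b C)\<^sup>2)"
  unfolding V_plus_def by (rule sum_edges_orients)

text \<open>An edge is counted once for each of its orientations, which accounts for the factor \<open>2\<close>.\<close>

lemma V_minus_eq:
  assumes "orientation E \<sigma>"
  shows "V_minus E C = (\<Sum>b\<in>E. occ b C * occ (prod.swap b) C)"
proof -
  have "(\<Sum>b\<in>E. occ b C * occ (prod.swap b) C) =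
      (\<Sum>e\<in>edges E. \<Sum>b\<in>orients E e. occ b C * occ (prod.swap b) C)"
    by (rule sum_edges_orients[symmetric])
  also have "\<dots> = (\<Sum>e\<in>edges E. 2 * (\<Prod>b\<in>orients E e. occ b C))"
  proof (intro sum.cong refl)
    fix e assume e: "e \<in> edges E"
    note o = orients_orientation[OF assms e]
    show "(\<Sum>b\<in>orients E e. occ b C * occ (prod.swap b) C) = 2 * (\<Prod>b\<in>orients E e. occ b C)"
      using swap_neq[OF o(2)] swap_neq[OF o(2), symmetric] unfolding o(1) by simp
  qed
  finally show ?thesis by (simp add: V_minus_def sum_distrib_left)
qed

text \<open>The sums over pairs are the rates times the kernels; splitting off the identity in each generator
  produces \<open>V\<^sup>+\<close> and \<open>V\<^sup>-\<close>.\<close>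

lemma casimir_conn_tau:
  assumes \<sigma>: "orientation E \<sigma>" and B: "orthonormal_basis B"
  shows "- casimir_conn B E \<sigma> (\<lambda>m'. tau (modulus E m') C) m =
      (of_nat CARD('d) - 1) * of_nat (S_op E C) * tau A C
    + of_nat (V_plus E C) * tau A C - of_nat (V_minus E C) * tau A C
    + B_SM_plus E (tau A) C - B_SM_minus E (tau A) C"
proof -
  let ?d = "of_nat CARD('d) :: complex" and ?N = "\<lambda>b. of_nat (occ b C) :: complex"
  let ?K = "\<lambda>b. kernel_op (K_plus b) (tau A) C" and ?K' = "\<lambda>b. kernel_op (K_minus b) (tau A) C"
  have "- casimir_conn B E \<sigma> (\<lambda>m'. tau (modulus E m') C) m =
      (\<Sum>e\<in>edges E. - casimir_edge B (\<sigma> e) (\<lambda>m'. tau (modulus E m') C) m)"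
    by (simp add: casimir_conn_def sum_negf)
  also have "\<dots> = (\<Sum>e\<in>edges E. \<Sum>b\<in>orients E e. \<Sum>p\<in>crossings b bs.
      (?d - 1) * rest_trace m bs {} + (\<Sum>q\<in>crossings b bs. plus_value m bs p q)
      - (\<Sum>q\<in>crossings (prod.swap b) bs. minus_value m bs p q))"
    by (intro sum.cong refl)
      (simp only: orients_orientation[OF \<sigma>] casimir_edge_loops[OF m_conn _ B tau_modulus])
  also have "\<dots> = (\<Sum>b\<in>E. \<Sum>p\<in>crossings b bs.
      (?d - 1) * rest_trace m bs {} + (\<Sum>q\<in>crossings b bs. plus_value m bs p q)
      - (\<Sum>q\<in>crossings (prod.swap b) bs. minus_value m bs p q))"
    by (rule sum_edges_orients)
  also have "\<dots> = (\<Sum>b\<in>E. (?d - 1) * ?N b * tau A C + (?N b)\<^sup>2 * ?K b - ?N b * ?N (prod.swap b) * ?K' b)"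
  proof (intro sum.cong refl)
    fix b assume b: "b \<in> E"
    show "(\<Sum>p\<in>crossings b bs. (?d - 1) * rest_trace m bs {} + (\<Sum>q\<in>crossings b bs. plus_value m bs p q)
        - (\<Sum>q\<in>crossings (prod.swap b) bs. minus_value m bs p q)) =
      (?d - 1) * ?N b * tau A C + (?N b)\<^sup>2 * ?K b - ?N b * ?N (prod.swap b) * ?K' b"
      unfolding kernel_plus kernel_minus[OF b] unfolding tau_collection occ_eq
      by (simp add: sum.distrib sum_subtractf)
  qed
  also have "\<dots> = (\<Sum>b\<in>E. (?d - 1) * ?N b * tau A C + (?N b)\<^sup>2 * tau A C - ?N b * ?N (prod.swap b) * tau A C
      + (?N b)\<^sup>2 * (?K b - tau A C) - ?N b * ?N (prod.swap b) * (?K' b - tau A C))"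
    by (intro sum.cong refl) (simp add: algebra_simps)
  also have "\<dots> = (?d - 1) * of_nat (S_op E C) * tau A C
    + of_nat (V_plus E C) * tau A C - of_nat (V_minus E C) * tau A C
    + B_SM_plus E (tau A) C - B_SM_minus E (tau A) C"
    by (simp add: sum.distrib sum_subtractf S_op_def V_plus_eq V_minus_eq[OF \<sigma>] B_SM_plus_def
        B_SM_minus_def sum_distrib_left sum_distrib_right)
  finally show ?thesis .
qed

text \<open>Both deformations choose among the same number \<open>N\<close> of plaquettes, so the identities in their
  generators cancel each other.\<close>

lemma Gamma_conn_tau:
  assumes \<sigma>: "orientation E \<sigma>" and B: "orthonormal_basis B"
    and plaq: "\<And>e. e \<in> E \<Longrightarrow> card (plaquettes_at E e) = N" and N: "0 < N"
  shows "- Gamma_conn B E \<sigma> (\<lambda>m'. plaq_sum E (modulus E m')) (\<lambda>m'. tau (modulus E m') C) m =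
      (\<Sum>e\<in>E. of_nat N * of_nat (occ e C) * (kernel_op (D_plus E e) (tau A) C - tau A C))
    - (\<Sum>e\<in>E. of_nat N * of_nat (occ e C) * (kernel_op (D_minus E e) (tau A) C - tau A C))"
proof -
  have ne: "plaquettes_at E e \<noteq> {}" if "e \<in> E" for e using plaq[OF that] N by auto
  have "- Gamma_conn B E \<sigma> (\<lambda>m'. plaq_sum E (modulus E m')) (\<lambda>m'. tau (modulus E m') C) m =
    (\<Sum>e\<in>edges E. - (\<Sum>W\<in>B. (\<Sum>\<eta>\<in>plaquettes E. trace_deriv (\<sigma> e) (steps (plaq_base \<eta>)) W m) *
      loops_deriv (\<sigma> e) bs W m))"
    unfolding sum_negf
  proof (intro arg_cong[of _ _ uminus] Gamma_conn_eq[OF m_conn _ B] conjI)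
    show "\<sigma> e \<in> E" if "e \<in> edges E" for e by (rule orients_orientation(2)[OF \<sigma> that])
    fix a W assume a: "a \<in> E" and "W \<in> B"
    then have W: "W \<in> antihermitian" using orthonormal_basis_antihermitian[OF B] by simp
    show "edge_deriv E a W (\<lambda>m. plaq_sum E (modulus E m))
        (\<lambda>m. \<Sum>\<eta>\<in>plaquettes E. trace_deriv a (steps (plaq_base \<eta>)) W m)"
      and "edge_deriv E a W (\<lambda>m. \<Sum>\<eta>\<in>plaquettes E. trace_deriv a (steps (plaq_base \<eta>)) W m)
        (\<lambda>m. \<Sum>\<eta>\<in>plaquettes E. trace_deriv2 a (steps (plaq_base \<eta>)) W m)"
      by (rule edge_deriv_plaq_sum[OF a W])+
    show "edge_deriv E a W (\<lambda>m'. tau (modulus E m') C) (loops_deriv a bs W)"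
      by (rule edge_deriv_cong[OF edge_deriv_loops(1)[OF a W] a W]) (simp_all add: tau_modulus)
    show "edge_deriv E a W (loops_deriv a bs W) (loops_deriv2 a bs W)"
      by (rule edge_deriv_loops(2)[OF a W])
  qed
  also have "\<dots> = (\<Sum>e\<in>edges E. \<Sum>b\<in>orients E e. \<Sum>p\<in>crossings b bs.
      (\<Sum>\<eta>\<in>plaquettes_at E b. trace (hol m (word_at bs p @ steps (start_at b \<eta>))) * rest_trace m bs {fst p}) -
      (\<Sum>\<eta>\<in>plaquettes_at E (prod.swap b).
        trace (hol m (tl (word_at bs p) @ tl (steps (start_at (prod.swap b) \<eta>)))) * rest_trace m bs {fst p}))"
    by (intro sum.cong refl)
      (simp only: orients_orientation[OF \<sigma>] sum_plaq_deriv_loops_deriv[OF m_conn _ B])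
  also have "\<dots> = (\<Sum>b\<in>E. \<Sum>p\<in>crossings b bs.
      (\<Sum>\<eta>\<in>plaquettes_at E b. trace (hol m (word_at bs p @ steps (start_at b \<eta>))) * rest_trace m bs {fst p}) -
      (\<Sum>\<eta>\<in>plaquettes_at E (prod.swap b).
        trace (hol m (tl (word_at bs p) @ tl (steps (start_at (prod.swap b) \<eta>)))) * rest_trace m bs {fst p}))"
    by (rule sum_edges_orients)
  also have "\<dots> = (\<Sum>b\<in>E. of_nat N * of_nat (occ b C) * kernel_op (D_plus E b) (tau A) C -
      of_nat N * of_nat (occ b C) * kernel_op (D_minus E b) (tau A) C)"
  proof (intro sum.cong refl)
    fix b assume b: "b \<in> E"
    show "(\<Sum>p\<in>crossings b bs.
      (\<Sum>\<eta>\<in>plaquettes_at E b. trace (hol m (word_at bs p @ steps (start_at b \<eta>))) * rest_trace m bs {fst p}) -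
      (\<Sum>\<eta>\<in>plaquettes_at E (prod.swap b).
        trace (hol m (tl (word_at bs p) @ tl (steps (start_at (prod.swap b) \<eta>)))) * rest_trace m bs {fst p})) =
      of_nat N * of_nat (occ b C) * kernel_op (D_plus E b) (tau A) C -
      of_nat N * of_nat (occ b C) * kernel_op (D_minus E b) (tau A) C"
      using kernel_deform_plus[OF ne[OF b]] kernel_deform_minus[OF b ne[OF swap_in_E[OF b]]]
      unfolding plaq[OF b] plaq[OF swap_in_E[OF b]] by (simp only: sum_subtractf)
  qed
  also have "\<dots> = (\<Sum>e\<in>E. of_nat N * of_nat (occ e C) * (kernel_op (D_plus E e) (tau A) C - tau A C))
    - (\<Sum>e\<in>E. of_nat N * of_nat (occ e C) * (kernel_op (D_minus E e) (tau A) C - tau A C))"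
    unfolding sum_subtractf[symmetric] by (intro sum.cong refl) (simp add: algebra_simps)
  finally show ?thesis .
qed

end

section \<open>Plaquettes of the discrete torus\<close>

definition nbr :: "nat \<Rightarrow> int ^ 'n \<Rightarrow> 'n \<Rightarrow> int \<Rightarrow> int ^ 'n" where
  "nbr L x i s = (\<chi> j. (x $ j + (if j = i then s else 0)) mod int L)"

lemma nbr_in_verts: "0 < L \<Longrightarrow> nbr L x i s \<in> torus_verts L"
  by (simp add: nbr_def torus_verts_def)

lemma nbr_back:
  assumes "x \<in> torus_verts L"
  shows "nbr L (nbr L x i s) i (- s) = x"
  using assms by (auto simp: vec_eq_iff nbr_def torus_verts_def mod_simps)

lemma nbr_commute: "nbr L (nbr L x i s) i' s' = nbr L (nbr L x i' s') i s"
  by (simp add: vec_eq_iff nbr_def mod_simps add.assoc add.commute)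

lemma torus_iff:
  assumes "0 < L"
  shows "(x, y) \<in> torus L \<longleftrightarrow> x \<in> torus_verts L \<and> (\<exists>i. \<exists>s\<in>{1, -1}. y = nbr L x i s)"
proof
  assume xy: "(x, y) \<in> torus L"
  then have V: "x \<in> torus_verts L" "y \<in> torus_verts L" by (auto simp: torus_def)
  obtain i where i: "\<forall>j. j \<noteq> i \<longrightarrow> y $ j = x $ j"
      "y $ i = (x $ i + 1) mod int L \<or> x $ i = (y $ i + 1) mod int L"
    using xy by (auto simp: torus_def)
  have mods: "x $ j mod int L = x $ j" "y $ j mod int L = y $ j" for j
    using V by (auto simp: torus_verts_def)
  from i(2) have "y = nbr L x i 1 \<or> y = nbr L x i (-1)"
  proof
    assume "x $ i = (y $ i + 1) mod int L"
    then have "y $ i = (x $ i + - 1) mod int L" by (simp add: mods mod_simps)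
    then show ?thesis using i(1) mods by (auto simp: vec_eq_iff nbr_def)
  qed (use i(1) mods in \<open>auto simp: vec_eq_iff nbr_def\<close>)
  then show "x \<in> torus_verts L \<and> (\<exists>i. \<exists>s\<in>{1, -1}. y = nbr L x i s)" using V by auto
next
  assume "x \<in> torus_verts L \<and> (\<exists>i. \<exists>s\<in>{1, -1}. y = nbr L x i s)"
  then obtain i s where x: "x \<in> torus_verts L" and s: "s = 1 \<or> s = -1" and y: "y = nbr L x i s" by auto
  have mods: "x $ j mod int L = x $ j" for j using x by (auto simp: torus_verts_def)
  have "\<forall>j. j \<noteq> i \<longrightarrow> y $ j = x $ j" by (simp add: y nbr_def mods)
  moreover have "y $ i = (x $ i + 1) mod int L \<or> x $ i = (y $ i + 1) mod int L"
    using s by (auto simp: y nbr_def mod_simps mods)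
  ultimately show "(x, y) \<in> torus L"
    using x nbr_in_verts[OF assms, of x i s] by (auto simp: torus_def y)
qed

text \<open>Four unit steps cannot wind around a torus of side at least \<open>5\<close>.\<close>

lemma small_shift_mod_eq:
  assumes "5 \<le> L" "0 \<le> a" "a < int L" "\<bar>s\<bar> \<le> 4" "(a + s) mod int L = a"
  shows "s = 0"
proof -
  have "(a + s) mod int L = a mod int L" using assms by simp
  then have "int L dvd s" by (simp add: mod_eq_dvd_iff)
  then show ?thesis using assms zdvd_imp_le[of "int L" "\<bar>s\<bar>"] by (cases "s = 0") auto
qed

lemma finite_torus: "finite (torus L :: ((int ^ 'n) \<times> (int ^ 'n)) set)"
proof (rule finite_subset)
  let ?F = "{f. \<forall>i::'n. f i \<in> {0..<int L}}"
  have "finite (PiE UNIV (\<lambda>_::'n. {0..<int L}))" by (rule finite_PiE) auto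
  then have "finite ?F" by (rule rev_finite_subset) auto
  moreover have "torus_verts L = (\<lambda>f. \<chi> i. f i) ` ?F"
  proof (intro equalityI subsetI)
    fix x :: "int ^ 'n" assume "x \<in> torus_verts L"
    then show "x \<in> (\<lambda>f. \<chi> i. f i) ` ?F"
      by (intro image_eqI[of _ _ "\<lambda>i. x $ i"]) (auto simp: torus_verts_def)
  qed (auto simp: torus_verts_def)
  ultimately show "finite (torus_verts L \<times> torus_verts L :: ((int ^ 'n) \<times> (int ^ 'n)) set)" by simp
qed (auto simp: torus_def)

lemma finite_graph_torus:
  assumes "5 \<le> L"
  shows "finite_graph (torus L :: ((int ^ 'n) \<times> (int ^ 'n)) set)"
proof
  show "finite (torus L :: ((int ^ 'n) \<times> (int ^ 'n)) set)" by (rule finite_torus)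
  show "sym (torus L :: ((int ^ 'n) \<times> (int ^ 'n)) set)"
  proof (rule symI)
    fix x y :: "int ^ 'n" assume xy: "(x, y) \<in> torus L"
    then obtain i where i: "\<forall>j. j \<noteq> i \<longrightarrow> y $ j = x $ j"
      "y $ i = (x $ i + 1) mod int L \<or> x $ i = (y $ i + 1) mod int L"
      by (auto simp: torus_def)
    have "x \<in> torus_verts L" "y \<in> torus_verts L" using xy by (auto simp: torus_def)
    moreover have "\<forall>j. j \<noteq> i \<longrightarrow> x $ j = y $ j"
      "x $ i = (y $ i + 1) mod int L \<or> y $ i = (x $ i + 1) mod int L"
      using i by metis+
    ultimately show "(y, x) \<in> torus L"
      unfolding torus_def mem_Collect_eq prod.case by (intro conjI exI[of _ i])
  qed
  show "irrefl (torus L :: ((int ^ 'n) \<times> (int ^ 'n)) set)"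
  proof (unfold irrefl_def, intro allI notI)
    have L0: "0 < L" using assms by simp
    fix x :: "int ^ 'n" assume "(x, x) \<in> torus L"
    then obtain i s where x: "x \<in> torus_verts L" and s: "s \<in> {1, -1}" and eq: "x = nbr L x i s"
      unfolding torus_iff[OF L0] by blast
    have "nbr L x i s $ i = x $ i" by (simp only: eq[symmetric])
    then have "s = 0"
      using s x by (intro small_shift_mod_eq[OF assms, of "x $ i" s]) (auto simp: nbr_def torus_verts_def)
    then show False using s by auto
  qed
qed

text \<open>A closed path of four unit steps does not wind around the torus, so its displacement vanishes
  in each coordinate. The first step can then be undone by the third one only, as the second and the
  fourth are adjacent to it and would backtrack; in the same way the fourth step undoes the second.\<close>

lemma torus_square:
  fixes x :: "int ^ 'n"
  assumes L: "5 \<le> L" and x: "x \<in> torus_verts L"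
    and s: "s1 \<in> {1, -1}" "s2 \<in> {1, -1}" "s3 \<in> {1, -1}" "s4 \<in> {1, -1}"
    and y: "y = nbr L x i1 s1" and z: "z = nbr L y i2 s2" and w: "w = nbr L z i3 s3"
    and closing: "x = nbr L w i4 s4" and "z \<noteq> x" "w \<noteq> y"
  shows "i2 \<noteq> i1" "w = nbr L x i2 s2"
proof -
  have V: "y \<in> torus_verts L" "z \<in> torus_verts L" "w \<in> torus_verts L"
    using L by (simp_all add: y z w nbr_in_verts)
  have sum0: "(if j = i1 then s1 else 0) + (if j = i2 then s2 else 0) +
      (if j = i3 then s3 else 0) + (if j = i4 then s4 else 0) = 0" (is "?c j = 0") for j
  proof (rule small_shift_mod_eq[OF L])
    show "0 \<le> x $ j" "x $ j < int L" using x by (auto simp: torus_verts_def)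
    have "- 1 \<le> (if j = i then t else 0)" "(if j = i then t else 0) \<le> 1" if "t \<in> {1, -1}" for i and t :: int
      using that by auto
    from this[OF s(1), of i1] this[OF s(2), of i2] this[OF s(3), of i3] this[OF s(4), of i4]
    show "\<bar>?c j\<bar> \<le> 4" by linarith
    have "x $ j = nbr L (nbr L (nbr L (nbr L x i1 s1) i2 s2) i3 s3) i4 s4 $ j"
      using closing by (simp only: y z w)
    also have "\<dots> = (x $ j + ?c j) mod int L"
      by (simp add: nbr_def mod_simps add.assoc)
    finally show "(x $ j + ?c j) mod int L = x $ j" by simp
  qed
  have wx: "w = nbr L x i4 (- s4)" using nbr_back[OF V(3), of i4 s4] closing by simp
  have n12: "\<not> (i2 = i1 \<and> s2 = - s1)" using nbr_back[OF x, of i1 s1] \<open>z \<noteq> x\<close> by (auto simp: y z)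
  have n23: "\<not> (i3 = i2 \<and> s3 = - s2)" using nbr_back[OF V(1), of i2 s2] \<open>w \<noteq> y\<close> by (auto simp: z w)
  have n41: "\<not> (i4 = i1 \<and> s4 = - s1)" using wx \<open>w \<noteq> y\<close> by (auto simp: y)
  show i12: "i2 \<noteq> i1"
    using sum0[of i1] n12 n23 s by (auto split: if_splits)
  then have "i4 \<noteq> i1" using sum0[of i1] n41 s by (auto split: if_splits)
  then have "i3 = i1" using sum0[of i1] i12 s by (auto split: if_splits)
  then have "i4 = i2 \<and> s4 = - s2" using sum0[of i2] i12 s by (auto split: if_splits)
  then show "w = nbr L x i2 s2" using wx by simp
qed

lemma geodesic_distinct:
  assumes "distinct \<xi>" "3 \<le> length \<xi>"
  shows "geodesic (loop_of \<xi>)"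
  unfolding geodesic_def
proof (intro ballI allI impI)
  fix \<zeta> i assume "\<zeta> \<in> loop_of \<xi>" and i: "i < length \<zeta>"
  then have \<zeta>: "distinct \<zeta>" "3 \<le> length \<zeta>" using assms by (auto simp: loop_of_iff)
  define n where "n = length \<zeta>"
  have "Suc (Suc i mod n) mod n \<noteq> i"
    using i \<zeta>(2) by (auto simp: n_def[symmetric] mod_Suc)
  moreover have "0 < n" using \<zeta>(2) unfolding n_def by linarith
  then have "Suc (Suc i mod n) mod n < n" by simp
  ultimately have "\<zeta> ! (Suc (Suc i mod n) mod n) \<noteq> \<zeta> ! i"
    using \<zeta>(1) i by (simp add: nth_eq_iff_index_eq n_def)
  then show "edge_at \<zeta> (Suc i mod length \<zeta>) \<noteq> prod.swap (edge_at \<zeta> i)"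
    by (simp add: edge_at_def n_def)
qed

text \<open>A square on the edge \<open>(x, y)\<close> is determined by the direction, other than that of the edge, and the
  sign of its second step.\<close>

lemma card_plaquettes_at_torus:
  fixes e :: "(int ^ 'n) \<times> (int ^ 'n)"
  assumes L: "5 \<le> L" and e: "e \<in> torus L"
  shows "card (plaquettes_at (torus L) e) = 2 * (CARD('n) - 1)"
proof -
  interpret finite_graph "torus L :: ((int ^ 'n) \<times> (int ^ 'n)) set" by (rule finite_graph_torus[OF L])
  have L0: "0 < L" using L by simp
  obtain x y where xy: "e = (x, y)" by (cases e)
  obtain i0 s0 where x: "x \<in> torus_verts L" and s0: "s0 \<in> {1, -1}" and y: "y = nbr L x i0 s0"
    using e unfolding xy torus_iff[OF L0] by blast
  define I where "I = (UNIV - {i0}) \<times> {1, -1 :: int}"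
  define sq where "sq = (\<lambda>(i, s). [x, y, nbr L y i s, nbr L x i s])"
  have yV: "y \<in> torus_verts L" by (simp add: y nbr_in_verts[OF L0])
  have mods: "x $ j mod int L = x $ j" for j using x by (auto simp: torus_verts_def)
  have moved: "(x $ j + s) mod int L \<noteq> x $ j" if "s \<in> {1, -1}" for j s
  proof
    assume "(x $ j + s) mod int L = x $ j"
    then have "s = 0" using that x by (intro small_shift_mod_eq[OF L]) (auto simp: torus_verts_def)
    then show False using that by auto
  qed
  have "inj_on sq I"
  proof (rule inj_onI)
    fix a b assume ab: "a \<in> I" "b \<in> I" "sq a = sq b"
    obtain i s i' s' where ab_def: "a = (i, s)" "b = (i', s')" by (cases a, cases b)
    have eq: "nbr L x i s $ j = nbr L x i' s' $ j" for j using ab by (simp add: sq_def ab_def)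
    have s: "s \<in> {1, -1}" "s' \<in> {1, -1}" using ab by (auto simp: I_def ab_def)
    have "i = i'"
    proof (rule ccontr)
      assume "i \<noteq> i'"
      then have "(x $ i + s) mod int L = x $ i" using eq[of i] by (simp add: nbr_def mods)
      then show False using moved[OF s(1)] by simp
    qed
    moreover have "(x $ i + s) mod int L = (x $ i + s') mod int L"
      using eq[of i] \<open>i = i'\<close> by (simp add: nbr_def)
    then have "int L dvd s - s'" by (simp add: mod_eq_dvd_iff)
    then have "s = s'" using L s zdvd_imp_le[of "int L" "\<bar>s - s'\<bar>"] by auto
    ultimately show "a = b" by (simp add: ab_def)
  qed
  then have cardQ: "card (sq ` I) = 2 * (CARD('n) - 1)"
    by (simp add: card_image I_def card_cartesian_product card_Diff_singleton)
  have plaq: "loop_of (sq a) \<in> plaquettes (torus L)" "edge_at (sq a) 0 = e" "length (sq a) = 4"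
    if a: "a \<in> I" for a
  proof -
    obtain i s where is_a: "a = (i, s)" "i \<noteq> i0" "s \<in> {1, -1}" using a by (auto simp: I_def)
    let ?z = "nbr L y i s" and ?w = "nbr L x i s"
    have sq: "sq a = [x, y, ?z, ?w]" by (simp add: sq_def is_a)
    have edge: "(u, nbr L u j t) \<in> torus L" if "u \<in> torus_verts L" "t \<in> {1, -1}" for u j t
      unfolding torus_iff[OF L0] using that by blast
    have "?z = nbr L ?w i0 s0" unfolding y by (rule nbr_commute)
    then have E: "(x, y) \<in> torus L" "(y, ?z) \<in> torus L" "(?w, ?z) \<in> torus L" "(x, ?w) \<in> torus L"
      using edge[OF x s0, of i0] edge[OF yV is_a(3), of i] edge[OF x is_a(3), of i]
        edge[OF nbr_in_verts[OF L0, of x i s] s0, of i0]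
      by (simp_all only: y)
    then have E': "(?z, ?w) \<in> torus L" "(?w, x) \<in> torus L" using sym_E by (auto dest: symD)
    then have based: "sq a \<in> based_loops (torus L)" using E by (simp add: based_loops_iff steps_eq_walk sq)
    have "?z $ i \<noteq> x $ i" "?w $ i0 \<noteq> y $ i0"
      using moved[OF is_a(3), of i] moved[OF s0, of i0] is_a(2) by (simp_all add: y nbr_def mods)
    then have "?z \<noteq> x" "?w \<noteq> y" by auto
    moreover have "u \<noteq> v" if "(u, v) \<in> torus L" for u v :: "int ^ 'n"
      using irrefl_E that by (auto simp: irrefl_def)
    ultimately have "distinct (sq a)" using E E' by (auto simp: sq)
    then have "geodesic (loop_of (sq a))" by (rule geodesic_distinct) (simp add: sq)
    moreover have "loop_of (sq a) \<in> loops (torus L)"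
      using based unfolding loops_def loop_of_def by (rule quotientI)
    ultimately show "loop_of (sq a) \<in> plaquettes (torus L)"
      using loop_of_steps(2)[of _ "sq a"] by (auto simp: plaquettes_def geodesic_loops_def sq)
    show "edge_at (sq a) 0 = e" "length (sq a) = 4" by (simp_all add: sq edge_at_def xy)
  qed
  have start: "start_at e (loop_of (sq a)) = sq a" if a: "a \<in> I" for a
    using start_at_plaquette[OF plaq(1)[OF a] self_in_loop_of, of 0 e] plaq(2,3)[OF a] by simp
  have "bij_betw loop_of (sq ` I) (plaquettes_at (torus L) e)"
    unfolding bij_betw_def
  proof
    show "inj_on loop_of (sq ` I)"
      by (rule inj_on_inverseI[of _ "start_at e"]) (auto simp: start)
    show "loop_of ` sq ` I = plaquettes_at (torus L) e"
    proof (intro equalityI subsetI)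
      fix \<eta> assume "\<eta> \<in> loop_of ` sq ` I"
      then obtain a where a: "a \<in> I" "\<eta> = loop_of (sq a)" by auto
      then show "\<eta> \<in> plaquettes_at (torus L) e"
        using plaq[OF a(1)] plaquettes_at_iff[OF plaq(1)[OF a(1)] self_in_loop_of, of e]
        by (auto intro!: exI[of _ 0])
    next
      fix \<eta> assume \<eta>: "\<eta> \<in> plaquettes_at (torus L) e"
      note S = start_at_props[OF \<eta>]
      have \<eta>': "\<eta> \<in> plaquettes (torus L)" using \<eta> by (simp add: plaquettes_at_def)
      have "start_at e \<eta> \<in> \<eta>" using S(4) self_in_loop_of by metis
      note dist = plaquette_based(4)[OF \<eta>' this]
      obtain x' y' z w where "start_at e \<eta> = [x', y', z, w]"
        using S(5) by (auto simp: numeral_eq_Suc length_Suc_conv)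
      with S(3) have \<zeta>: "start_at e \<eta> = [x, y, z, w]" by (simp add: edge_at_def xy)
      have "(y, z) \<in> torus L" "(z, w) \<in> torus L" "(w, x) \<in> torus L"
        using S(1) by (auto simp: based_loops_iff steps_eq_walk \<zeta>)
      then obtain i2 s2 i3 s3 i4 s4 where
        s: "s2 \<in> {1, -1}" "s3 \<in> {1, -1}" "s4 \<in> {1, -1}" and
        z: "z = nbr L y i2 s2" and w: "w = nbr L z i3 s3" and closing: "x = nbr L w i4 s4"
        unfolding torus_iff[OF L0] by blast
      have "z \<noteq> x" "w \<noteq> y" using dist by (auto simp: \<zeta>)
      note square = torus_square[OF L x s0 s y z w closing this]
      have "(i2, s2) \<in> I" "start_at e \<eta> = sq (i2, s2)"
        using square s(1) by (simp_all add: I_def \<zeta> sq_def z)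
      then have "\<eta> = loop_of (sq (i2, s2))" "(i2, s2) \<in> I" using S(4) by simp_all
      then show "\<eta> \<in> loop_of ` sq ` I" by blast
    qed
  qed
  then show ?thesis using cardQ by (simp add: bij_betw_same_card)
qed

section \<open>The identity on the torus\<close>

theorem theorem6p1:
  fixes L :: nat and k :: real
    and C :: "(int ^ 'n) loop multiset"
    and A :: "(int ^ 'n, 'd::finite) connection set"
    and m :: "(int ^ 'n, 'd::finite) connection"
    and \<sigma> :: "(int ^ 'n) set \<Rightarrow> (int ^ 'n) \<times> (int ^ 'n)"
    and B :: "(complex ^ 'd ^ 'd) set"
  assumes "2 \<le> CARD('n)" and "5 \<le> L" and "0 < k"
    and "\<forall>l\<in>#C. l \<in> geodesic_loops (torus L)"
    and "A \<in> moduli (torus L)" and "m \<in> A"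
    and "orientation (torus L) \<sigma>" and "orthonormal_basis B"
  shows "- casimir_mod B (torus L) \<sigma> k (\<lambda>m'. tau (modulus (torus L) m') C) m =
      (of_nat CARD('d) - 1) * of_nat (S_op (torus L) C) * tau A C
    + of_nat (V_plus (torus L) C) * tau A C
    - of_nat (V_minus (torus L) C) * tau A C
    + B_SM_plus (torus L) (tau A) C
    - B_SM_minus (torus L) (tau A) C
    + of_real k / of_nat CARD('d) * (B_D_plus L (tau A) C - B_D_minus L (tau A) C)"
proof -
  interpret finite_graph "torus L :: ((int ^ 'n) \<times> (int ^ 'n)) set" by (rule finite_graph_torus[OF assms(2)])
  obtain m0 where m0: "A = gauge_equiv (torus L) `` {m0}"
    using assms(5) by (auto simp: moduli_def quotient_def)
  interpret loop_system "torus L :: ((int ^ 'n) \<times> (int ^ 'n)) set" A m C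
  proof
    show "\<exists>m0. A = gauge_equiv (torus L) `` {m0}" using m0 by blast
    show "m \<in> A" by fact
    show "m \<in> connections (torus L)" using assms(6) m0 by (auto simp: gauge_equiv_def)
    show "l \<in> loops (torus L)" if "l \<in># C" for l
      using assms(4) that by (auto simp: geodesic_loops_def)
  qed
  let ?N = "2 * (CARD('n) - 1)"
  have N: "(of_nat ?N :: complex) = 2 * (of_nat CARD('n) - 1)" using assms(1) by (simp add: of_nat_diff)
  have "- Gamma_conn B (torus L) \<sigma> (\<lambda>m'. plaq_sum (torus L) (modulus (torus L) m'))
      (\<lambda>m'. tau (modulus (torus L) m') C) m = B_D_plus L (tau A) C - B_D_minus L (tau A) C"
    unfolding B_D_plus_def B_D_minus_def N[symmetric]
    using assms(1) by (intro Gamma_conn_tau[OF assms(7,8)] card_plaquettes_at_torus[OF assms(2)]) simp_all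
  then have "of_real k / of_nat CARD('d) * (B_D_plus L (tau A) C - B_D_minus L (tau A) C) =
      - (of_real k / of_nat CARD('d) * Gamma_conn B (torus L) \<sigma>
          (\<lambda>m'. plaq_sum (torus L) (modulus (torus L) m')) (\<lambda>m'. tau (modulus (torus L) m') C) m)"
    by (simp only: mult_minus_right[symmetric])
  then show ?thesis
    unfolding casimir_conn_tau[OF assms(7,8), symmetric] casimir_mod_def by simp
qed

end
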